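(* Let $G$ be a finite group, let $\Bbbk$ be a field of characteristic $0$ over which every ordinary representation of $G$ is defined, and let $\alpha : G \to \Bbbk^{\times}$ be a multiplicative character. Then $\mathcal{L}_{\alpha}(G) = \mathcal{M}_{\alpha}(G)$ as Lie subalgebras of $\Bbbk G$. In particular, $\mathcal{L}_{\alpha}(G)$ is a reductive Lie algebra. The center of $\mathcal{L}_{\alpha}(G)$ is generated (as a vector space) by the elements $T_c - \alpha(c) T_{c^{-1}}$, where $c$ runs over the conjugacy classes of $G$ such that either $\alpha(c) \neq 1$, or $\alpha(c) = 1$ and $c \neq c^{-1}$.
   Context: The group algebra $\Bbbk G$ is a Lie algebra for $[a,b]=ab-ba$. $\widehat{G}$ denotes the set of irreducible representations of $G$ over $\Bbbk$ up to isomorphism, so that, as algebras and as Lie algebras, $\Bbbk G = \bigoplus_{V\in\widehat{G}} \mathfrak{gl}(V)$ (with $\mathfrak{gl}(V)=\mathrm{End}(V)$). For a conjugacy class $c$ of $G$, $T_c \in \Bbbk G$ is the sum of all elements of $c$, $c^{-1}=\{g^{-1} : g\in c\}$, and $\alpha(c)$ is the common value of $\alpha$ on $c$. $\mathcal{L}_{\alpha}(G)$ is the Lie subalgebra of $\Bbbk G$ linearly spanned by the elements $g-\alpha(g)g^{-1}$, $g \in G$. $\mathcal{M}_{\alpha}(G)$ is defined as follows. Consider on $\widehat{G}$ the equivalence relation generated by $V \sim V^*\otimes \alpha$; each class has cardinality $1$ or $2$. Let $\widehat{G}_\alpha^{even}$ (resp. $\widehat{G}_\alpha^{odd}$) be the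 set of classes of cardinality $1$ (resp. $2$). - If $V \simeq V^*\otimes\alpha$ (equivalently $\alpha \hookrightarrow V\otimes V$), there is a nondegenerate bilinear form $\langle\cdot,\cdot\rangle$ on $V$, unique up to scalar, with $\langle gv,gw\rangle=\alpha(g)\langle v,w\rangle$ for all $g \in G$; set $\mathfrak{osp}_\alpha(V)=\{x\in\mathfrak{gl}(V) : \langle xv,w\rangle+\langle v,xw\rangle=0 \ \forall v,w\in V\}$. - If $V\not\simeq V^*\otimes\alpha$, let $\mathfrak{gl}_\alpha(V)$ be the image of $\mathfrak{gl}(V)$ in $\mathfrak{gl}(V)\oplus\mathfrak{gl}(V^*\otimes\alpha)\subset \Bbbk G$ under $x\mapsto (x,-{}^t x)$, where the underlying vector space of $V^*\otimes\alpha$ is identified with $V^*$; it depends only on the class $\{V,V^*\otimes\alpha\}$. Then $\mathcal{M}_{\alpha}(G) = \left(\bigoplus_{V\in\widehat{G}_\alpha^{even}} \mathfrak{osp}_\alpha(V)\right)\oplus\left(\bigoplus_{V\in\widehat{G}_\alpha^{odd}} \mathfrak{gl}_\alpha(V)\right)\subset \Bbbk G$.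
   Formalization: The center formula fails for S_3, α=1, and is proved when no 2-dimensional irreducible V has a symmetric nondegenerate form with ⟨gv,gw⟩=α(g)⟨v,w⟩; in general the center is spanned by the elements T_c−α(c)T_{c^{-1}} together with osp_α(V) for all such V. *)

theory Defs
  imports
    "HOL-Library.Poly_Mapping"
    "HOL-Algebra.Algebraic_Closure_Type"
    "Jordan_Normal_Form.Matrix"
begin

section \<open>The group algebra and its Lie structure\<close>

text \<open>
  A finite group is a type of class \<open>{finite, group_add}\<close>. This class does not assume
  commutativity; the group law is written \<open>g + h\<close>, the unit \<open>0\<close> and the inverse \<open>- g\<close>.
  The ring \<open>'g \<Rightarrow>\<^sub>0 'k\<close>, whose product is convolution, is then the group algebra.
\<close>

type_synonym ('g, 'k) group_algebra = "'g \<Rightarrow>\<^sub>0 'k"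

definition basis_elem :: "'g \<Rightarrow> ('g, 'k::zero_neq_one) group_algebra" where
  "basis_elem g = Poly_Mapping.single g 1"

definition ga_scale :: "'k \<Rightarrow> ('g, 'k::field) group_algebra \<Rightarrow> ('g, 'k) group_algebra" where
  "ga_scale c a = Poly_Mapping.map ((*) c) a"

lemma lookup_ga_scale [simp]:
  "Poly_Mapping.lookup (ga_scale c a) g = c * Poly_Mapping.lookup a g"
  by (simp add: ga_scale_def map.rep_eq when_def)

global_interpretation ga: vector_space ga_scale
  by unfold_locales (auto intro!: poly_mapping_eqI simp: lookup_add algebra_simps)

definition lie_bracket :: "('g::group_add, 'k::field) group_algebra \<Rightarrow>
    ('g, 'k) group_algebra \<Rightarrow> ('g, 'k) group_algebra" where
  "lie_bracket a b = a * b - b * a"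

definition lie_subalgebra :: "('g::group_add, 'k::field) group_algebra set \<Rightarrow> bool" where
  "lie_subalgebra L \<longleftrightarrow> ga.subspace L \<and> (\<forall>a\<in>L. \<forall>b\<in>L. lie_bracket a b \<in> L)"

definition lie_ideal :: "('g::group_add, 'k::field) group_algebra set \<Rightarrow>
    ('g, 'k) group_algebra set \<Rightarrow> bool" where
  "lie_ideal L I \<longleftrightarrow> ga.subspace I \<and> I \<subseteq> L \<and> (\<forall>a\<in>L. \<forall>b\<in>I. lie_bracket a b \<in> I)"

definition lie_center :: "('g::group_add, 'k::field) group_algebra set \<Rightarrow>
    ('g, 'k) group_algebra set" where
  "lie_center L = {z \<in> L. \<forall>a\<in>L. lie_bracket z a = 0}"

text \<open>
  Bourbaki's definition of a reductive Lie algebra: the adjoint representation, whose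
  subrepresentations are the ideals, is semisimple.
\<close>

definition lie_reductive :: "('g::group_add, 'k::field) group_algebra set \<Rightarrow> bool" where
  "lie_reductive L \<longleftrightarrow> lie_subalgebra L \<and>
     (\<forall>I. lie_ideal L I \<longrightarrow>
        (\<exists>J. lie_ideal L J \<and> I \<inter> J = {0} \<and> {a + b | a b. a \<in> I \<and> b \<in> J} = L))"

section \<open>Representations\<close>

text \<open>
  Finite-dimensional representations are given in coordinates, as homomorphisms into square
  matrices.
\<close>

definition rep_dim :: "('g::group_add \<Rightarrow> 'k mat) \<Rightarrow> nat" where
  "rep_dim V = dim_row (V 0)"

definition representation :: "('g::group_add \<Rightarrow> 'k::field mat) \<Rightarrow> bool" where
  "representation V \<longleftrightarrow>
     (\<forall>g. V g \<in> carrier_mat (rep_dim V) (rep_dim V)) \<and>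
     V 0 = 1\<^sub>m (rep_dim V) \<and>
     (\<forall>g h. V (g + h) = V g * V h)"

definition vec_subspace :: "nat \<Rightarrow> 'k::field vec set \<Rightarrow> bool" where
  "vec_subspace n W \<longleftrightarrow> W \<subseteq> carrier_vec n \<and> 0\<^sub>v n \<in> W \<and>
     (\<forall>v\<in>W. \<forall>w\<in>W. v + w \<in> W) \<and> (\<forall>c. \<forall>v\<in>W. c \<cdot>\<^sub>v v \<in> W)"

definition irreducible_rep :: "('g::group_add \<Rightarrow> 'k::field mat) \<Rightarrow> bool" where
  "irreducible_rep V \<longleftrightarrow> representation V \<and> rep_dim V \<noteq> 0 \<and>
     (\<forall>W. vec_subspace (rep_dim V) W \<and> (\<forall>g. \<forall>w\<in>W. V g *\<^sub>v w \<in> W) \<longrightarrow>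
        W = {0\<^sub>v (rep_dim V)} \<or> W = carrier_vec (rep_dim V))"

definition rep_iso :: "('g::group_add \<Rightarrow> 'k::field mat) \<Rightarrow> ('g \<Rightarrow> 'k mat) \<Rightarrow> bool" where
  "rep_iso V W \<longleftrightarrow> rep_dim V = rep_dim W \<and>
     (\<exists>P \<in> carrier_mat (rep_dim V) (rep_dim V).
        invertible_mat P \<and> (\<forall>g. P * V g = W g * P))"

text \<open>A representation over the algebraic closure of \<open>'k\<close> is defined over \<open>'k\<close>.\<close>

definition defined_over_base :: "('g::group_add \<Rightarrow> 'k::field alg_closure mat) \<Rightarrow> bool" where
  "defined_over_base V \<longleftrightarrow>
     (\<exists>W :: 'g \<Rightarrow> 'k mat. representation W \<and> rep_iso V (\<lambda>g. map_mat to_ac (W g)))"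

definition mult_character :: "('g::group_add \<Rightarrow> 'k::field) \<Rightarrow> bool" where
  "mult_character \<alpha> \<longleftrightarrow> (\<forall>g. \<alpha> g \<noteq> 0) \<and> (\<forall>g h. \<alpha> (g + h) = \<alpha> g * \<alpha> h)"

text \<open>\<open>V\<^sup>* \<otimes> \<alpha>\<close>, written in the basis dual to the standard basis of \<open>V\<close>.\<close>

definition twisted_dual ::
    "('g::group_add \<Rightarrow> 'k::field) \<Rightarrow> ('g \<Rightarrow> 'k mat) \<Rightarrow> 'g \<Rightarrow> 'k mat" where
  "twisted_dual \<alpha> V = (\<lambda>g. \<alpha> g \<cdot>\<^sub>m transpose_mat (V (- g)))"

text \<open>The linear extension of \<open>V\<close> to the group algebra.\<close>

definition rep_extend :: "('g::{finite, group_add} \<Rightarrow> 'k::field mat) \<Rightarrow>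
    ('g, 'k) group_algebra \<Rightarrow> 'k mat" where
  "rep_extend V a = mat (rep_dim V) (rep_dim V) (\<lambda>(i, j). \<Sum>g\<in>UNIV. Poly_Mapping.lookup a g * V g $$ (i, j))"

section \<open>The Lie algebras $\mathcal{L}_\alpha(G)$ and $\mathcal{M}_\alpha(G)$\<close>

definition L_alg :: "('g::{finite, group_add} \<Rightarrow> 'k::field) \<Rightarrow> ('g, 'k) group_algebra set" where
  "L_alg \<alpha> = ga.span {basis_elem g - ga_scale (\<alpha> g) (basis_elem (- g)) | g. True}"

definition invariant_form ::
    "('g::group_add \<Rightarrow> 'k::field) \<Rightarrow> ('g \<Rightarrow> 'k mat) \<Rightarrow> 'k mat \<Rightarrow> bool" where
  "invariant_form \<alpha> V B \<longleftrightarrow> B \<in> carrier_mat (rep_dim V) (rep_dim V) \<and> invertible_mat B \<and>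
     (\<forall>g. \<forall>v\<in>carrier_vec (rep_dim V). \<forall>w\<in>carrier_vec (rep_dim V).
        (V g *\<^sub>v v) \<bullet> (B *\<^sub>v (V g *\<^sub>v w)) = \<alpha> g * (v \<bullet> (B *\<^sub>v w)))"

definition osp_form :: "nat \<Rightarrow> 'k::field mat \<Rightarrow> 'k mat set" where
  "osp_form n B = {x \<in> carrier_mat n n. \<forall>v\<in>carrier_vec n. \<forall>w\<in>carrier_vec n.
     (x *\<^sub>v v) \<bullet> (B *\<^sub>v w) + v \<bullet> (B *\<^sub>v (x *\<^sub>v w)) = 0}"

text \<open>
  Under the isomorphism of the group algebra with the direct sum of the \<open>gl(W)\<close>, the sum of the
  blocks indexed by the members of \<open>S\<close> consists of the elements that act by \<open>0\<close> on every
  irreducible \<open>W\<close> not isomorphic to a member of \<open>S\<close>.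
\<close>

definition blocks :: "('g::{finite, group_add} \<Rightarrow> 'k::field mat) set \<Rightarrow>
    ('g, 'k) group_algebra set" where
  "blocks S = {a. \<forall>W. irreducible_rep W \<and> (\<forall>V\<in>S. \<not> rep_iso W V) \<longrightarrow>
     rep_extend W a = 0\<^sub>m (rep_dim W) (rep_dim W)}"

text \<open>
  For irreducible \<open>V\<close> the form is unique up to a scalar, so its choice is immaterial.
\<close>

definition osp_alg :: "('g::{finite, group_add} \<Rightarrow> 'k::field) \<Rightarrow> ('g \<Rightarrow> 'k mat) \<Rightarrow>
    ('g, 'k) group_algebra set" where
  "osp_alg \<alpha> V = {a \<in> blocks {V}.
     \<exists>B. invariant_form \<alpha> V B \<and> rep_extend V a \<in> osp_form (rep_dim V) B}"

definition gl_alg :: "('g::{finite, group_add} \<Rightarrow> 'k::field) \<Rightarrow> ('g \<Rightarrow> 'k mat) \<Rightarrow>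
    ('g, 'k) group_algebra set" where
  "gl_alg \<alpha> V = {a \<in> blocks {V, twisted_dual \<alpha> V}.
     \<exists>x \<in> carrier_mat (rep_dim V) (rep_dim V).
       rep_extend V a = x \<and> rep_extend (twisted_dual \<alpha> V) a = - transpose_mat x}"

text \<open>
  \<open>osp_alg \<alpha> V\<close> depends only on the isomorphism class of \<open>V\<close>, and \<open>gl_alg \<alpha> V\<close> only on the pair
  of classes of \<open>V\<close> and \<open>V\<^sup>* \<otimes> \<alpha>\<close>; hence \<open>V\<close> may run over all irreducible representations.
  Distinct summands lie in disjoint sets of blocks, so the sum is direct.
\<close>

definition M_alg :: "('g::{finite, group_add} \<Rightarrow> 'k::field) \<Rightarrow> ('g, 'k) group_algebra set" where
  "M_alg \<alpha> = ga.span
     ((\<Union>V \<in> {V. irreducible_rep V \<and> rep_iso V (twisted_dual \<alpha> V)}. osp_alg \<alpha> V) \<union>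
      (\<Union>V \<in> {V. irreducible_rep V \<and> \<not> rep_iso V (twisted_dual \<alpha> V)}. gl_alg \<alpha> V))"

section \<open>Central elements\<close>

definition conj_classes :: "'g::group_add set set" where
  "conj_classes = {{h + g + (- h) | h. True} | g. True}"

definition class_sum :: "'g set \<Rightarrow> ('g, 'k::field) group_algebra" where
  "class_sum c = (\<Sum>g\<in>c. basis_elem g)"

definition class_value :: "('g \<Rightarrow> 'k) \<Rightarrow> 'g set \<Rightarrow> 'k" where
  "class_value \<alpha> c = the_elem (\<alpha> ` c)"

definition class_elements :: "('g::{finite, group_add} \<Rightarrow> 'k::field) \<Rightarrow>
    ('g, 'k) group_algebra set" where
  "class_elements \<alpha> =
     {class_sum c - ga_scale (class_value \<alpha> c) (class_sum (uminus ` c)) | c.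
        c \<in> conj_classes \<and>
        (class_value \<alpha> c \<noteq> 1 \<or> class_value \<alpha> c = 1 \<and> c \<noteq> uminus ` c)}"

text \<open>
  The irreducible \<open>V\<close> of dimension 2 whose invariant form is symmetric. For such \<open>V\<close> the summand
  \<open>osp_alg \<alpha> V\<close> is an orthogonal Lie algebra in dimension 2. It is one-dimensional, hence central
  in \<open>L_alg \<alpha>\<close>, but is not in the span of the \<open>class_elements \<alpha>\<close>. Example: for the symmetric
  group of degree 3 and trivial \<open>\<alpha>\<close>, \<open>L_alg \<alpha>\<close> is the line through \<open>s - s\<^sup>-\<^sup>1\<close> with \<open>s\<close> a
  3-cycle, whereas every conjugacy class equals its inverse, so \<open>class_elements \<alpha>\<close> is empty.
\<close>

definition orthogonal_planes ::
    "('g::group_add \<Rightarrow> 'k::field) \<Rightarrow> ('g \<Rightarrow> 'k mat) set" where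
  "orthogonal_planes \<alpha> = {V. irreducible_rep V \<and> rep_dim V = 2 \<and>
     (\<exists>B. invariant_form \<alpha> V B \<and> transpose_mat B = B)}"

end

theory Submission
  imports Defs "Jordan_Normal_Form.Char_Poly"
begin

text \<open>
  The linear map \<open>\<sigma> g = \<alpha> g \<cdot> g\<^sup>-\<^sup>1\<close> is an involutive anti-automorphism of the group algebra, and
  \<open>L_alg \<alpha>\<close> is its eigenspace for \<open>-1\<close>. Since \<open>\<sigma>\<close> exchanges the blocks of \<open>V\<close> and \<open>V\<^sup>* \<otimes> \<alpha>\<close>, acting by
  transposition, cutting with the central idempotents gives the decomposition \<open>M_alg \<alpha>\<close>. An element
  of the center acts by scalars on the blocks of \<open>V\<close> unless \<open>V\<close> is an orthogonal plane, because the
  centralizer of an orthogonal or symplectic Lie algebra in itself vanishes except for \<open>so(2)\<close>; and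
  the central elements of the group algebra lying in \<open>L_alg \<alpha>\<close> are spanned by the antisymmetrized class sums.

  For reductivity, choose \<open>s g\<close> in the algebraic closure with \<open>(s g)\<^sup>2 = 1 / \<alpha> g\<close>. In the basis
  \<open>s g \<cdot> g\<close> the structure constants are \<open>1\<close> or \<open>-1\<close>, and the generators of \<open>L_alg \<alpha>\<close> act in the adjoint
  representation by multiples of rational skew-symmetric matrices. The associative algebra they
  generate is closed under transposition, so its trace form \<open>tr(a b\<^sup>T)\<close> is positive definite over the
  rationals; averaging a projection onto an ideal with dual bases for this form yields an
  equivariant projection over any extension field, which descends to the base field.
\<close>

section \<open>The group algebra and Maschke's theorem\<close>

text \<open>The Wedderburn isomorphism is never constructed: an identity in the group algebra is
  checked on all irreducible representations, which suffices by faithfulness. The hypothesis on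
  fields of definition concerns representations over the algebraic closure, whereas blocks are
  indexed by irreducible representations over the base field; the bridge is that the latter stay
  irreducible over the closure, so that Schur's lemma gives scalars in the base field. Reductivity
  is not read off from the summands, as this would require the structure theory of
  \<open>sl\<close>, \<open>so\<close> and \<open>sp\<close>. The base field carries no order, so
  positivity is available only over the rationals; this is why the adjoint representation must
  become rational. The choice of square root makes it skew as well: the rescaled \<open>g\<close>
  multiplies the rescaled basis by a signed permutation matrix, and the inverse of that matrix,
  which is its transpose, belongs to the \<sigma>-image of the rescaled \<open>g\<close>. The
  averaged projection restricts to the ideal as an invertible operator other than the identity in
  general, so the inverse of this restriction has to be composed with it.\<close>

lemma lookup_times_group:
  fixes a b :: "'g::{finite, group_add} \<Rightarrow>\<^sub>0 'k::semiring_0"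
  shows "Poly_Mapping.lookup (a * b) h
    = (\<Sum>g\<in>UNIV. Poly_Mapping.lookup a g * Poly_Mapping.lookup b (- g + h))"
proof -
  have eq: "h = g + q \<longleftrightarrow> - g + h = q" for g q
    by (metis add.assoc add_0 left_minus right_minus)
  have "(\<Sum>q. Poly_Mapping.lookup b q when h = g + q) = Poly_Mapping.lookup b (- g + h)" for g
    unfolding eq by simp
  then show ?thesis
    by (simp add: lookup_mult Sum_any.expand_superset[of UNIV])
qed

lemma lookup_basis_elem: "Poly_Mapping.lookup (basis_elem g) h = (if h = g then 1 else 0)"
  by (simp add: basis_elem_def lookup_single when_def)

lemma sum_reindex_add_left:
  fixes f :: "'g::{finite, group_add} \<Rightarrow> 'b::comm_monoid_add"
  shows "(\<Sum>g\<in>UNIV. f (h + g)) = (\<Sum>g\<in>UNIV. f g)"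
  by (rule sum.reindex_bij_witness[of _ "\<lambda>g. - h + g" "\<lambda>g. h + g"]) (auto simp: add.assoc[symmetric])

lemma sum_reindex_uminus:
  fixes f :: "'g::{finite, group_add} \<Rightarrow> 'b::comm_monoid_add"
  shows "(\<Sum>g\<in>UNIV. f (- g)) = (\<Sum>g\<in>UNIV. f g)"
  by (rule sum.reindex_bij_witness[of _ uminus uminus]) auto

lemma lookup_basis_times:
  fixes b :: "('g::{finite, group_add}, 'k::field) group_algebra"
  shows "Poly_Mapping.lookup (basis_elem g * b) h = Poly_Mapping.lookup b (- g + h)"
  by (simp add: lookup_times_group lookup_basis_elem if_distrib[of "\<lambda>x. x * _"] cong: if_cong)

lemma lookup_times_basis:
  fixes b :: "('g::{finite, group_add}, 'k::field) group_algebra"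
  shows "Poly_Mapping.lookup (b * basis_elem g) h = Poly_Mapping.lookup b (h - g)"
proof -
  have eq: "- x + h = g \<longleftrightarrow> x = h - g" for x
    by (metis add.assoc add_0 diff_add_cancel left_minus right_minus add_diff_cancel)
  show ?thesis
    by (simp add: lookup_times_group lookup_basis_elem eq if_distrib[of "\<lambda>x. _ * x"] cong: if_cong)
qed

lemma basis_elem_times: "basis_elem g * basis_elem h = (basis_elem (g + h) :: ('g::group_add, 'k::field) group_algebra)"
  by (simp add: basis_elem_def mult_single)

lemma basis_elem_0: "basis_elem 0 = (1 :: ('g::group_add, 'k::field) group_algebra)"
  by (simp add: basis_elem_def)

lemma ga_expansion:
  fixes a :: "('g::finite, 'k::field) group_algebra"
  shows "a = (\<Sum>g\<in>UNIV. ga_scale (Poly_Mapping.lookup a g) (basis_elem g))"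
  by (rule poly_mapping_eqI)
    (simp add: lookup_sum lookup_basis_elem if_distrib[of "\<lambda>x. _ * x"] cong: if_cong)

lemma ga_span_basis: "ga.span (range basis_elem) = (UNIV :: ('g::finite, 'k::field) group_algebra set)"
proof -
  have "a \<in> ga.span (range basis_elem)" for a :: "('g, 'k) group_algebra"
    by (subst ga_expansion) (intro ga.span_sum ga.span_scale ga.span_base rangeI)
  then show ?thesis by blast
qed

lemma ga_independent_basis: "ga.independent (range basis_elem :: ('g::finite, 'k::field) group_algebra set)"
proof (rule ga.independent_if_scalars_zero)
  show "finite (range basis_elem :: ('g, 'k) group_algebra set)" by simp
  fix f :: "('g, 'k) group_algebra \<Rightarrow> 'k" and x :: "('g, 'k) group_algebra"
  assume 0: "(\<Sum>x\<in>range basis_elem. ga_scale (f x) x) = 0" and x: "x \<in> range basis_elem"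
  have inj: "inj (basis_elem :: 'g \<Rightarrow> ('g, 'k) group_algebra)"
    by (rule injI) (metis lookup_basis_elem zero_neq_one)
  from x obtain g where g: "x = basis_elem g" by blast
  have "0 = Poly_Mapping.lookup (\<Sum>h\<in>UNIV. ga_scale (f (basis_elem h)) (basis_elem h)) g"
    using 0 by (simp add: sum.reindex[OF inj])
  then show "f x = 0"
    by (simp add: g lookup_sum lookup_basis_elem if_distrib[of "\<lambda>x. _ * x"] cong: if_cong)
qed

text \<open>The index type is any finite type, so the dimension theory serves also rational
  matrices, which are indexed by pairs, and coordinate vectors over the algebraic closure.\<close>

global_interpretation ga: finite_dimensional_vector_space
  "ga_scale :: 'k::field \<Rightarrow> ('g::finite, 'k) group_algebra \<Rightarrow> _" "range basis_elem"
  using ga_independent_basis ga_span_basis by unfold_locales auto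

lemma ga_scale_times_left:
  fixes a b :: "('g::{finite, group_add}, 'k::field) group_algebra"
  shows "ga_scale c a * b = ga_scale c (a * b)"
  by (rule poly_mapping_eqI) (simp add: lookup_times_group sum_distrib_left mult.assoc)

lemma ga_scale_times_right:
  fixes a b :: "('g::{finite, group_add}, 'k::field) group_algebra"
  shows "a * ga_scale c b = ga_scale c (a * b)"
  by (rule poly_mapping_eqI) (simp add: lookup_times_group sum_distrib_left mult_ac)

lemma ga_subspace_projection:
  fixes I :: "('g, 'k::field) group_algebra set"
  assumes "ga.subspace I"
  obtains p where "\<And>x y. p (x + y) = p x + p y" "\<And>c x. p (ga_scale c x) = ga_scale c (p x)"
    "\<And>x. p x \<in> I" "\<And>x. x \<in> I \<Longrightarrow> p x = x"
proof -
  interpret ga2: vector_space_pair "ga_scale :: 'k \<Rightarrow> ('g, 'k) group_algebra \<Rightarrow> _" "ga_scale :: 'k \<Rightarrow> ('g, 'k) group_algebra \<Rightarrow> _"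
    by unfold_locales
  obtain p where p: "p ` UNIV \<subseteq> I" "Vector_Spaces.linear ga_scale ga_scale p" "\<forall>v\<in>I. p (id v) = v"
    using ga2.linear_exists_left_inverse_on[OF ga.linear_id assms] by auto
  interpret p: Vector_Spaces.linear ga_scale ga_scale p by fact
  show ?thesis
    by (rule that[of p]) (use p in \<open>auto simp: p.add p.scale\<close>)
qed

text \<open>By injectivity the image has the dimension of \<open>I\<close>. The use is to invert on
  an ideal an averaged operator that is injective there without being the identity.\<close>

lemma ga_injective_imp_surjective_on:
  fixes I :: "('g::finite, 'k::field) group_algebra set"
  assumes I: "ga.subspace I"
    and add: "\<And>x y. f (x + y) = f x + f y" and scale: "\<And>c x. f (ga_scale c x) = ga_scale c (f x)"
    and maps: "f ` I \<subseteq> I" and inj: "\<And>x. x \<in> I \<Longrightarrow> f x = 0 \<Longrightarrow> x = 0"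
  shows "f ` I = I"
proof -
  have lin: "Vector_Spaces.linear ga_scale ga_scale f"
    using add scale by unfold_locales auto
  interpret f: Vector_Spaces.linear ga_scale ga_scale f by fact
  have fI: "ga.subspace (f ` I)" using I by (rule f.subspace_image)
  interpret ga2: finite_dimensional_vector_space_pair_1 "ga_scale :: 'k \<Rightarrow> ('g, 'k) group_algebra \<Rightarrow> _" "range basis_elem" "ga_scale :: 'k \<Rightarrow> ('g, 'k) group_algebra \<Rightarrow> _"
    by unfold_locales
  have spI: "ga.span I = I" using I by simp
  have "inj_on f I"
    using f.inj_on_iff_eq_0[OF I] inj by auto
  then have "ga.dim (f ` I) = ga.dim I"
    by (intro ga2.dim_image_eq[OF lin]) (simp only: spI)
  then show ?thesis
    using ga.subspace_dim_equal[OF fI I maps] by simp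
qed

lemma ga_induct [case_names basis add]:
  fixes a :: "('g::finite, 'k::field) group_algebra"
  assumes basis: "\<And>c g. P (ga_scale c (basis_elem g))"
    and add: "\<And>a b. P a \<Longrightarrow> P b \<Longrightarrow> P (a + b)"
  shows "P a"
proof -
  have "P 0" using basis[of 0] by simp
  then have "P (\<Sum>g\<in>S. ga_scale (Poly_Mapping.lookup a g) (basis_elem g))" for S
    by (induction S rule: infinite_finite_induct) (auto intro: basis add)
  then show ?thesis by (subst ga_expansion)
qed

section \<open>Left ideals and averaging over the group\<close>

definition ga_left_ideal :: "('g::group_add, 'k::field) group_algebra set \<Rightarrow> bool" where
  "ga_left_ideal I \<longleftrightarrow> ga.subspace I \<and> (\<forall>g. \<forall>x\<in>I. basis_elem g * x \<in> I)"

lemma ga_left_ideal_mult: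
  fixes I :: "('g::{finite, group_add}, 'k::field) group_algebra set"
  assumes "ga_left_ideal I" "x \<in> I"
  shows "a * x \<in> I"
proof -
  have "a * x = (\<Sum>g\<in>UNIV. ga_scale (Poly_Mapping.lookup a g) (basis_elem g * x))"
    by (subst ga_expansion[of a]) (simp add: sum_distrib_right ga_scale_times_left)
  also have "\<dots> \<in> I"
    using assms unfolding ga_left_ideal_def by (auto intro!: ga.subspace_sum ga.subspace_scale)
  finally show ?thesis .
qed

text \<open>Maschke: a \<open>G\<close>-equivariant projection of the group algebra onto \<open>I\<close> is right
  multiplication by the image \<open>e\<close> of the unit.\<close>

lemma maschke_idempotent:
  fixes I :: "('g::{finite, group_add}, 'k::field_char_0) group_algebra set"
  assumes "ga_left_ideal I"
  obtains e where "e \<in> I" "\<And>x. x \<in> I \<Longrightarrow> x * e = x"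
proof -
  have sub: "ga.subspace I" and inv: "\<And>g x. x \<in> I \<Longrightarrow> basis_elem g * x \<in> I"
    using assms by (auto simp: ga_left_ideal_def)
  obtain p where p: "\<And>x y. p (x + y) = p x + p y" "\<And>c x. p (ga_scale c x) = ga_scale c (p x)"
    "\<And>x. p x \<in> I" "\<And>x. x \<in> I \<Longrightarrow> p x = x"
    using ga_subspace_projection[OF sub] by blast
  define n :: 'k where "n = of_nat (card (UNIV :: 'g set))"
  have n: "n \<noteq> 0" by (simp add: n_def)
  \<comment> \<open>The average is not normalized: \<open>q\<close> restricts to \<open>I\<close> as
    multiplication by the group order \<open>n\<close>, and the division by \<open>n\<close>, which
    needs characteristic 0, is left to the choice of the idempotent.\<close>
  define q where "q x = (\<Sum>g\<in>UNIV. basis_elem g * p (basis_elem (- g) * x))" for x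
  have q_add: "q (x + y) = q x + q y" for x y
    by (simp add: q_def p distrib_left sum.distrib)
  have q_scale: "q (ga_scale c x) = ga_scale c (q x)" for c x
    by (simp add: q_def p ga_scale_times_right ga.scale_sum_right)
  have q0: "q 0 = 0" using q_scale[of 0 0] by simp
  have q_basis: "q (basis_elem h * x) = basis_elem h * q x" for h x
  proof -
    have "q (basis_elem h * x) = (\<Sum>g\<in>UNIV. basis_elem (h + g) * p (basis_elem (- (h + g)) * (basis_elem h * x)))"
      unfolding q_def by (rule sum_reindex_add_left[symmetric])
    also have "\<dots> = (\<Sum>g\<in>UNIV. basis_elem h * (basis_elem g * p (basis_elem (- g) * x)))"
      by (intro sum.cong refl)
        (simp add: mult.assoc[symmetric] basis_elem_times minus_add add.assoc)
    finally show ?thesis by (simp add: q_def sum_distrib_left)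
  qed
  have q_sum: "q (sum f A) = (\<Sum>i\<in>A. q (f i))" for f and A :: "'g set"
    by (induction A rule: infinite_finite_induct) (auto simp: q0 q_add)
  have q_mult: "q (a * x) = a * q x" for a x
  proof -
    have "q (a * x) = q (\<Sum>g\<in>UNIV. ga_scale (Poly_Mapping.lookup a g) (basis_elem g * x))"
      by (subst ga_expansion[of a]) (simp add: sum_distrib_right ga_scale_times_left)
    also have "\<dots> = (\<Sum>g\<in>UNIV. ga_scale (Poly_Mapping.lookup a g) (basis_elem g)) * q x"
      by (simp add: q_sum q_scale q_basis sum_distrib_right ga_scale_times_left)
    finally show ?thesis by (simp add: ga_expansion[of a, symmetric])
  qed
  have q_id: "q x = ga_scale n x" if "x \<in> I" for x
  proof -
    have "basis_elem g * p (basis_elem (- g) * x) = x" for g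
      using p(4)[OF inv[OF that]] by (simp add: mult.assoc[symmetric] basis_elem_times basis_elem_0)
    then have "Poly_Mapping.lookup (q x) h = (\<Sum>g\<in>(UNIV::'g set). Poly_Mapping.lookup x h)" for h
      by (simp only: q_def lookup_sum)
    then show ?thesis
      by (intro poly_mapping_eqI) (simp add: n_def)
  qed
  show ?thesis
  proof
    show "ga_scale (inverse n) (q 1) \<in> I"
      unfolding q_def using p(3) inv sub by (auto intro!: ga.subspace_scale ga.subspace_sum)
    show "x * ga_scale (inverse n) (q 1) = x" if "x \<in> I" for x
    proof -
      have "x * q 1 = ga_scale n x" using q_id[OF that] q_mult[of x 1] by simp
      then show ?thesis using n by (simp only: ga_scale_times_right) simp
    qed
  qed
qed

section \<open>Representations of the group algebra\<close>

lemma mult_mat_index: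
  assumes "A \<in> carrier_mat n m" "B \<in> carrier_mat m p" "i < n" "j < p"
  shows "(A * B) $$ (i, j) = (\<Sum>k<m. A $$ (i, k) * B $$ (k, j))"
  using assms by (auto simp: scalar_prod_def atLeast0LessThan)

lemma mult_mat_vec_index:
  assumes "A \<in> carrier_mat n m" "v \<in> carrier_vec m" "i < n"
  shows "(A *\<^sub>v v) $ i = (\<Sum>k<m. A $$ (i, k) * v $ k)"
  using assms by (auto simp: scalar_prod_def atLeast0LessThan)

lemma smult_mult_mat_vec:
  fixes A :: "'a::field mat"
  assumes "A \<in> carrier_mat n m" "v \<in> carrier_vec m"
  shows "(c \<cdot>\<^sub>m A) *\<^sub>v v = c \<cdot>\<^sub>v (A *\<^sub>v v)"
  using assms by (intro eq_vecI) (auto simp: scalar_prod_def sum_distrib_left mult.assoc)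

lemma representation_carrier [simp]:
  "representation V \<Longrightarrow> V g \<in> carrier_mat (rep_dim V) (rep_dim V)"
  by (simp add: representation_def)

lemma representation_dims [simp]:
  "representation V \<Longrightarrow> dim_row (V g) = rep_dim V" "representation V \<Longrightarrow> dim_col (V g) = rep_dim V"
  using representation_carrier[of V g] by (auto simp del: representation_carrier)

lemma representation_add: "representation V \<Longrightarrow> V (g + h) = V g * V h"
  by (simp add: representation_def)

lemma representation_0: "representation V \<Longrightarrow> V 0 = 1\<^sub>m (rep_dim V)"
  by (simp add: representation_def)

lemma representation_add_index:
  assumes "representation V" "i < rep_dim V" "j < rep_dim V"
  shows "V (g + h) $$ (i, j) = (\<Sum>k<rep_dim V. V g $$ (i, k) * V h $$ (k, j))"
  using assms mult_mat_index[OF representation_carrier representation_carrier]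
  by (simp add: representation_add[OF assms(1)] del: index_mult_mat)

lemma rep_extend_carrier [simp]: "rep_extend V a \<in> carrier_mat (rep_dim V) (rep_dim V)"
  by (simp add: rep_extend_def)

lemma rep_extend_dim [simp]: "dim_row (rep_extend V a) = rep_dim V" "dim_col (rep_extend V a) = rep_dim V"
  by (simp_all add: rep_extend_def)

lemma rep_extend_index:
  "i < rep_dim V \<Longrightarrow> j < rep_dim V \<Longrightarrow>
    rep_extend V a $$ (i, j) = (\<Sum>g\<in>UNIV. Poly_Mapping.lookup a g * V g $$ (i, j))"
  by (simp add: rep_extend_def)

lemma rep_extend_add: "rep_extend V (a + b) = rep_extend V a + rep_extend V b"
  by (rule eq_matI) (auto simp: rep_extend_index lookup_add distrib_right sum.distrib)

lemma rep_extend_scale: "rep_extend V (ga_scale c a) = c \<cdot>\<^sub>m rep_extend V a"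
  by (rule eq_matI) (auto simp: rep_extend_index sum_distrib_left mult.assoc)

lemma rep_extend_0 [simp]: "rep_extend V 0 = 0\<^sub>m (rep_dim V) (rep_dim V)"
  by (rule eq_matI) (auto simp: rep_extend_index)

lemma rep_extend_minus: "rep_extend V (a - b) = rep_extend V a - rep_extend V b"
  by (rule eq_matI) (auto simp: rep_extend_index lookup_minus left_diff_distrib sum_subtractf)

lemma rep_extend_basis: "representation V \<Longrightarrow> rep_extend V (basis_elem g) = V g"
proof (rule eq_matI)
  assume V: "representation V"
  then show "dim_row (rep_extend V (basis_elem g)) = dim_row (V g)"
    "dim_col (rep_extend V (basis_elem g)) = dim_col (V g)"
    by auto
  fix i j assume "i < dim_row (V g)" "j < dim_col (V g)"
  then show "rep_extend V (basis_elem g) $$ (i, j) = V g $$ (i, j)"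
    using V by (simp add: rep_extend_index lookup_basis_elem if_distrib[of "\<lambda>x. x * _"] cong: if_cong)
qed

lemma rep_extend_one: "representation V \<Longrightarrow> rep_extend V 1 = 1\<^sub>m (rep_dim V)"
  using rep_extend_basis[of V 0] by (simp add: basis_elem_0 representation_0)

lemma rep_extend_mult:
  assumes V: "representation V"
  shows "rep_extend V (a * b) = rep_extend V a * rep_extend V b"
proof (rule eq_matI)
  fix i j assume "i < dim_row (rep_extend V a * rep_extend V b)" "j < dim_col (rep_extend V a * rep_extend V b)"
  then have ij: "i < rep_dim V" "j < rep_dim V" by auto
  let ?l = Poly_Mapping.lookup
  have "rep_extend V (a * b) $$ (i, j) = (\<Sum>h\<in>UNIV. \<Sum>g\<in>UNIV. ?l a g * ?l b (- g + h) * V h $$ (i, j))"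
    using ij by (simp add: rep_extend_index lookup_times_group sum_distrib_right)
  also have "\<dots> = (\<Sum>g\<in>UNIV. \<Sum>h\<in>UNIV. ?l a g * ?l b (- g + h) * V h $$ (i, j))"
    by (rule sum.swap)
  also have "\<dots> = (\<Sum>g\<in>UNIV. \<Sum>h\<in>UNIV. ?l a g * ?l b (- g + (g + h)) * V (g + h) $$ (i, j))"
    by (rule sum.cong[OF refl], rule sum_reindex_add_left[symmetric])
  also have "\<dots> = (\<Sum>g\<in>UNIV. \<Sum>h\<in>UNIV. \<Sum>k<rep_dim V. ?l a g * ?l b h * (V g $$ (i, k) * V h $$ (k, j)))"
    using ij V by (simp add: add.assoc[symmetric] representation_add_index sum_distrib_left)
  also have "\<dots> = (\<Sum>g\<in>UNIV. \<Sum>k<rep_dim V. \<Sum>h\<in>UNIV. ?l a g * ?l b h * (V g $$ (i, k) * V h $$ (k, j)))"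
    by (intro sum.cong refl) (rule sum.swap)
  also have "\<dots> = (\<Sum>k<rep_dim V. \<Sum>g\<in>UNIV. \<Sum>h\<in>UNIV. ?l a g * ?l b h * (V g $$ (i, k) * V h $$ (k, j)))"
    by (rule sum.swap)
  also have "\<dots> = (\<Sum>k<rep_dim V. rep_extend V a $$ (i, k) * rep_extend V b $$ (k, j))"
    using ij by (simp add: rep_extend_index sum_product mult_ac)
  also have "\<dots> = (rep_extend V a * rep_extend V b) $$ (i, j)"
    using ij mult_mat_index[OF rep_extend_carrier rep_extend_carrier, of i V j]
    by (simp del: index_mult_mat)
  finally show "rep_extend V (a * b) $$ (i, j) = (rep_extend V a * rep_extend V b) $$ (i, j)" .
qed auto

lemma rep_extend_commutator_zero:
  assumes "representation V" "rep_extend V a = 0\<^sub>m (rep_dim V) (rep_dim V)"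
  shows "rep_extend V (a * b - b * a) = 0\<^sub>m (rep_dim V) (rep_dim V)"
  using left_mult_zero_mat[OF rep_extend_carrier[of V b]] right_mult_zero_mat[OF rep_extend_carrier[of V b]]
  by (auto simp: rep_extend_minus rep_extend_mult assms intro!: eq_matI)

lemma rep_extend_intertwine:
  assumes T: "T \<in> carrier_mat (rep_dim W) (rep_dim V)"
    and V: "representation V" and W: "representation W" and TV: "\<And>g. T * V g = W g * T"
  shows "T * rep_extend V a = rep_extend W a * T"
proof (induction a rule: ga_induct)
  case (basis c g)
  show ?case
    using T V W TV[of g] mult_smult_distrib[OF T representation_carrier[OF V]]
      mult_smult_assoc_mat[OF representation_carrier[OF W] T]
    by (simp add: rep_extend_scale rep_extend_basis)
next
  case (add a b)
  then show ?case
    using mult_add_distrib_mat[OF T rep_extend_carrier rep_extend_carrier]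
      add_mult_distrib_mat[OF rep_extend_carrier rep_extend_carrier T]
    by (simp add: rep_extend_add)
qed

lemma rep_extend_invariant:
  assumes V: "representation V" and U: "vec_subspace (rep_dim V) U"
    and inv: "\<And>g w. w \<in> U \<Longrightarrow> V g *\<^sub>v w \<in> U" and w: "w \<in> U"
  shows "rep_extend V a *\<^sub>v w \<in> U"
proof (induction a rule: ga_induct)
  case (basis c g)
  have wc: "w \<in> carrier_vec (rep_dim V)" using U w by (auto simp: vec_subspace_def)
  have "(c \<cdot>\<^sub>m V g) *\<^sub>v w = c \<cdot>\<^sub>v (V g *\<^sub>v w)"
    by (rule smult_mult_mat_vec[OF representation_carrier[OF V] wc])
  then show ?case
    using U inv[OF w] V by (auto simp: rep_extend_scale rep_extend_basis vec_subspace_def)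
next
  case (add a b)
  have wc: "w \<in> carrier_vec (rep_dim V)" using U w by (auto simp: vec_subspace_def)
  show ?case
    using add U wc add_mult_distrib_mat_vec[OF rep_extend_carrier rep_extend_carrier wc]
    by (auto simp: rep_extend_add vec_subspace_def)
qed

section \<open>Isomorphisms of representations\<close>

lemma invertible_matE:
  assumes "invertible_mat P" "P \<in> carrier_mat n n"
  obtains Q where "Q \<in> carrier_mat n n" "P * Q = 1\<^sub>m n" "Q * P = 1\<^sub>m n"
proof -
  obtain Q where Q: "P * Q = 1\<^sub>m n" "Q * P = 1\<^sub>m (dim_row Q)"
    using assms by (auto simp: invertible_mat_def inverts_mat_def)
  have "dim_col Q = n" using arg_cong[OF Q(1), of dim_col] by simp
  moreover have "dim_row Q = n" using arg_cong[OF Q(2), of dim_col] assms(2) by simp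
  ultimately show ?thesis using Q by (intro that[of Q]) auto
qed

lemma invertible_matI:
  assumes "P \<in> carrier_mat n n" "Q \<in> carrier_mat n n" "P * Q = 1\<^sub>m n" "Q * P = 1\<^sub>m n"
  shows "invertible_mat P"
  using assms by (auto simp: invertible_mat_def inverts_mat_def)

lemma rep_isoE:
  assumes "rep_iso V W"
  obtains P Q where "rep_dim V = rep_dim W" "P \<in> carrier_mat (rep_dim V) (rep_dim V)"
    "Q \<in> carrier_mat (rep_dim V) (rep_dim V)" "P * Q = 1\<^sub>m (rep_dim V)" "Q * P = 1\<^sub>m (rep_dim V)"
    "\<And>g. P * V g = W g * P"
proof -
  obtain P where P: "rep_dim V = rep_dim W" "P \<in> carrier_mat (rep_dim V) (rep_dim V)"
    "invertible_mat P" "\<And>g. P * V g = W g * P"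
    using assms by (auto simp: rep_iso_def)
  from P(3,2) obtain Q where "Q \<in> carrier_mat (rep_dim V) (rep_dim V)"
    "P * Q = 1\<^sub>m (rep_dim V)" "Q * P = 1\<^sub>m (rep_dim V)" by (rule invertible_matE)
  with P that show ?thesis by blast
qed

lemma rep_isoI:
  assumes "rep_dim V = rep_dim W" "P \<in> carrier_mat (rep_dim V) (rep_dim V)"
    "Q \<in> carrier_mat (rep_dim V) (rep_dim V)" "P * Q = 1\<^sub>m (rep_dim V)" "Q * P = 1\<^sub>m (rep_dim V)"
    "\<And>g. P * V g = W g * P"
  shows "rep_iso V W"
  using assms invertible_matI[OF assms(2-5)] by (auto simp: rep_iso_def)

lemma rep_iso_refl: "representation V \<Longrightarrow> rep_iso V V"
  using left_mult_one_mat[OF representation_carrier] right_mult_one_mat[OF representation_carrier]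
  by (intro rep_isoI[of _ _ "1\<^sub>m (rep_dim V)" "1\<^sub>m (rep_dim V)"]) auto

lemma rep_iso_sym:
  assumes "rep_iso V W" "representation V" "representation W"
  shows "rep_iso W V"
  using assms(1)
proof (rule rep_isoE)
  fix P Q assume d: "rep_dim V = rep_dim W" and P: "P \<in> carrier_mat (rep_dim V) (rep_dim V)"
    and Q: "Q \<in> carrier_mat (rep_dim V) (rep_dim V)" and PQ: "P * Q = 1\<^sub>m (rep_dim V)" "Q * P = 1\<^sub>m (rep_dim V)"
    and iso: "\<And>g. P * V g = W g * P"
  show ?thesis
  proof (rule rep_isoI[of _ _ Q P])
    fix g
    have Vg: "V g \<in> carrier_mat (rep_dim V) (rep_dim V)" and Wg: "W g \<in> carrier_mat (rep_dim V) (rep_dim V)"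
      using representation_carrier[OF assms(2), of g] representation_carrier[OF assms(3), of g] d by simp_all
    have "Q * W g = Q * (W g * (P * Q))" using PQ Wg by simp
    also have "\<dots> = Q * ((W g * P) * Q)" using P Q Wg by (simp add: assoc_mult_mat[of _ "rep_dim V" "rep_dim V" _ "rep_dim V" _ "rep_dim V"])
    also have "\<dots> = (Q * P) * V g * Q" using P Q Vg iso[symmetric] by (simp add: assoc_mult_mat[of _ "rep_dim V" "rep_dim V" _ "rep_dim V" _ "rep_dim V"])
    finally show "Q * W g = V g * Q" using PQ Vg by simp
  qed (use d P Q PQ in auto)
qed

lemma rep_iso_trans:
  assumes "rep_iso U V" "rep_iso V W" "representation U" "representation V" "representation W"
  shows "rep_iso U W"
proof -
  from assms(1) obtain P Q where d: "rep_dim U = rep_dim V" and P: "P \<in> carrier_mat (rep_dim U) (rep_dim U)"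
    and Q: "Q \<in> carrier_mat (rep_dim U) (rep_dim U)" and PQ: "P * Q = 1\<^sub>m (rep_dim U)" "Q * P = 1\<^sub>m (rep_dim U)"
    and iso: "\<And>g. P * U g = V g * P" by (rule rep_isoE) blast
  from assms(2) obtain P' Q' where d': "rep_dim V = rep_dim W" and P': "P' \<in> carrier_mat (rep_dim U) (rep_dim U)"
    and Q': "Q' \<in> carrier_mat (rep_dim U) (rep_dim U)" and PQ': "P' * Q' = 1\<^sub>m (rep_dim U)" "Q' * P' = 1\<^sub>m (rep_dim U)"
    and iso': "\<And>g. P' * V g = W g * P'" using d by - (erule rep_isoE, auto)
  let ?n = "rep_dim U"
  note as = assoc_mult_mat[of _ ?n ?n _ ?n _ ?n]
  have VW: "U g \<in> carrier_mat ?n ?n" "V g \<in> carrier_mat ?n ?n" "W g \<in> carrier_mat ?n ?n" for g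
    using representation_carrier[OF assms(3), of g] representation_carrier[OF assms(4), of g]
      representation_carrier[OF assms(5), of g] d d' by simp_all
  show ?thesis
  proof (rule rep_isoI[of _ _ "P' * P" "Q * Q'"])
    have "P' * P * (Q * Q') = P' * ((P * Q) * Q')" using P Q P' Q' by (simp add: as)
    then show "P' * P * (Q * Q') = 1\<^sub>m ?n" using PQ PQ' Q' by simp
    have "Q * Q' * (P' * P) = Q * ((Q' * P') * P)" using P Q P' Q' by (simp add: as)
    then show "Q * Q' * (P' * P) = 1\<^sub>m ?n" using PQ PQ' P by simp
    fix g
    have "P' * P * U g = P' * V g * P" using P P' VW iso by (simp add: as)
    then show "P' * P * U g = W g * (P' * P)" using P P' VW iso' by (simp add: as)
  qed (use d d' P Q P' Q' in auto)
qed

lemma rep_extend_iso_zero: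
  assumes "rep_iso V W" "representation V" "representation W" "rep_extend W a = 0\<^sub>m (rep_dim W) (rep_dim W)"
  shows "rep_extend V a = 0\<^sub>m (rep_dim V) (rep_dim V)"
proof -
  from assms(1) obtain P Q where d: "rep_dim V = rep_dim W" and P: "P \<in> carrier_mat (rep_dim V) (rep_dim V)"
    and Q: "Q \<in> carrier_mat (rep_dim V) (rep_dim V)" and PQ: "P * Q = 1\<^sub>m (rep_dim V)" "Q * P = 1\<^sub>m (rep_dim V)"
    and iso: "\<And>g. P * V g = W g * P" by (rule rep_isoE) blast
  have "P * rep_extend V a = rep_extend W a * P"
    by (rule rep_extend_intertwine) (use P d assms iso in auto)
  then have "P * rep_extend V a = 0\<^sub>m (rep_dim V) (rep_dim V)" using assms(4) d P by simp
  then have "Q * (P * rep_extend V a) = 0\<^sub>m (rep_dim V) (rep_dim V)" using Q by simp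
  then show ?thesis using P Q PQ by (simp add: assoc_mult_mat[of _ "rep_dim V" "rep_dim V" _ "rep_dim V" _ "rep_dim V", symmetric])
qed

section \<open>Minimal left ideals and faithfulness\<close>

lemma irreducible_repD:
  assumes "irreducible_rep V"
  shows "representation V" "rep_dim V \<noteq> 0"
    "vec_subspace (rep_dim V) U \<Longrightarrow> (\<And>g w. w \<in> U \<Longrightarrow> V g *\<^sub>v w \<in> U) \<Longrightarrow>
      U = {0\<^sub>v (rep_dim V)} \<or> U = carrier_vec (rep_dim V)"
  using assms by (auto simp: irreducible_rep_def)

text \<open>Here \<open>crd\<close> takes coordinates in the basis \<open>b 0, b 1, \<dots>\<close> of \<open>I\<close>.\<close>

lemma left_ideal_representation:
  fixes I :: "('g::{finite, group_add}, 'k::field) group_algebra set"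
  assumes "ga_left_ideal I"
  obtains W :: "'g \<Rightarrow> 'k mat" and crd :: "_ \<Rightarrow> 'k vec" and b where "representation W"
    "bij_betw crd I (carrier_vec (rep_dim W))"
    "\<And>x y. x \<in> I \<Longrightarrow> y \<in> I \<Longrightarrow> crd (x + y) = crd x + crd y"
    "\<And>c x. x \<in> I \<Longrightarrow> crd (ga_scale c x) = c \<cdot>\<^sub>v crd x"
    "\<And>g x. x \<in> I \<Longrightarrow> crd (basis_elem g * x) = W g *\<^sub>v crd x"
    "\<And>x. x \<in> I \<Longrightarrow> x = (\<Sum>j<rep_dim W. ga_scale (crd x $ j) (b j))"
proof -
  have I: "ga.subspace I" and inv: "\<And>g x. x \<in> I \<Longrightarrow> basis_elem g * x \<in> I"
    using assms by (auto simp: ga_left_ideal_def)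
  obtain B where B: "B \<subseteq> I" "ga.independent B" "I \<subseteq> ga.span B"
    using ga.maximal_independent_subset by blast
  have spB: "ga.span B = I"
    using B ga.span_minimal[OF B(1) I] by auto
  have finB: "finite B" using ga.independent_bound_general[OF B(2)] by simp
  obtain bs where bs: "set bs = B" "distinct bs"
    using finite_distinct_list[OF finB] by blast
  define n where "n = length bs"
  define R where "R = ga.representation B"
  have nth_I: "bs ! i \<in> I" if "i < n" for i using that bs B(1) by (auto simp: n_def)
  have R_add: "R (x + y) b = R x b + R y b" if "x \<in> I" "y \<in> I" for x y b
    unfolding R_def using ga.representation_add[OF B(2), of y x] that spB by simp
  have R_scale: "R (ga_scale c x) b = c * R x b" if "x \<in> I" for c x b
    unfolding R_def using ga.representation_scale[OF B(2), of x] that spB by simp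
  have R_sum: "R (\<Sum>i\<in>S. f i) b = (\<Sum>i\<in>S. R (f i) b)" if "\<And>i. i \<in> S \<Longrightarrow> f i \<in> I" for f and S :: "nat set" and b
    unfolding R_def using ga.representation_sum[OF B(2), of S f] that spB by simp
  have R_nth: "R (bs ! i) (bs ! j) = (if i = j then 1 else 0)" if "i < n" "j < n" for i j
    using ga.representation_basis[OF B(2), of "bs ! i"] that bs
    by (auto simp: R_def n_def nth_eq_iff_index_eq)
  have sum_bs: "(\<Sum>b\<in>B. f b) = (\<Sum>i<n. f (bs ! i))" for f :: "('g, 'k) group_algebra \<Rightarrow> ('g, 'k) group_algebra"
    unfolding n_def bs(1)[symmetric] by (simp add: bs(2) sum.distinct_set_conv_list sum_list_sum_nth atLeast0LessThan)
  have expand: "x = (\<Sum>i<n. ga_scale (R x (bs ! i)) (bs ! i))" if "x \<in> I" for x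
    using ga.sum_representation_eq[OF B(2), of x B] that spB finB
      sum_bs[of "\<lambda>b. ga_scale (ga.representation B x b) b"]
    by (simp add: R_def)
  define crd where "crd x = vec n (\<lambda>i. R x (bs ! i))" for x
  define W where "W g = mat n n (\<lambda>(i, j). R (basis_elem g * bs ! j) (bs ! i))" for g
  have crd_carrier: "crd x \<in> carrier_vec n" for x by (simp add: crd_def)
  have W_carrier: "W g \<in> carrier_mat n n" for g by (simp add: W_def)
  have W_crd: "crd (basis_elem g * x) = W g *\<^sub>v crd x" if x: "x \<in> I" for g x
  proof (rule eq_vecI)
    show "dim_vec (crd (basis_elem g * x)) = dim_vec (W g *\<^sub>v crd x)" by (simp add: crd_def W_def)
    fix i assume "i < dim_vec (W g *\<^sub>v crd x)"
    then have i: "i < n" by (simp add: W_def)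
    have "crd (basis_elem g * x) $ i = R (basis_elem g * (\<Sum>j<n. ga_scale (R x (bs ! j)) (bs ! j))) (bs ! i)"
      using i expand[OF x] by (simp add: crd_def)
    also have "\<dots> = R (\<Sum>j<n. ga_scale (R x (bs ! j)) (basis_elem g * (bs ! j))) (bs ! i)"
      by (simp add: sum_distrib_left ga_scale_times_right)
    also have "\<dots> = (\<Sum>j<n. R x (bs ! j) * R (basis_elem g * (bs ! j)) (bs ! i))"
      using inv nth_I I by (subst R_sum) (auto simp: R_scale intro: ga.subspace_scale)
    also have "\<dots> = (W g *\<^sub>v crd x) $ i"
      using i mult_mat_vec_index[OF W_carrier crd_carrier] by (simp add: W_def crd_def mult.commute)
    finally show "crd (basis_elem g * x) $ i = (W g *\<^sub>v crd x) $ i" .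
  qed
  have dimW: "rep_dim W = n" by (simp add: rep_dim_def W_def)
  have rep: "representation W"
    unfolding representation_def dimW
  proof (intro conjI allI)
    show "W g \<in> carrier_mat n n" for g by (rule W_carrier)
    show "W 0 = 1\<^sub>m n"
      by (rule eq_matI) (auto simp: W_def basis_elem_0 R_nth)
    fix g h
    show "W (g + h) = W g * W h"
    proof (rule eq_matI)
      fix i j assume "i < dim_row (W g * W h)" "j < dim_col (W g * W h)"
      then have ij: "i < n" "j < n" by (auto simp: W_def)
      have "W (g + h) $$ (i, j) = crd (basis_elem g * (basis_elem h * bs ! j)) $ i"
        using ij by (simp add: W_def crd_def mult.assoc[symmetric] basis_elem_times)
      also have "\<dots> = (\<Sum>k<n. W g $$ (i, k) * crd (basis_elem h * bs ! j) $ k)"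
        unfolding W_crd[OF inv[OF nth_I[OF ij(2)]]] by (rule mult_mat_vec_index[OF W_carrier crd_carrier ij(1)])
      also have "\<dots> = (\<Sum>k<n. W g $$ (i, k) * W h $$ (k, j))"
        using ij by (simp add: crd_def W_def)
      also have "\<dots> = (W g * W h) $$ (i, j)"
        using ij mult_mat_index[OF W_carrier W_carrier] by simp
      finally show "W (g + h) $$ (i, j) = (W g * W h) $$ (i, j)" .
    qed (auto simp: W_def)
  qed
  have "bij_betw crd I (carrier_vec n)"
  proof (rule bij_betw_byWitness[where f' = "\<lambda>v :: 'k vec. \<Sum>i<n. ga_scale (v $ i) (bs ! i)"])
    show "\<forall>x\<in>I. (\<Sum>i<n. ga_scale (crd x $ i) (bs ! i)) = x"
      using expand by (simp add: crd_def)
    show "(\<lambda>v :: 'k vec. \<Sum>i<n. ga_scale (v $ i) (bs ! i)) ` carrier_vec n \<subseteq> I"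
      using nth_I I by (auto intro!: ga.subspace_sum ga.subspace_scale)
    show "\<forall>v\<in>carrier_vec n. crd (\<Sum>i<n. ga_scale (v $ i) (bs ! i)) = v"
    proof
      fix v :: "'k vec" assume v: "v \<in> carrier_vec n"
      show "crd (\<Sum>i<n. ga_scale (v $ i) (bs ! i)) = v"
      proof (rule eq_vecI)
        fix j assume "j < dim_vec v"
        then have j: "j < n" using v by simp
        have "R (\<Sum>i<n. ga_scale (v $ i) (bs ! i)) (bs ! j) = (\<Sum>i<n. v $ i * R (bs ! i) (bs ! j))"
          using nth_I I by (subst R_sum) (auto simp: R_scale intro: ga.subspace_scale)
        also have "\<dots> = v $ j"
          using j by (simp add: R_nth if_distrib[of "\<lambda>x. _ * x"] cong: if_cong)
        finally show "crd (\<Sum>i<n. ga_scale (v $ i) (bs ! i)) $ j = v $ j"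
          using j by (simp add: crd_def)
      qed (use v in \<open>simp add: crd_def\<close>)
    qed
  qed (auto simp: crd_carrier)
  then show ?thesis
    using rep W_crd expand by (intro that[of W crd "(!) bs"]) (auto simp: dimW crd_def R_add R_scale)
qed

lemma zero_smult_vec: "v \<in> carrier_vec n \<Longrightarrow> (0::'a::field) \<cdot>\<^sub>v v = 0\<^sub>v n"
  by (intro eq_vecI) auto

lemma zero_mult_mat_vec: "v \<in> carrier_vec n \<Longrightarrow> 0\<^sub>m m n *\<^sub>v v = (0\<^sub>v m :: 'a::field vec)"
  by (intro eq_vecI) (auto simp: scalar_prod_def)

definition ga_minimal_left_ideal :: "('g::group_add, 'k::field) group_algebra set \<Rightarrow> bool" where
  "ga_minimal_left_ideal I \<longleftrightarrow> ga_left_ideal I \<and> I \<noteq> {0} \<and>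
    (\<forall>I'. ga_left_ideal I' \<and> I' \<subseteq> I \<longrightarrow> I' = {0} \<or> I' = I)"

text \<open>Least dimension among the nonzero left ideals inside \<open>J\<close> implies minimality
  for inclusion, since a subspace of the same dimension is everything.\<close>

lemma minimal_left_ideal_exists:
  fixes J :: "('g::{finite, group_add}, 'k::field) group_algebra set"
  assumes "ga_left_ideal J" "J \<noteq> {0}"
  obtains I where "ga_minimal_left_ideal I" "I \<subseteq> J"
proof -
  define P where "P I \<longleftrightarrow> ga_left_ideal I \<and> I \<noteq> {0} \<and> I \<subseteq> J" for I
  define I where "I = arg_min ga.dim P"
  have "P J" using assms by (simp add: P_def)
  then have I: "P I" and least: "\<And>I'. P I' \<Longrightarrow> ga.dim I \<le> ga.dim I'"
    unfolding I_def by (auto intro: arg_min_natI arg_min_nat_le)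
  have "I' = {0} \<or> I' = I" if "ga_left_ideal I'" "I' \<subseteq> I" for I'
  proof (rule disjCI)
    assume "I' \<noteq> I"
    show "I' = {0}"
    proof (rule ccontr)
      assume "I' \<noteq> {0}"
      then have "ga.dim I \<le> ga.dim I'" using least[of I'] that I by (auto simp: P_def)
      then have "I' = I"
        using that I by (intro ga.subspace_dim_equal) (auto simp: P_def ga_left_ideal_def)
      with \<open>I' \<noteq> I\<close> show False ..
    qed
  qed
  then show ?thesis using I by (intro that[of I]) (auto simp: P_def ga_minimal_left_ideal_def)
qed

text \<open>A subspace of the coordinate space stable under \<open>W\<close> is the image under
  \<open>crd\<close> of a left ideal inside \<open>I\<close>, so minimality of \<open>I\<close>
  becomes irreducibility of \<open>W\<close>. This is the source of irreducible representations in
  the faithfulness and embedding arguments.\<close>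

lemma minimal_left_ideal_representation:
  fixes I :: "('g::{finite, group_add}, 'k::field) group_algebra set"
  assumes min: "ga_minimal_left_ideal I"
  obtains W :: "'g \<Rightarrow> 'k mat" and crd :: "_ \<Rightarrow> 'k vec" and b where "irreducible_rep W"
    "bij_betw crd I (carrier_vec (rep_dim W))"
    "\<And>x y. x \<in> I \<Longrightarrow> y \<in> I \<Longrightarrow> crd (x + y) = crd x + crd y"
    "\<And>c x. x \<in> I \<Longrightarrow> crd (ga_scale c x) = c \<cdot>\<^sub>v crd x"
    "\<And>a x. x \<in> I \<Longrightarrow> crd (a * x) = rep_extend W a *\<^sub>v crd x"
    "\<And>x. x \<in> I \<Longrightarrow> x = (\<Sum>j<rep_dim W. ga_scale (crd x $ j) (b j))"
proof -
  have I: "ga_left_ideal I" "I \<noteq> {0}" "ga.subspace I"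
    using min by (auto simp: ga_minimal_left_ideal_def ga_left_ideal_def)
  obtain W :: "'g \<Rightarrow> 'k mat" and crd :: "_ \<Rightarrow> 'k vec" and b where W: "representation W"
    and bij: "bij_betw crd I (carrier_vec (rep_dim W))"
    and add: "\<And>x y. x \<in> I \<Longrightarrow> y \<in> I \<Longrightarrow> crd (x + y) = crd x + crd y"
    and scale: "\<And>c x. x \<in> I \<Longrightarrow> crd (ga_scale c x) = c \<cdot>\<^sub>v crd x"
    and basis: "\<And>g x. x \<in> I \<Longrightarrow> crd (basis_elem g * x) = W g *\<^sub>v crd x"
    and expand: "\<And>x. x \<in> I \<Longrightarrow> x = (\<Sum>j<rep_dim W. ga_scale (crd x $ j) (b j))"
    by (rule left_ideal_representation[OF I(1)]) (rule that)
  let ?n = "rep_dim W"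
  have cI: "crd x \<in> carrier_vec ?n" if "x \<in> I" for x
    using bij that by (auto simp: bij_betw_def)
  have zero: "0 \<in> I" using I(3) by (rule ga.subspace_0)
  have crd0: "crd 0 = 0\<^sub>v ?n"
    using scale[OF zero, of 0] cI[OF zero] by (simp add: zero_smult_vec)
  have mult: "crd (a * x) = rep_extend W a *\<^sub>v crd x" if x: "x \<in> I" for a x
  proof (induction a rule: ga_induct)
    case (basis c g)
    have "basis_elem g * x \<in> I" using I(1) x by (rule ga_left_ideal_mult)
    then have "crd (ga_scale c (basis_elem g) * x) = c \<cdot>\<^sub>v (W g *\<^sub>v crd x)"
      using x by (simp add: ga_scale_times_left scale assms \<open>\<And>g x. x \<in> I \<Longrightarrow> crd (basis_elem g * x) = W g *\<^sub>v crd x\<close>)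
    also have "\<dots> = (c \<cdot>\<^sub>m W g) *\<^sub>v crd x"
      by (rule smult_mult_mat_vec[OF representation_carrier[OF W] cI[OF x], symmetric])
    finally show ?case using W by (simp add: rep_extend_scale rep_extend_basis)
  next
    case (add a b)
    then show ?case
      using x ga_left_ideal_mult[OF I(1) x]
        add_mult_distrib_mat_vec[OF rep_extend_carrier rep_extend_carrier cI[OF x]]
      by (simp add: distrib_right assms \<open>\<And>x y. x \<in> I \<Longrightarrow> y \<in> I \<Longrightarrow> crd (x + y) = crd x + crd y\<close> rep_extend_add)
  qed
  have "irreducible_rep W"
    unfolding irreducible_rep_def
  proof (intro conjI allI impI)
    show "?n \<noteq> 0"
    proof
      assume n: "?n = 0"
      have "x = 0" if "x \<in> I" for x
      proof -
        have "crd x = crd 0" using cI[OF that] cI[OF zero] n by auto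
        then show ?thesis using bij that zero by (auto simp: bij_betw_def inj_on_def)
      qed
      with I(2) zero show False by auto
    qed
    fix U assume "vec_subspace ?n U \<and> (\<forall>g. \<forall>w\<in>U. W g *\<^sub>v w \<in> U)"
    then have U: "U \<subseteq> carrier_vec ?n" "0\<^sub>v ?n \<in> U" "\<And>v w. v \<in> U \<Longrightarrow> w \<in> U \<Longrightarrow> v + w \<in> U"
      "\<And>c v. v \<in> U \<Longrightarrow> c \<cdot>\<^sub>v v \<in> U" "\<And>g w. w \<in> U \<Longrightarrow> W g *\<^sub>v w \<in> U"
      by (auto simp: vec_subspace_def)
    define I' where "I' = {x \<in> I. crd x \<in> U}"
    have "ga_left_ideal I'"
      unfolding ga_left_ideal_def ga.subspace_def
      using I(3) U I(1) zero
      by (auto simp: I'_def crd0 add scale basis ga.subspace_def ga_left_ideal_def)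
    then have "I' = {0} \<or> I' = I"
      using min by (auto simp: ga_minimal_left_ideal_def I'_def)
    moreover have "U = crd ` I'"
      using U(1) bij unfolding I'_def bij_betw_def by auto
    ultimately show "U = {0\<^sub>v ?n} \<or> U = carrier_vec ?n"
      using bij by (auto simp: crd0 bij_betw_def)
  qed (rule W)
  then show ?thesis using bij add scale mult expand by (rule that)
qed

text \<open>A minimal left ideal of elements annihilated by every irreducible representation would
  annihilate itself, contradicting the idempotent generator.\<close>

lemma rep_extend_faithful:
  fixes a :: "('g::{finite, group_add}, 'k::field_char_0) group_algebra"
  assumes "\<And>W. irreducible_rep W \<Longrightarrow> rep_extend W a = 0\<^sub>m (rep_dim W) (rep_dim W)"
  shows "a = 0"
proof (rule ccontr)
  assume a: "a \<noteq> 0"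
  define J :: "('g, 'k) group_algebra set" where
    "J = {a. \<forall>W. irreducible_rep W \<longrightarrow> rep_extend W a = 0\<^sub>m (rep_dim W) (rep_dim W)}"
  have J: "ga_left_ideal J"
    unfolding ga_left_ideal_def ga.subspace_def
    by (auto simp: J_def rep_extend_add rep_extend_scale rep_extend_mult irreducible_repD(1) rep_extend_basis)
  have "a \<in> J" using assms by (simp add: J_def)
  with a have "J \<noteq> {0}" by auto
  with J obtain I where I: "ga_minimal_left_ideal I" "I \<subseteq> J"
    by (rule minimal_left_ideal_exists)
  have I': "ga_left_ideal I" "I \<noteq> {0}" using I(1) by (auto simp: ga_minimal_left_ideal_def)
  then have I0: "0 \<in> I" by (auto simp: ga_left_ideal_def ga.subspace_0)
  obtain W :: "'g \<Rightarrow> 'k mat" and crd :: "_ \<Rightarrow> 'k vec" and b where W: "irreducible_rep W"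
    and bij: "bij_betw crd I (carrier_vec (rep_dim W))"
    and "\<And>x y. x \<in> I \<Longrightarrow> y \<in> I \<Longrightarrow> crd (x + y) = crd x + crd y"
    and scale: "\<And>c x. x \<in> I \<Longrightarrow> crd (ga_scale c x) = c \<cdot>\<^sub>v crd x"
    and mult: "\<And>a x. x \<in> I \<Longrightarrow> crd (a * x) = rep_extend W a *\<^sub>v crd x"
    and "\<And>x. x \<in> I \<Longrightarrow> x = (\<Sum>j<rep_dim W. ga_scale (crd x $ j) (b j))"
    by (rule minimal_left_ideal_representation[OF I(1)]) (rule that)
  have cI: "crd x \<in> carrier_vec (rep_dim W)" if "x \<in> I" for x
    using bij that by (auto simp: bij_betw_def)
  have prod0: "x * y = 0" if "x \<in> I" "y \<in> I" for x y
  proof -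
    have "rep_extend W x = 0\<^sub>m (rep_dim W) (rep_dim W)" using that I(2) W by (auto simp: J_def)
    then have "crd (x * y) = 0\<^sub>v (rep_dim W)" using that cI by (simp add: mult zero_mult_mat_vec)
    moreover have "crd 0 = 0\<^sub>v (rep_dim W)"
      using scale[OF I0, of 0] cI[OF I0] by (simp add: zero_smult_vec)
    ultimately show ?thesis
      using bij I0 ga_left_ideal_mult[OF I'(1) that(2)] by (auto simp: bij_betw_def inj_on_def)
  qed
  obtain e where "e \<in> I" "\<And>x. x \<in> I \<Longrightarrow> x * e = x" using maschke_idempotent[OF I'(1)] by blast
  then have "I = {0}" using prod0 I0 by fastforce
  with I'(2) show False ..
qed

lemma ga_eqI:
  fixes a b :: "('g::{finite, group_add}, 'k::field_char_0) group_algebra"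
  assumes "\<And>W. irreducible_rep W \<Longrightarrow> rep_extend W a = rep_extend W b"
  shows "a = b"
proof -
  have "a - b = 0"
    by (rule rep_extend_faithful) (auto simp: rep_extend_minus assms intro!: eq_matI)
  then show ?thesis by simp
qed

section \<open>Schur's lemma and extension of scalars\<close>

lemma mult_mat_unit_vec_index:
  fixes A :: "'a::field mat"
  assumes "A \<in> carrier_mat n m" "i < n" "j < m"
  shows "(A *\<^sub>v unit_vec m j) $ i = A $$ (i, j)"
  using assms by (subst mult_mat_vec_index[of A n m]) (auto simp: unit_vec_def if_distrib[of "\<lambda>x. _ * x"] cong: if_cong)

lemma mat_eqI_mult_vec:
  fixes A B :: "'a::field mat"
  assumes A: "A \<in> carrier_mat n m" and B: "B \<in> carrier_mat n m"
    and eq: "\<And>v. v \<in> carrier_vec m \<Longrightarrow> A *\<^sub>v v = B *\<^sub>v v"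
  shows "A = B"
proof (rule eq_matI)
  fix i j assume "i < dim_row B" "j < dim_col B"
  with B have ij: "i < n" "j < m" by auto
  then show "A $$ (i, j) = B $$ (i, j)"
    using eq[of "unit_vec m j"] mult_mat_unit_vec_index[OF A ij] mult_mat_unit_vec_index[OF B ij] by simp
qed (use A B in auto)

lemma mult_mat_vec_smult:
  fixes A :: "'a::field mat"
  assumes "A \<in> carrier_mat n m" "v \<in> carrier_vec m"
  shows "A *\<^sub>v (c \<cdot>\<^sub>v v) = c \<cdot>\<^sub>v (A *\<^sub>v v)"
  using assms by (intro eq_vecI) (auto simp: scalar_prod_def sum_distrib_left mult_ac)

lemma mult_mat_vec_zero: "A \<in> carrier_mat n m \<Longrightarrow> A *\<^sub>v 0\<^sub>v m = (0\<^sub>v n :: 'a::field vec)"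
  by (intro eq_vecI) (auto simp: scalar_prod_def)

lemma vec_subspace_preimage:
  fixes A :: "'a::field mat"
  assumes A: "A \<in> carrier_mat n m" and U: "vec_subspace n U"
  shows "vec_subspace m {v \<in> carrier_vec m. A *\<^sub>v v \<in> U}"
  using U unfolding vec_subspace_def
  by (auto simp: mult_mat_vec_zero[OF A] mult_mat_vec_smult[OF A] mult_add_distrib_mat_vec[OF A])

lemma vec_subspace_image:
  fixes A :: "'a::field mat"
  assumes A: "A \<in> carrier_mat n m"
  shows "vec_subspace n ((*\<^sub>v) A ` carrier_vec m)"
  unfolding vec_subspace_def
proof (intro conjI allI ballI)
  show "0\<^sub>v n \<in> (*\<^sub>v) A ` carrier_vec m"
    using mult_mat_vec_zero[OF A] by (intro image_eqI[of _ _ "0\<^sub>v m"]) auto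
next
  fix v w assume "v \<in> (*\<^sub>v) A ` carrier_vec m" "w \<in> (*\<^sub>v) A ` carrier_vec m"
  then obtain v' w' where "v = A *\<^sub>v v'" "w = A *\<^sub>v w'" "v' \<in> carrier_vec m" "w' \<in> carrier_vec m" by auto
  then show "v + w \<in> (*\<^sub>v) A ` carrier_vec m"
    using mult_add_distrib_mat_vec[OF A, of v' w'] by (intro image_eqI[of _ _ "v' + w'"]) auto
next
  fix c v assume "v \<in> (*\<^sub>v) A ` carrier_vec m"
  then obtain v' where "v = A *\<^sub>v v'" "v' \<in> carrier_vec m" by auto
  then show "c \<cdot>\<^sub>v v \<in> (*\<^sub>v) A ` carrier_vec m"
    using mult_mat_vec_smult[OF A, of v' c] by (intro image_eqI[of _ _ "c \<cdot>\<^sub>v v'"]) auto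
qed (use A in auto)

lemma vec_subspace_zero: "vec_subspace n {0\<^sub>v n}"
  by (auto simp: vec_subspace_def)

text \<open>Over a field of characteristic \<open>0\<close>, comparing traces of \<open>T * S\<close> and \<open>S * T\<close>
  shows that the two dimensions agree.\<close>

lemma inverse_mats_imp_square:
  fixes T :: "'a::field_char_0 mat"
  assumes T: "T \<in> carrier_mat n m" and S: "S \<in> carrier_mat m n"
    and TS: "T * S = 1\<^sub>m n" and ST: "S * T = 1\<^sub>m m"
  shows "n = m"
proof -
  have "(of_nat n :: 'a) = (\<Sum>i<n. (T * S) $$ (i, i))" by (simp add: TS)
  also have "\<dots> = (\<Sum>i<n. \<Sum>k<m. T $$ (i, k) * S $$ (k, i))"
    using mult_mat_index[OF T S] by (intro sum.cong refl) auto
  also have "\<dots> = (\<Sum>k<m. \<Sum>i<n. S $$ (k, i) * T $$ (i, k))"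
    by (subst sum.swap) (simp add: mult.commute)
  also have "\<dots> = (\<Sum>k<m. (S * T) $$ (k, k))"
    using mult_mat_index[OF S T] by (intro sum.cong refl) auto
  also have "\<dots> = of_nat m" by (simp add: ST)
  finally show ?thesis by simp
qed

text \<open>Kernel and image of \<open>T\<close> are invariant subspaces, so \<open>T\<close> is
  bijective. The inverse \<open>S\<close> is assembled from preimages of the standard basis, because
  the two dimensions are not yet known to agree; their equality follows from the two-sided
  inverse.\<close>

lemma schur_invertible:
  fixes V W :: "'g::group_add \<Rightarrow> 'k::field_char_0 mat"
  assumes V: "irreducible_rep V" and W: "irreducible_rep W"
    and T: "T \<in> carrier_mat (rep_dim W) (rep_dim V)" and T0: "T \<noteq> 0\<^sub>m (rep_dim W) (rep_dim V)"
    and comm: "\<And>g. T * V g = W g * T"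
  obtains S where "rep_dim W = rep_dim V" "S \<in> carrier_mat (rep_dim V) (rep_dim W)"
    "T * S = 1\<^sub>m (rep_dim W)" "S * T = 1\<^sub>m (rep_dim V)"
proof -
  let ?n = "rep_dim V" and ?m = "rep_dim W"
  note rV = irreducible_repD(1)[OF V] and rW = irreducible_repD(1)[OF W]
  have comm_vec: "T *\<^sub>v (V g *\<^sub>v v) = W g *\<^sub>v (T *\<^sub>v v)" if v: "v \<in> carrier_vec ?n" for g v
    using assoc_mult_mat_vec[OF T representation_carrier[OF rV] v, of g]
      assoc_mult_mat_vec[OF representation_carrier[OF rW] T v, of g] comm[of g] by simp
  define K where "K = {v \<in> carrier_vec ?n. T *\<^sub>v v \<in> {0\<^sub>v ?m}}"
  have "V g *\<^sub>v v \<in> K" if "v \<in> K" for g v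
    using that comm_vec[of v g] rV mult_mat_vec_zero[OF representation_carrier[OF rW]]
    by (auto simp: K_def intro: mult_mat_vec_carrier[OF representation_carrier])
  then have K: "K = {0\<^sub>v ?n} \<or> K = carrier_vec ?n"
    using irreducible_repD(3)[OF V, of K] vec_subspace_preimage[OF T vec_subspace_zero] K_def by blast
  have "K \<noteq> carrier_vec ?n"
  proof
    assume "K = carrier_vec ?n"
    then have "T = 0\<^sub>m ?m ?n"
      using T by (intro mat_eqI_mult_vec[OF T]) (auto simp: K_def zero_mult_mat_vec)
    with T0 show False ..
  qed
  then have inj: "v = 0\<^sub>v ?n" if "v \<in> carrier_vec ?n" "T *\<^sub>v v = 0\<^sub>v ?m" for v
    using K that by (auto simp: K_def)
  define R where "R = (*\<^sub>v) T ` carrier_vec ?n"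
  have "W g *\<^sub>v w \<in> R" if w: "w \<in> R" for g w
  proof -
    obtain v where v: "v \<in> carrier_vec ?n" "w = T *\<^sub>v v" using w by (auto simp: R_def)
    have "V g *\<^sub>v v \<in> carrier_vec ?n" using rV v by (auto intro: mult_mat_vec_carrier[OF representation_carrier])
    then show ?thesis unfolding R_def v(2) comm_vec[OF v(1), symmetric] by (rule imageI)
  qed
  then have R: "R = {0\<^sub>v ?m} \<or> R = carrier_vec ?m"
    using irreducible_repD(3)[OF W, of R] vec_subspace_image[OF T] R_def by blast
  have "R \<noteq> {0\<^sub>v ?m}"
  proof
    assume R0: "R = {0\<^sub>v ?m}"
    then have "T = 0\<^sub>m ?m ?n"
      using T by (intro mat_eqI_mult_vec[OF T]) (auto simp: R_def zero_mult_mat_vec)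
    with T0 show False ..
  qed
  with R have "\<exists>y. y \<in> carrier_vec ?n \<and> T *\<^sub>v y = unit_vec ?m j" for j
    using unit_vec_carrier[of ?m j] unfolding R_def by (metis imageE)
  then obtain y where y: "\<And>j. y j \<in> carrier_vec ?n" "\<And>j. T *\<^sub>v y j = unit_vec ?m j" by metis
  define S where "S = mat ?n ?m (\<lambda>(i, j). y j $ i)"
  have S: "S \<in> carrier_mat ?n ?m" by (simp add: S_def)
  have TS: "T * S = 1\<^sub>m ?m"
  proof (rule eq_matI)
    fix i j assume "i < dim_row (1\<^sub>m ?m)" "j < dim_col (1\<^sub>m ?m)"
    then have ij: "i < ?m" "j < ?m" by auto
    have "(T * S) $$ (i, j) = (T *\<^sub>v y j) $ i"
      unfolding mult_mat_index[OF T S ij] mult_mat_vec_index[OF T y(1) ij(1)] using ij by (simp add: S_def)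
    then show "(T * S) $$ (i, j) = 1\<^sub>m ?m $$ (i, j)" using ij y(2) by (simp add: unit_vec_def)
  qed (use T in \<open>auto simp: S_def\<close>)
  have ST: "S * T = 1\<^sub>m ?n"
  proof (rule mat_eqI_mult_vec)
    fix v :: "'k vec" assume v: "v \<in> carrier_vec ?n"
    have Tv: "T *\<^sub>v v \<in> carrier_vec ?m" using T v by simp
    have STv: "S *\<^sub>v (T *\<^sub>v v) \<in> carrier_vec ?n" using S Tv by simp
    have "T *\<^sub>v (S *\<^sub>v (T *\<^sub>v v)) = T *\<^sub>v v"
      using assoc_mult_mat_vec[OF T S Tv] TS Tv by simp
    then have "T *\<^sub>v (S *\<^sub>v (T *\<^sub>v v) - v) = 0\<^sub>v ?m"
      using mult_minus_distrib_mat_vec[OF T STv v] Tv by simp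
    then have 0: "S *\<^sub>v (T *\<^sub>v v) - v = 0\<^sub>v ?n" using inj STv v by auto
    have "S *\<^sub>v (T *\<^sub>v v) = v"
    proof (rule eq_vecI)
      fix i assume "i < dim_vec v"
      then show "(S *\<^sub>v (T *\<^sub>v v)) $ i = v $ i"
        using arg_cong[OF 0, of "\<lambda>u :: 'k vec. u $ i"] v by (simp del: index_mult_mat_vec)
    qed (use STv v S in auto)
    then show "S * T *\<^sub>v v = 1\<^sub>m ?n *\<^sub>v v" using assoc_mult_mat_vec[OF S T v] v by simp
  qed (use S T in auto)
  show ?thesis using inverse_mats_imp_square[OF T S TS ST] S TS ST by (rule that)
qed

lemma schur_iso:
  fixes V W :: "'g::group_add \<Rightarrow> 'k::field_char_0 mat"
  assumes V: "irreducible_rep V" and W: "irreducible_rep W"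
    and T: "T \<in> carrier_mat (rep_dim W) (rep_dim V)" and T0: "T \<noteq> 0\<^sub>m (rep_dim W) (rep_dim V)"
    and comm: "\<And>g. T * V g = W g * T"
  shows "rep_iso V W"
proof -
  obtain S where S: "rep_dim W = rep_dim V" "S \<in> carrier_mat (rep_dim V) (rep_dim W)"
    "T * S = 1\<^sub>m (rep_dim W)" "S * T = 1\<^sub>m (rep_dim V)"
    using schur_invertible[OF assms] .
  show ?thesis
    by (rule rep_isoI[of _ _ T S]) (use S T comm in auto)
qed

lemma irreducible_rep_iso:
  fixes V W :: "'g::group_add \<Rightarrow> 'k::field mat"
  assumes "rep_iso V W" and V: "irreducible_rep V" and W: "representation W"
  shows "irreducible_rep W"
proof -
  obtain P Q where d: "rep_dim V = rep_dim W" and P: "P \<in> carrier_mat (rep_dim V) (rep_dim V)"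
    and Q: "Q \<in> carrier_mat (rep_dim V) (rep_dim V)" and PQ: "P * Q = 1\<^sub>m (rep_dim V)" "Q * P = 1\<^sub>m (rep_dim V)"
    and iso: "\<And>g. P * V g = W g * P" using assms(1) by (rule rep_isoE) blast
  let ?n = "rep_dim V"
  note rV = irreducible_repD(1)[OF V]
  show ?thesis
    unfolding irreducible_rep_def
  proof (intro conjI allI impI)
    show "rep_dim W \<noteq> 0" using irreducible_repD(2)[OF V] d by simp
    fix U assume "vec_subspace (rep_dim W) U \<and> (\<forall>g. \<forall>w\<in>U. W g *\<^sub>v w \<in> U)"
    then have U: "vec_subspace ?n U" and inv: "\<And>g w. w \<in> U \<Longrightarrow> W g *\<^sub>v w \<in> U" using d by auto
    define U' where "U' = {v \<in> carrier_vec ?n. P *\<^sub>v v \<in> U}"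
    have "V g *\<^sub>v v \<in> U'" if "v \<in> U'" for g v
    proof -
      have v: "v \<in> carrier_vec ?n" "P *\<^sub>v v \<in> U" using that by (auto simp: U'_def)
      have Wg: "W g \<in> carrier_mat ?n ?n" using representation_carrier[OF W, of g] d by simp
      have "P *\<^sub>v (V g *\<^sub>v v) = W g *\<^sub>v (P *\<^sub>v v)"
        using assoc_mult_mat_vec[OF P representation_carrier[OF rV] v(1), of g]
          assoc_mult_mat_vec[OF Wg P v(1)] iso[of g] by simp
      then show ?thesis
        using inv[OF v(2), of g] v(1) mult_mat_vec_carrier[OF representation_carrier[OF rV] v(1), of g]
        by (simp add: U'_def)
    qed
    then have U': "U' = {0\<^sub>v ?n} \<or> U' = carrier_vec ?n"
      using irreducible_repD(3)[OF V, of U'] vec_subspace_preimage[OF P U] U'_def by blast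
    have PQu: "P *\<^sub>v (Q *\<^sub>v u) = u" if "u \<in> carrier_vec ?n" for u
      using assoc_mult_mat_vec[OF P Q that] one_mult_mat_vec[OF that] by (simp only: PQ)
    have Qc: "Q *\<^sub>v u \<in> carrier_vec ?n" if "u \<in> carrier_vec ?n" for u
      using Q that by (rule mult_mat_vec_carrier)
    have Uc: "U \<subseteq> carrier_vec ?n" "0\<^sub>v ?n \<in> U" using U by (auto simp: vec_subspace_def)
    show "U = {0\<^sub>v (rep_dim W)} \<or> U = carrier_vec (rep_dim W)"
    proof (cases "U' = {0\<^sub>v ?n}")
      case True
      have "u = 0\<^sub>v ?n" if u: "u \<in> U" for u
      proof -
        have uc: "u \<in> carrier_vec ?n" using Uc u by auto
        then have "Q *\<^sub>v u \<in> U'" using u PQu Qc by (simp add: U'_def)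
        then have "Q *\<^sub>v u = 0\<^sub>v ?n" using True by blast
        then show ?thesis using PQu[OF uc] mult_mat_vec_zero[OF P] by simp
      qed
      then have "U = {0\<^sub>v ?n}" using Uc by blast
      then show ?thesis by (simp add: d)
    next
      case False
      then have all: "U' = carrier_vec ?n" using U' by blast
      have "u \<in> U" if u: "u \<in> carrier_vec ?n" for u
      proof -
        have "Q *\<^sub>v u \<in> U'" unfolding all using u by (rule Qc)
        then show ?thesis using PQu[OF u] by (simp add: U'_def)
      qed
      then have "U = carrier_vec ?n" using Uc by blast
      then show ?thesis by (simp add: d)
    qed
  qed (rule W)
qed

text \<open>Along \<open>h\<close> the larger field is a vector space over the smaller one, and a
  functional extends from the line through \<open>u\<close>. Applied to matrix entries, such
  functionals carry intertwiners, kernel vectors and projections back to the smaller field without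
  tensor products; the value 1 at \<open>u\<close> protects a chosen nonzero entry. The instances of
  \<open>h\<close> are \<open>to_ac\<close> and \<open>of_rat\<close>.\<close>

lemma field_hom_linear_functional:
  fixes h :: "'a::field \<Rightarrow> 'b::field"
  assumes h: "h 1 = 1" "\<And>x y. h (x + y) = h x + h y" "\<And>x y. h (x * y) = h x * h y" and u: "u \<noteq> 0"
  obtains f :: "'b \<Rightarrow> 'a" where "\<And>x y. f (x + y) = f x + f y" "\<And>c x. f (h c * x) = c * f x" "f u = 1"
proof -
  interpret vs: vector_space_pair "\<lambda>c x. h c * x" "(*) :: 'a \<Rightarrow> 'a \<Rightarrow> 'a"
    by unfold_locales (simp_all add: h algebra_simps)
  have "vs.vs1.independent {u}" using u by simp
  from vs.linear_independent_extend[OF this, of "\<lambda>_. 1"]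
  obtain f where f: "Vector_Spaces.linear (\<lambda>c x. h c * x) (*) f" "f u = 1" by auto
  interpret f: Vector_Spaces.linear "\<lambda>c x. h c * x" "(*)" f by fact
  show ?thesis using f.add f.scale f(2) by (rule that)
qed

lemma linear_functional_sum:
  fixes f :: "'b::comm_ring_1 \<Rightarrow> 'a::comm_ring_1"
  assumes add: "\<And>x y. f (x + y) = f x + f y"
  shows "f (sum F A) = (\<Sum>i\<in>A. f (F i))"
proof -
  have "f 0 = 0" using add[of 0 0] by simp
  then show ?thesis by (induction A rule: infinite_finite_induct) (auto simp: add)
qed

section \<open>Extension of scalars to the algebraic closure\<close>

abbreviation extend_scalars :: "('g \<Rightarrow> 'k::field mat) \<Rightarrow> 'g \<Rightarrow> 'k alg_closure mat" where
  "extend_scalars V \<equiv> (\<lambda>g. map_mat to_ac (V g))"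

lemma map_mat_to_ac_mult:
  "A \<in> carrier_mat n m \<Longrightarrow> B \<in> carrier_mat m p \<Longrightarrow> map_mat to_ac (A * B) = map_mat to_ac A * map_mat to_ac B"
  by (rule eq_matI) (auto simp: scalar_prod_def to_ac_sum)

lemma representation_extend_scalars:
  assumes "representation V"
  shows "representation (extend_scalars V)" "rep_dim (extend_scalars V) = rep_dim V"
proof -
  show d: "rep_dim (extend_scalars V) = rep_dim V" by (simp add: rep_dim_def)
  show "representation (extend_scalars V)"
    unfolding representation_def d
    using assms map_mat_to_ac_mult[OF representation_carrier[OF assms] representation_carrier[OF assms]]
    by (auto simp: representation_add representation_0 intro!: eq_matI)
qed

text \<open>An invariant subspace \<open>U\<close> over the base field generates the invariant subspace of all
  vectors whose images under base-linear functionals lie in \<open>U\<close>.\<close>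

lemma irreducible_of_extend_scalars:
  fixes V :: "'g::group_add \<Rightarrow> 'k::field mat"
  assumes V: "representation V" and irr: "irreducible_rep (extend_scalars V)"
  shows "irreducible_rep V"
proof -
  let ?n = "rep_dim V"
  note d = representation_extend_scalars(2)[OF V]
  have "U = {0\<^sub>v ?n} \<or> U = carrier_vec ?n"
    if U: "vec_subspace ?n U" and inv: "\<And>g w. w \<in> U \<Longrightarrow> V g *\<^sub>v w \<in> U" for U
  proof -
    define F where "F = {f :: 'k alg_closure \<Rightarrow> 'k. (\<forall>x y. f (x + y) = f x + f y) \<and> (\<forall>c x. f (to_ac c * x) = c * f x)}"
    have F_to_ac: "f (to_ac c) = c * f 1" if "f \<in> F" for f c
    proof -
      have "f (to_ac c * 1) = c * f 1" using that unfolding F_def by blast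
      then show ?thesis by simp
    qed
    have F0: "f 0 = 0" if "f \<in> F" for f
      using F_to_ac[OF that, of 0] by simp
    \<comment> \<open>\<open>F\<close> is stable under precomposition with multiplication by an
      element of the closure; this makes \<open>U'\<close> a subspace over the closure although
      \<open>U\<close> is one only over the base field.\<close>
    have F_scale: "(\<lambda>x. f (c * x)) \<in> F" if "f \<in> F" for f c
      using that by (auto simp: F_def distrib_left) (metis mult.left_commute)
    have F_mult: "map_vec f (map_mat to_ac A *\<^sub>v v) = A *\<^sub>v map_vec f v"
      if f: "f \<in> F" and A: "A \<in> carrier_mat ?n ?n" and v: "v \<in> carrier_vec ?n" for f A v
    proof (rule eq_vecI)
      fix i assume "i < dim_vec (A *\<^sub>v map_vec f v)"
      then have i: "i < ?n" using A by simp
      have add: "\<And>x y. f (x + y) = f x + f y" and sc: "\<And>c x. f (to_ac c * x) = c * f x"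
        using f by (auto simp: F_def)
      show "map_vec f (map_mat to_ac A *\<^sub>v v) $ i = (A *\<^sub>v map_vec f v) $ i"
        using A v i by (simp add: scalar_prod_def linear_functional_sum[OF add] sc)
    qed (use A in auto)
    define U' where "U' = {v \<in> carrier_vec ?n. \<forall>f\<in>F. map_vec f v \<in> U}"
    have Uc: "U \<subseteq> carrier_vec ?n" "0\<^sub>v ?n \<in> U" and Uadd: "\<And>v w. v \<in> U \<Longrightarrow> w \<in> U \<Longrightarrow> v + w \<in> U"
      and Usc: "\<And>c v. v \<in> U \<Longrightarrow> c \<cdot>\<^sub>v v \<in> U"
      using U by (auto simp: vec_subspace_def)
    have "vec_subspace ?n U'"
      unfolding vec_subspace_def
    proof (intro conjI ballI allI)
      show "U' \<subseteq> carrier_vec ?n" by (auto simp: U'_def)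
      have "map_vec f (0\<^sub>v ?n) = 0\<^sub>v ?n" if "f \<in> F" for f
        using F0[OF that] by (intro eq_vecI) auto
      then show "0\<^sub>v ?n \<in> U'" using Uc by (auto simp: U'_def)
      fix v assume v: "v \<in> U'"
      {
        fix w assume w: "w \<in> U'"
        have "map_vec f (v + w) = map_vec f v + map_vec f w" if "f \<in> F" for f
          using that v w by (intro eq_vecI) (auto simp: U'_def F_def)
        then show "v + w \<in> U'" using v w Uadd by (auto simp: U'_def)
      }
      fix c
      have "map_vec f (c \<cdot>\<^sub>v v) \<in> U" if f: "f \<in> F" for f
      proof -
        have "map_vec f (c \<cdot>\<^sub>v v) = map_vec (\<lambda>x. f (c * x)) v"
          by (intro eq_vecI) auto
        moreover have "map_vec (\<lambda>x. f (c * x)) v \<in> U"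
          using v F_scale[OF f, of c] by (auto simp: U'_def)
        ultimately show ?thesis by simp
      qed
      then show "c \<cdot>\<^sub>v v \<in> U'" using v by (auto simp: U'_def)
    qed
    moreover have "extend_scalars V g *\<^sub>v v \<in> U'" if "v \<in> U'" for g v
      using that F_mult[OF _ representation_carrier[OF V]] inv V
      by (auto simp: U'_def intro!: mult_mat_vec_carrier[of _ ?n ?n])
    ultimately have U': "U' = {0\<^sub>v ?n} \<or> U' = carrier_vec ?n"
      using irreducible_repD(3)[OF irr, of U'] d by simp
    have to_ac_U': "map_vec to_ac u \<in> U'" if "u \<in> U" for u
    proof -
      have "map_vec f (map_vec to_ac u) = f 1 \<cdot>\<^sub>v u" if "f \<in> F" for f
        using F_to_ac[OF that] by (intro eq_vecI) (auto simp: mult.commute)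
      then show ?thesis using that Uc Usc by (auto simp: U'_def)
    qed
    show ?thesis
      using U'
    proof
      assume U': "U' = {0\<^sub>v ?n}"
      have "u = 0\<^sub>v ?n" if u: "u \<in> U" for u
      proof -
        have *: "map_vec to_ac u = 0\<^sub>v ?n" using to_ac_U'[OF u] U' by simp
        have "u \<in> carrier_vec ?n" using Uc u by auto
        then show ?thesis
        proof (intro eq_vecI)
          fix i assume "i < dim_vec (0\<^sub>v ?n)"
          then show "u $ i = 0\<^sub>v ?n $ i"
            using arg_cong[OF *, of "\<lambda>v :: 'k alg_closure vec. v $ i"] \<open>u \<in> carrier_vec ?n\<close> by simp
        qed auto
      qed
      then have "U = {0\<^sub>v ?n}" using Uc by blast
      then show ?thesis ..
    next
      assume U': "U' = carrier_vec ?n"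
      \<comment> \<open>A functional that is a left inverse of \<open>to_ac\<close>: it recovers
        \<open>u\<close> from its image in \<open>U'\<close>, so \<open>U\<close> is
        everything.\<close>
      obtain f :: "'k alg_closure \<Rightarrow> 'k" where f: "\<And>x y. f (x + y) = f x + f y" "\<And>c x. f (to_ac c * x) = c * f x" "f 1 = 1"
        by (rule field_hom_linear_functional[of to_ac "1 :: 'k alg_closure"]) (auto intro: that)
      then have fF: "f \<in> F" by (simp add: F_def)
      have "u \<in> U" if "u \<in> carrier_vec ?n" for u
      proof -
        have "map_vec f (map_vec to_ac u) = u"
          using F_to_ac[OF fF] f(3) by (intro eq_vecI) auto
        moreover have "map_vec to_ac u \<in> U'" using U' that by simp
        ultimately show ?thesis using fF by (auto simp: U'_def)
      qed
      then have "U = carrier_vec ?n" using Uc by blast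
      then show ?thesis ..
    qed
  qed
  then show ?thesis
    using V irreducible_repD(2)[OF irr] d by (auto simp: irreducible_rep_def)
qed

text \<open>The left ideal of all \<open>x\<close> with \<open>x * e = 0\<close> is a complement of
  \<open>N\<close>. A minimal left ideal inside it cannot lie in \<open>N\<close>, where right
  multiplication by \<open>e\<close> is the identity.\<close>

lemma minimal_left_ideal_not_subset:
  fixes N :: "('g::{finite, group_add}, 'k::field_char_0) group_algebra set"
  assumes N: "ga_left_ideal N" "N \<noteq> UNIV"
  obtains I where "ga_minimal_left_ideal I" "\<not> I \<subseteq> N"
proof -
  obtain e where e: "e \<in> N" "\<And>x. x \<in> N \<Longrightarrow> x * e = x"
    using maschke_idempotent[OF N(1)] by blast
  define I0 where "I0 = {x. x * e = 0}"
  have I0: "ga_left_ideal I0"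
    by (auto simp: ga_left_ideal_def ga.subspace_def I0_def distrib_right ga_scale_times_left mult.assoc)
  have "e \<noteq> 1"
  proof
    assume "e = 1"
    then have "x \<in> N" for x using ga_left_ideal_mult[OF N(1) e(1), of x] by simp
    with N(2) show False by blast
  qed
  moreover have "1 - e \<in> I0" using e by (simp add: I0_def left_diff_distrib)
  ultimately have "I0 \<noteq> {0}" by auto
  with I0 obtain I where I: "ga_minimal_left_ideal I" "I \<subseteq> I0"
    by (rule minimal_left_ideal_exists)
  have "\<not> I \<subseteq> N"
  proof
    assume "I \<subseteq> N"
    have "x = 0" if "x \<in> I" for x
    proof -
      have "x * e = 0" "x * e = x" using that I(2) e(2)[of x] \<open>I \<subseteq> N\<close> by (auto simp: I0_def)
      then show ?thesis by simp
    qed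
    then have "I \<subseteq> {0}" by blast
    moreover have "0 \<in> I" "I \<noteq> {0}"
      using I(1) by (auto simp: ga_minimal_left_ideal_def ga_left_ideal_def ga.subspace_0)
    ultimately show False by blast
  qed
  with I(1) show ?thesis by (rule that)
qed

lemma rep_extend_sum_index:
  fixes a :: "'i \<Rightarrow> ('g::{finite, group_add}, 'k::field) group_algebra"
  assumes "i < rep_dim V" "k < rep_dim V"
  shows "rep_extend V (\<Sum>j\<in>J. ga_scale (c j) (a j)) $$ (i, k) = (\<Sum>j\<in>J. c j * rep_extend V (a j) $$ (i, k))"
  using assms
  by (induction J rule: infinite_finite_induct) (auto simp: rep_extend_add rep_extend_scale)

text \<open>Acting on the first standard basis vector is a homomorphism of left modules from the
  group algebra to the space of \<open>V\<close>. Its kernel \<open>N\<close> misses 1, so some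
  minimal left ideal is mapped nontrivially, and \<open>T\<close> is the matrix of this restriction.
  The lemma is applied to an extension of scalars whose irreducibility is still to be shown.\<close>

lemma irreducible_embeds_minimal_left_ideal:
  fixes V :: "'g::{finite, group_add} \<Rightarrow> 'k::field_char_0 mat"
  assumes V: "representation V" and n0: "rep_dim V \<noteq> 0"
  obtains W :: "'g \<Rightarrow> 'k mat" and T where "irreducible_rep W"
    "T \<in> carrier_mat (rep_dim V) (rep_dim W)" "T \<noteq> 0\<^sub>m (rep_dim V) (rep_dim W)"
    "\<And>g. T * W g = V g * T"
proof -
  let ?n = "rep_dim V"
  define N where "N = {a. \<forall>i<?n. rep_extend V a $$ (i, 0) = 0}"
  have "ga_left_ideal N"
    unfolding ga_left_ideal_def ga.subspace_def
  proof (intro conjI allI ballI)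
    fix g x assume x: "x \<in> N"
    have "rep_extend V (basis_elem g * x) $$ (i, 0) = 0" if i: "i < ?n" for i
      unfolding rep_extend_mult[OF V]
      using x n0 by (subst mult_mat_index[OF rep_extend_carrier rep_extend_carrier i]) (auto simp: N_def)
    then show "basis_elem g * x \<in> N" by (simp add: N_def)
  qed (use n0 in \<open>auto simp: N_def rep_extend_add rep_extend_scale\<close>)
  moreover have "1 \<notin> N" using n0 by (auto simp: N_def rep_extend_one[OF V])
  ultimately obtain I where I: "ga_minimal_left_ideal I" "\<not> I \<subseteq> N"
    using minimal_left_ideal_not_subset[of N] by blast
  have Il: "ga_left_ideal I" using I(1) by (simp add: ga_minimal_left_ideal_def)
  obtain W :: "'g \<Rightarrow> 'k mat" and crd :: "_ \<Rightarrow> 'k vec" and b where W: "irreducible_rep W"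
    and bij: "bij_betw crd I (carrier_vec (rep_dim W))"
    and "\<And>x y. x \<in> I \<Longrightarrow> y \<in> I \<Longrightarrow> crd (x + y) = crd x + crd y"
    and "\<And>c x. x \<in> I \<Longrightarrow> crd (ga_scale c x) = c \<cdot>\<^sub>v crd x"
    and mult: "\<And>a x. x \<in> I \<Longrightarrow> crd (a * x) = rep_extend W a *\<^sub>v crd x"
    and expand: "\<And>x. x \<in> I \<Longrightarrow> x = (\<Sum>j<rep_dim W. ga_scale (crd x $ j) (b j))"
    by (rule minimal_left_ideal_representation[OF I(1)]) (rule that)
  let ?m = "rep_dim W"
  note rW = irreducible_repD(1)[OF W]
  define T where "T = mat ?n ?m (\<lambda>(i, j). rep_extend V (b j) $$ (i, 0))"
  have T: "T \<in> carrier_mat ?n ?m" by (simp add: T_def)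
  have crd_carrier: "crd x \<in> carrier_vec ?m" if "x \<in> I" for x
    using bij that by (auto simp: bij_betw_def)
  have T_crd: "T *\<^sub>v crd x = vec ?n (\<lambda>i. rep_extend V x $$ (i, 0))" if x: "x \<in> I" for x
  proof (rule eq_vecI)
    fix i assume "i < dim_vec (vec ?n (\<lambda>i. rep_extend V x $$ (i, 0)))"
    then have i: "i < ?n" by simp
    have "rep_extend V x $$ (i, 0) = (\<Sum>j<?m. crd x $ j * rep_extend V (b j) $$ (i, 0))"
      using i n0 by (subst expand[OF x]) (simp add: rep_extend_sum_index)
    then show "(T *\<^sub>v crd x) $ i = vec ?n (\<lambda>i. rep_extend V x $$ (i, 0)) $ i"
      unfolding mult_mat_vec_index[OF T crd_carrier[OF x] i] using i by (simp add: T_def mult.commute)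
  qed (simp add: T_def)
  show ?thesis
  proof
    show "T \<noteq> 0\<^sub>m ?n ?m"
    proof
      assume T0: "T = 0\<^sub>m ?n ?m"
      have "x \<in> N" if x: "x \<in> I" for x
      proof -
        have *: "vec ?n (\<lambda>i. rep_extend V x $$ (i, 0)) = 0\<^sub>v ?n"
          using T_crd[OF x] crd_carrier[OF x] by (simp add: T0 zero_mult_mat_vec)
        have "rep_extend V x $$ (i, 0) = 0" if "i < ?n" for i
          using arg_cong[OF *, of "\<lambda>v :: 'k vec. v $ i"] that by simp
        then show ?thesis by (simp add: N_def)
      qed
      with I(2) show False by blast
    qed
    fix g
    show "T * W g = V g * T"
    proof (rule mat_eqI_mult_vec)
      fix v :: "'k vec" assume v: "v \<in> carrier_vec ?m"
      then obtain x where x: "x \<in> I" "v = crd x" using bij by (auto simp: bij_betw_def)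
      have gx: "basis_elem g * x \<in> I" using Il x(1) by (rule ga_left_ideal_mult)
      have "T *\<^sub>v (W g *\<^sub>v v) = T *\<^sub>v crd (basis_elem g * x)"
        using x rW by (simp add: mult rep_extend_basis)
      also have "\<dots> = vec ?n (\<lambda>i. rep_extend V (basis_elem g * x) $$ (i, 0))"
        by (rule T_crd[OF gx])
      also have "\<dots> = V g *\<^sub>v (T *\<^sub>v v)"
      proof (rule eq_vecI)
        fix i assume "i < dim_vec (V g *\<^sub>v (T *\<^sub>v v))"
        then have i: "i < ?n" using V by simp
        have "(V g *\<^sub>v (T *\<^sub>v v)) $ i = (\<Sum>k<?n. V g $$ (i, k) * rep_extend V x $$ (k, 0))"
          unfolding x(2) T_crd[OF x(1)]
          by (subst mult_mat_vec_index[OF representation_carrier[OF V] _ i]) auto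
        also have "\<dots> = rep_extend V (basis_elem g * x) $$ (i, 0)"
          unfolding rep_extend_mult[OF V] rep_extend_basis[OF V]
          using n0 by (subst mult_mat_index[OF representation_carrier[OF V] rep_extend_carrier i]) auto
        finally show "vec ?n (\<lambda>i. rep_extend V (basis_elem g * x) $$ (i, 0)) $ i = (V g *\<^sub>v (T *\<^sub>v v)) $ i"
          using i by simp
      qed (use V in simp)
      finally show "T * W g *\<^sub>v v = V g * T *\<^sub>v v"
        using assoc_mult_mat_vec[OF T representation_carrier[OF rW] v, of g]
          assoc_mult_mat_vec[OF representation_carrier[OF V] T v, of g] by simp
    next
      show "T * W g \<in> carrier_mat ?n ?m" "V g * T \<in> carrier_mat ?n ?m"
        using T representation_carrier[OF rW, of g] representation_carrier[OF V, of g]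
        by (auto simp del: representation_carrier)
    qed
  qed (rule W, rule T)
qed

text \<open>The hypothesis on fields of definition enters here. An irreducible \<open>W\<close> that
  maps nontrivially to the extension of \<open>V\<close> has a form \<open>W'\<close> over the base
  field, and \<open>W'\<close> is irreducible because its extension is. A functional applied to the
  entries of the intertwiner gives a nonzero intertwiner from \<open>W'\<close> to \<open>V\<close>,
  an isomorphism by Schur's lemma, so the extension of \<open>V\<close> is isomorphic to that of
  \<open>W'\<close>.\<close>

lemma irreducible_extend_scalars:
  fixes V :: "'g::{finite, group_add} \<Rightarrow> 'k::field_char_0 mat"
  assumes base: "\<And>V :: 'g \<Rightarrow> 'k alg_closure mat. representation V \<Longrightarrow> defined_over_base V"
    and V: "irreducible_rep V"
  shows "irreducible_rep (extend_scalars V)"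
proof -
  let ?n = "rep_dim V" and ?VK = "extend_scalars V"
  note rV = irreducible_repD(1)[OF V] and rVK = representation_extend_scalars[OF irreducible_repD(1)[OF V]]
  obtain W :: "'g \<Rightarrow> 'k alg_closure mat" and T where W: "irreducible_rep W"
    and T: "T \<in> carrier_mat ?n (rep_dim W)" "T \<noteq> 0\<^sub>m ?n (rep_dim W)"
    and TW: "\<And>g. T * W g = ?VK g * T"
    using irreducible_embeds_minimal_left_ideal[OF rVK(1)] irreducible_repD(2)[OF V] unfolding rVK(2) by metis
  note rW = irreducible_repD(1)[OF W]
  obtain W' :: "'g \<Rightarrow> 'k mat" where W': "representation W'" and iso: "rep_iso W (extend_scalars W')"
    using base[OF rW] by (auto simp: defined_over_base_def)
  note rW'K = representation_extend_scalars[OF W']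
  have "irreducible_rep (extend_scalars W')" by (rule irreducible_rep_iso[OF iso W rW'K(1)])
  then have irrW': "irreducible_rep W'" by (rule irreducible_of_extend_scalars[OF W'])
  let ?m = "rep_dim W'"
  from rep_iso_sym[OF iso rW rW'K(1)]
  obtain Q P where d: "?m = rep_dim W" and Q: "Q \<in> carrier_mat ?m ?m" and P: "P \<in> carrier_mat ?m ?m"
    and QP: "Q * P = 1\<^sub>m ?m" and Qc: "\<And>g. Q * extend_scalars W' g = W g * Q"
    unfolding rW'K(2)[symmetric] by (rule rep_isoE) blast
  have T': "T \<in> carrier_mat ?n ?m" using T d by simp
  have Wg: "W g \<in> carrier_mat ?m ?m" "extend_scalars W' g \<in> carrier_mat ?m ?m" "?VK g \<in> carrier_mat ?n ?n" for g
    using representation_carrier[OF rW, of g] d representation_carrier[OF W', of g] representation_carrier[OF rV, of g]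
    by auto
  define S where "S = T * Q"
  have S: "S \<in> carrier_mat ?n ?m" using T' Q by (auto simp: S_def)
  have SW: "S * extend_scalars W' g = ?VK g * S" for g
  proof -
    have "S * extend_scalars W' g = T * (W g * Q)"
      unfolding S_def Qc[symmetric] by (rule assoc_mult_mat[OF T' Q Wg(2)])
    also have "\<dots> = ?VK g * T * Q" unfolding TW[symmetric] by (rule assoc_mult_mat[OF T' Wg(1) Q, symmetric])
    also have "\<dots> = ?VK g * S" unfolding S_def by (rule assoc_mult_mat[OF Wg(3) T' Q])
    finally show ?thesis .
  qed
  have "\<exists>i<?n. \<exists>j<?m. S $$ (i, j) \<noteq> 0"
  proof (rule ccontr)
    assume "\<not> ?thesis"
    then have S0: "S = 0\<^sub>m ?n ?m" using S by (intro eq_matI) auto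
    have "T = T * (Q * P)" using T' QP by simp
    also have "\<dots> = S * P" unfolding S_def by (rule assoc_mult_mat[OF T' Q P, symmetric])
    also have "\<dots> = 0\<^sub>m ?n ?m" using S0 P by simp
    finally show False using T(2) d by simp
  qed
  then obtain i0 j0 where i0: "i0 < ?n" "j0 < ?m" "S $$ (i0, j0) \<noteq> 0" by blast
  \<comment> \<open>The functional is normalized at a nonzero entry of \<open>S\<close>, so that the
    descended matrix \<open>R\<close> is not zero.\<close>
  obtain f :: "'k alg_closure \<Rightarrow> 'k" where add: "\<And>x y. f (x + y) = f x + f y"
    and sc: "\<And>c x. f (to_ac c * x) = c * f x" and f1: "f (S $$ (i0, j0)) = 1"
    by (rule field_hom_linear_functional[of to_ac "S $$ (i0, j0)"]) (use i0 that in auto)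
  define R where "R = map_mat f S"
  have R: "R \<in> carrier_mat ?n ?m" using S by (simp add: R_def)
  have "R \<noteq> 0\<^sub>m ?n ?m"
    using f1 i0 S by (metis R_def carrier_matD index_map_mat(1) index_zero_mat(1) zero_neq_one)
  moreover have "R * W' g = V g * R" for g
  proof (rule eq_matI)
    fix i j assume "i < dim_row (V g * R)" "j < dim_col (V g * R)"
    then have ij: "i < ?n" "j < ?m" using R rV by auto
    have "(R * W' g) $$ (i, j) = (\<Sum>k<?m. f (to_ac (W' g $$ (k, j)) * S $$ (i, k)))"
      unfolding mult_mat_index[OF R representation_carrier[OF W'] ij]
      using ij S by (simp add: R_def sc) (simp add: mult.commute)
    also have "\<dots> = f ((S * extend_scalars W' g) $$ (i, j))"
      unfolding mult_mat_index[OF S Wg(2) ij]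
      unfolding linear_functional_sum[OF add]
    proof (intro sum.cong refl)
      fix k assume "k \<in> {..<?m}"
      then have "extend_scalars W' g $$ (k, j) = to_ac (W' g $$ (k, j))" using ij W' by simp
      then show "f (to_ac (W' g $$ (k, j)) * S $$ (i, k)) = f (S $$ (i, k) * extend_scalars W' g $$ (k, j))"
        by (simp only: mult.commute)
    qed
    also have "\<dots> = f ((?VK g * S) $$ (i, j))" by (simp only: SW)
    also have "\<dots> = (\<Sum>k<?n. f (to_ac (V g $$ (i, k)) * S $$ (k, j)))"
      unfolding mult_mat_index[OF Wg(3) S ij]
      using ij rV by (simp add: linear_functional_sum[OF add])
    also have "\<dots> = (V g * R) $$ (i, j)"
      unfolding mult_mat_index[OF representation_carrier[OF rV] R ij]
      using ij S by (simp add: R_def sc)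
    finally show "(R * W' g) $$ (i, j) = (V g * R) $$ (i, j)" .
  qed (use R rV W' in auto)
  ultimately have "rep_iso W' V" by (rule schur_iso[OF irrW' V R])
  then obtain A B where dA: "?m = ?n" and A: "A \<in> carrier_mat ?m ?m" and B: "B \<in> carrier_mat ?m ?m"
    and AB: "A * B = 1\<^sub>m ?m" "B * A = 1\<^sub>m ?m" and Ac: "\<And>g. A * W' g = V g * A"
    by (rule rep_isoE) blast
  have "rep_iso (extend_scalars W') ?VK"
  proof (rule rep_isoI[of _ _ "map_mat to_ac A" "map_mat to_ac B"])
    fix g
    have Vg: "V g \<in> carrier_mat ?m ?m" using representation_carrier[OF rV, of g] dA by simp
    show "map_mat to_ac A * extend_scalars W' g = ?VK g * map_mat to_ac A"
      unfolding map_mat_to_ac_mult[OF A representation_carrier[OF W'], symmetric]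
        map_mat_to_ac_mult[OF Vg A, symmetric] Ac ..
  next
    show "map_mat to_ac A * map_mat to_ac B = 1\<^sub>m (rep_dim (extend_scalars W'))"
      "map_mat to_ac B * map_mat to_ac A = 1\<^sub>m (rep_dim (extend_scalars W'))"
      unfolding map_mat_to_ac_mult[OF A B, symmetric] map_mat_to_ac_mult[OF B A, symmetric] AB rW'K(2)
      by (auto intro!: eq_matI)
  qed (use dA A B rW'K rVK in auto)
  then show ?thesis by (rule irreducible_rep_iso[OF _ \<open>irreducible_rep (extend_scalars W')\<close> rVK(1)])
qed

lemma smult_one_mult_mat_vec:
  fixes v :: "'a::field vec"
  assumes "v \<in> carrier_vec n"
  shows "(c \<cdot>\<^sub>m 1\<^sub>m n) *\<^sub>v v = c \<cdot>\<^sub>v v"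
  using assms smult_mult_mat_vec[OF one_carrier_mat assms] by simp

text \<open>Schur's lemma: an eigenspace over the algebraic closure is everything.\<close>

lemma schur_scalar:
  fixes V :: "'g::{finite, group_add} \<Rightarrow> 'k::field_char_0 mat"
  assumes base: "\<And>V :: 'g \<Rightarrow> 'k alg_closure mat. representation V \<Longrightarrow> defined_over_base V"
    and V: "irreducible_rep V" and P: "P \<in> carrier_mat (rep_dim V) (rep_dim V)"
    and comm: "\<And>g. P * V g = V g * P"
  shows "P = P $$ (0, 0) \<cdot>\<^sub>m 1\<^sub>m (rep_dim V)"
proof -
  let ?n = "rep_dim V" and ?PK = "map_mat to_ac P" and ?VK = "extend_scalars V"
  note rV = irreducible_repD(1)[OF V] and n0 = irreducible_repD(2)[OF V]
  have VK: "irreducible_rep ?VK" by (rule irreducible_extend_scalars[OF base V])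
  have VKg: "?VK g \<in> carrier_mat ?n ?n" for g using rV by simp
  have PK: "?PK \<in> carrier_mat ?n ?n" using P by simp
  have commK: "?PK * ?VK g = ?VK g * ?PK" for g
    unfolding map_mat_to_ac_mult[OF P representation_carrier[OF rV], symmetric]
      map_mat_to_ac_mult[OF representation_carrier[OF rV] P, symmetric] comm ..
  have "degree (char_poly ?PK) = ?n" using degree_monic_char_poly[OF PK] by simp
  then obtain l where "poly (char_poly ?PK) l = 0"
    using alg_closed_imp_poly_has_root[of "char_poly ?PK"] n0 by auto
  then obtain v0 where v0: "v0 \<in> carrier_vec ?n" "v0 \<noteq> 0\<^sub>v ?n" "?PK *\<^sub>v v0 = l \<cdot>\<^sub>v v0"
    using eigenvalue_root_char_poly[OF PK] P by (auto simp: eigenvalue_def eigenvector_def)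
  define U where "U = {v \<in> carrier_vec ?n. ?PK *\<^sub>v v = l \<cdot>\<^sub>v v}"
  have "vec_subspace ?n U"
    unfolding vec_subspace_def
    by (auto simp: U_def mult_mat_vec_zero[OF PK] mult_add_distrib_mat_vec[OF PK] mult_mat_vec_smult[OF PK]
        smult_add_distrib_vec[of _ ?n] smult_smult_assoc mult.commute)
  moreover have "?VK g *\<^sub>v v \<in> U" if "v \<in> U" for g v
  proof -
    have v: "v \<in> carrier_vec ?n" "?PK *\<^sub>v v = l \<cdot>\<^sub>v v" using that by (auto simp: U_def)
    have "?PK *\<^sub>v (?VK g *\<^sub>v v) = ?VK g *\<^sub>v (?PK *\<^sub>v v)"
      unfolding assoc_mult_mat_vec[OF PK VKg v(1), symmetric] assoc_mult_mat_vec[OF VKg PK v(1), symmetric] commK ..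
    also have "\<dots> = l \<cdot>\<^sub>v (?VK g *\<^sub>v v)" unfolding v(2) by (rule mult_mat_vec_smult[OF VKg v(1)])
    finally show ?thesis using mult_mat_vec_carrier[OF VKg v(1), of g] by (simp add: U_def)
  qed
  ultimately have "U = {0\<^sub>v ?n} \<or> U = carrier_vec ?n"
    using irreducible_repD(3)[OF VK, of U] representation_extend_scalars(2)[OF rV] by simp
  then have all: "U = carrier_vec ?n" using v0 by (auto simp: U_def)
  have PK_eq: "?PK = l \<cdot>\<^sub>m 1\<^sub>m ?n"
  proof (rule mat_eqI_mult_vec[OF PK])
    fix v :: "'k alg_closure vec" assume v: "v \<in> carrier_vec ?n"
    then have "?PK *\<^sub>v v = l \<cdot>\<^sub>v v" using all by (auto simp: U_def)
    then show "?PK *\<^sub>v v = (l \<cdot>\<^sub>m 1\<^sub>m ?n) *\<^sub>v v"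
      using smult_one_mult_mat_vec[OF v] by simp
  qed auto
  have entry: "to_ac (P $$ (i, j)) = (if i = j then l else 0)" if "i < ?n" "j < ?n" for i j
    using arg_cong[OF PK_eq, of "\<lambda>A. A $$ (i, j)"] that P by simp
  have l: "l = to_ac (P $$ (0, 0))" using entry[of 0 0] n0 by simp
  show ?thesis
  proof (rule eq_matI)
    fix i j assume "i < dim_row (P $$ (0, 0) \<cdot>\<^sub>m 1\<^sub>m ?n)" "j < dim_col (P $$ (0, 0) \<cdot>\<^sub>m 1\<^sub>m ?n)"
    then have ij: "i < ?n" "j < ?n" by auto
    then show "P $$ (i, j) = (P $$ (0, 0) \<cdot>\<^sub>m 1\<^sub>m ?n) $$ (i, j)"
      using entry[OF ij] by (auto simp: l split: if_splits)
  qed (use P in auto)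
qed

section \<open>Schur orthogonality and central idempotents\<close>

locale twisted_group_algebra =
  fixes \<alpha> :: "'g::{finite, group_add} \<Rightarrow> 'k::field_char_0"
  assumes defined_over: "\<And>V :: 'g \<Rightarrow> 'k alg_closure mat. representation V \<Longrightarrow> defined_over_base V"
    and character: "mult_character \<alpha>"
begin

lemma alpha_nonzero [simp]: "\<alpha> g \<noteq> 0"
  and alpha_add: "\<alpha> (g + h) = \<alpha> g * \<alpha> h"
  using character by (auto simp: mult_character_def)

lemma alpha_0 [simp]: "\<alpha> 0 = 1"
  using alpha_add[of 0 0] by simp

lemma alpha_uminus_mult: "\<alpha> (- g) * \<alpha> g = 1" "\<alpha> g * \<alpha> (- g) = 1"
  using alpha_add[of "- g" g] alpha_add[of g "- g"] by simp_all

text \<open>\<open>T\<close> is the sum over the group of \<open>W g * E * V (- g)\<close> for the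
  matrix unit \<open>E\<close> at position \<open>(j, q)\<close>; the substitution of
  \<open>h + g\<close> for \<open>g\<close> turns \<open>V h\<close> on the right into
  \<open>W h\<close> on the left.\<close>

lemma schur_matrix_intertwines:
  fixes V W :: "'g \<Rightarrow> 'k mat"
  assumes V: "representation V" and W: "representation W" and j: "j < rep_dim W" and q: "q < rep_dim V"
  defines "T \<equiv> mat (rep_dim W) (rep_dim V) (\<lambda>(i, p). \<Sum>g\<in>UNIV. W g $$ (i, j) * V (- g) $$ (q, p))"
  shows "T * V h = W h * T"
proof (rule eq_matI)
  let ?n = "rep_dim V" and ?m = "rep_dim W"
  have T: "T \<in> carrier_mat ?m ?n" by (simp add: T_def)
  show "dim_row (T * V h) = dim_row (W h * T)" "dim_col (T * V h) = dim_col (W h * T)"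
    using V W by (auto simp: T_def)
  fix i p assume "i < dim_row (W h * T)" "p < dim_col (W h * T)"
  then have ip: "i < ?m" "p < ?n" using V W by (auto simp: T_def)
  have "(T * V h) $$ (i, p) = (\<Sum>k<?n. \<Sum>g\<in>UNIV. W g $$ (i, j) * (V (- g) $$ (q, k) * V h $$ (k, p)))"
    unfolding mult_mat_index[OF T representation_carrier[OF V] ip]
    using ip by (simp add: T_def sum_distrib_right mult.assoc)
  also have "\<dots> = (\<Sum>g\<in>UNIV. \<Sum>k<?n. W g $$ (i, j) * (V (- g) $$ (q, k) * V h $$ (k, p)))"
    by (rule sum.swap)
  also have "\<dots> = (\<Sum>g\<in>UNIV. W g $$ (i, j) * V (- g + h) $$ (q, p))"
    using ip q V by (simp add: representation_add_index sum_distrib_left del: add_uminus_conv_diff)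
  also have "\<dots> = (\<Sum>g\<in>UNIV. W (h + g) $$ (i, j) * V (- (h + g) + h) $$ (q, p))"
    by (rule sum_reindex_add_left[symmetric])
  also have "\<dots> = (\<Sum>g\<in>UNIV. (\<Sum>k<?m. W h $$ (i, k) * W g $$ (k, j)) * V (- g) $$ (q, p))"
    using ip j W by (simp add: representation_add_index minus_add add.assoc)
  also have "\<dots> = (\<Sum>g\<in>UNIV. \<Sum>k<?m. W h $$ (i, k) * (W g $$ (k, j) * V (- g) $$ (q, p)))"
    by (simp add: sum_distrib_right mult.assoc)
  also have "\<dots> = (\<Sum>k<?m. \<Sum>g\<in>UNIV. W h $$ (i, k) * (W g $$ (k, j) * V (- g) $$ (q, p)))"
    by (rule sum.swap)
  also have "\<dots> = (W h * T) $$ (i, p)"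
    unfolding mult_mat_index[OF representation_carrier[OF W] T ip]
    using ip by (simp add: T_def sum_distrib_left)
  finally show "(T * V h) $$ (i, p) = (W h * T) $$ (i, p)" .
qed

lemma schur_orthogonality_noniso:
  fixes V W :: "'g \<Rightarrow> 'k mat"
  assumes V: "irreducible_rep V" and W: "irreducible_rep W" and "\<not> rep_iso V W"
    and "i < rep_dim W" "j < rep_dim W" "q < rep_dim V" "p < rep_dim V"
  shows "(\<Sum>g\<in>UNIV. W g $$ (i, j) * V (- g) $$ (q, p)) = 0"
proof -
  let ?T = "mat (rep_dim W) (rep_dim V) (\<lambda>(i, p). \<Sum>g\<in>UNIV. W g $$ (i, j) * V (- g) $$ (q, p))"
  have "?T = 0\<^sub>m (rep_dim W) (rep_dim V)"
    using schur_iso[OF V W, of ?T] assms(3)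
      schur_matrix_intertwines[OF irreducible_repD(1)[OF V] irreducible_repD(1)[OF W] assms(5,6)] by auto
  then have "?T $$ (i, p) = 0\<^sub>m (rep_dim W) (rep_dim V) $$ (i, p)" by simp
  then show ?thesis using assms(4,7) by simp
qed

lemma schur_orthogonality_same:
  fixes V :: "'g \<Rightarrow> 'k mat"
  assumes V: "irreducible_rep V"
    and ij: "i < rep_dim V" "j < rep_dim V" and qp: "q < rep_dim V" "p < rep_dim V"
  shows "(\<Sum>g\<in>UNIV. V g $$ (i, j) * V (- g) $$ (q, p))
    = (if i = p \<and> j = q then of_nat (card (UNIV :: 'g set)) / of_nat (rep_dim V) else 0)"
proof -
  let ?n = "rep_dim V"
  note rV = irreducible_repD(1)[OF V]
  define T where "T = mat ?n ?n (\<lambda>(i, p). \<Sum>g\<in>UNIV. V g $$ (i, j) * V (- g) $$ (q, p))"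
  define c where "c = T $$ (0, 0)"
  have "T = c \<cdot>\<^sub>m 1\<^sub>m ?n"
    unfolding c_def
  proof (rule schur_scalar[OF defined_over V])
    show "T * V g = V g * T" for g
      unfolding T_def by (rule schur_matrix_intertwines[OF rV rV ij(2) qp(1)])
  qed (auto simp: T_def)
  then have entry: "T $$ (i', p') = (if i' = p' then c else 0)" if "i' < ?n" "p' < ?n" for i' p'
    using that by simp
  \<comment> \<open>The scalar by which \<open>T\<close> acts is found from its trace, in which
    \<open>V (- g)\<close> meets \<open>V g\<close> and cancels it, leaving one identity matrix for
    each group element.\<close>
  have "of_nat ?n * c = (\<Sum>i'<?n. T $$ (i', i'))" by (simp add: entry)
  also have "\<dots> = (\<Sum>i'<?n. \<Sum>g\<in>UNIV. V (- g) $$ (q, i') * V g $$ (i', j))"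
    by (simp add: T_def mult.commute)
  also have "\<dots> = (\<Sum>g\<in>UNIV. V (- g + g) $$ (q, j))"
    using qp ij by (subst sum.swap) (simp only: representation_add_index[OF rV])
  also have "\<dots> = (if j = q then of_nat (card (UNIV :: 'g set)) else 0)"
    using qp ij by (simp add: representation_0[OF rV])
  finally have "c = (if j = q then of_nat (card (UNIV :: 'g set)) / of_nat ?n else 0)"
    using irreducible_repD(2)[OF V] by (simp add: field_simps split: if_splits)
  moreover have "(\<Sum>g\<in>UNIV. V g $$ (i, j) * V (- g) $$ (q, p)) = T $$ (i, p)"
    using ij qp by (simp add: T_def)
  ultimately show ?thesis using entry ij qp by simp
qed

text \<open>Fourier inversion: the coefficient at \<open>g\<close> is the trace of
  \<open>y * V (- g)\<close>, scaled by dimension over group order. For irreducible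
  \<open>V\<close>, Schur orthogonality makes the element act as \<open>y\<close> on
  \<open>V\<close> and as 0 on the irreducible representations not isomorphic to
  \<open>V\<close>.\<close>

definition block_elem :: "('g \<Rightarrow> 'k mat) \<Rightarrow> 'k mat \<Rightarrow> ('g, 'k) group_algebra" where
  "block_elem V y = Abs_poly_mapping (\<lambda>g. of_nat (rep_dim V) / of_nat (card (UNIV :: 'g set)) *
     (\<Sum>p<rep_dim V. \<Sum>q<rep_dim V. y $$ (p, q) * V (- g) $$ (q, p)))"

lemma rep_extend_block_elem_index:
  assumes "i < rep_dim W" "j < rep_dim W"
  shows "rep_extend W (block_elem V y) $$ (i, j) = of_nat (rep_dim V) / of_nat (card (UNIV :: 'g set)) *
     (\<Sum>p<rep_dim V. \<Sum>q<rep_dim V. y $$ (p, q) * (\<Sum>g\<in>UNIV. W g $$ (i, j) * V (- g) $$ (q, p)))"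
proof -
  let ?c = "of_nat (rep_dim V) / of_nat (card (UNIV :: 'g set))" and ?n = "rep_dim V"
  have "rep_extend W (block_elem V y) $$ (i, j)
    = (\<Sum>g\<in>UNIV. ?c * (\<Sum>p<?n. \<Sum>q<?n. y $$ (p, q) * V (- g) $$ (q, p)) * W g $$ (i, j))"
    using assms by (simp add: rep_extend_index block_elem_def)
  also have "\<dots> = ?c * (\<Sum>g\<in>UNIV. \<Sum>p<?n. \<Sum>q<?n. y $$ (p, q) * (W g $$ (i, j) * V (- g) $$ (q, p)))"
    by (simp add: sum_distrib_left sum_distrib_right mult_ac)
  also have "(\<Sum>g\<in>UNIV. \<Sum>p<?n. \<Sum>q<?n. y $$ (p, q) * (W g $$ (i, j) * V (- g) $$ (q, p)))
    = (\<Sum>p<?n. \<Sum>g\<in>UNIV. \<Sum>q<?n. y $$ (p, q) * (W g $$ (i, j) * V (- g) $$ (q, p)))"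
    by (rule sum.swap)
  also have "\<dots> = (\<Sum>p<?n. \<Sum>q<?n. \<Sum>g\<in>UNIV. y $$ (p, q) * (W g $$ (i, j) * V (- g) $$ (q, p)))"
    by (rule sum.cong[OF refl], rule sum.swap)
  finally show ?thesis by (simp only: sum_distrib_left)
qed

lemma rep_extend_block_elem:
  assumes V: "irreducible_rep V" and y: "y \<in> carrier_mat (rep_dim V) (rep_dim V)"
  shows "rep_extend V (block_elem V y) = y"
proof (rule eq_matI)
  let ?n = "rep_dim V"
  fix i j assume "i < dim_row y" "j < dim_col y"
  then have ij: "i < ?n" "j < ?n" using y by auto
  define C :: 'k where "C = of_nat (card (UNIV :: 'g set)) / of_nat ?n"
  have C: "of_nat ?n / of_nat (card (UNIV :: 'g set)) * C = 1"
    using irreducible_repD(2)[OF V] by (simp add: C_def)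
  have "rep_extend V (block_elem V y) $$ (i, j) = of_nat ?n / of_nat (card (UNIV :: 'g set)) *
    (\<Sum>p<?n. \<Sum>q<?n. y $$ (p, q) * (if i = p \<and> j = q then C else 0))"
    unfolding rep_extend_block_elem_index[OF ij] C_def
    using schur_orthogonality_same[OF V ij] by simp
  also have "(\<Sum>p<?n. \<Sum>q<?n. y $$ (p, q) * (if i = p \<and> j = q then C else 0))
    = (\<Sum>p<?n. if i = p then (\<Sum>q<?n. if j = q then y $$ (p, q) * C else 0) else 0)"
  proof (rule sum.cong[OF refl])
    fix p
    show "(\<Sum>q<?n. y $$ (p, q) * (if i = p \<and> j = q then C else 0))
      = (if i = p then (\<Sum>q<?n. if j = q then y $$ (p, q) * C else 0) else 0)"
    proof (cases "i = p")
      case True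
      show ?thesis
        unfolding if_P[OF True] by (rule sum.cong[OF refl]) (simp add: True)
    qed simp
  qed
  also have "\<dots> = y $$ (i, j) * C"
    using ij by (simp only: sum.delta' finite_lessThan lessThan_iff if_True)
  also have "of_nat ?n / of_nat (card (UNIV :: 'g set)) * (y $$ (i, j) * C) = y $$ (i, j)"
    using C by (metis mult.left_commute mult.right_neutral)
  finally show "rep_extend V (block_elem V y) $$ (i, j) = y $$ (i, j)" .
qed (use y in auto)

lemma rep_extend_block_elem_noniso:
  assumes "irreducible_rep V" "irreducible_rep W" "\<not> rep_iso V W"
  shows "rep_extend W (block_elem V y) = 0\<^sub>m (rep_dim W) (rep_dim W)"
proof (rule eq_matI)
  fix i j assume "i < dim_row (0\<^sub>m (rep_dim W) (rep_dim W) :: 'k mat)" "j < dim_col (0\<^sub>m (rep_dim W) (rep_dim W) :: 'k mat)"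
  then have ij: "i < rep_dim W" "j < rep_dim W" by auto
  show "rep_extend W (block_elem V y) $$ (i, j) = 0\<^sub>m (rep_dim W) (rep_dim W) $$ (i, j)"
    unfolding rep_extend_block_elem_index[OF ij]
    using schur_orthogonality_noniso[OF assms ij] ij by simp
qed auto

definition block_idem :: "('g \<Rightarrow> 'k mat) \<Rightarrow> ('g, 'k) group_algebra" where
  "block_idem V = block_elem V (1\<^sub>m (rep_dim V))"

lemma rep_extend_block_idem:
  assumes V: "irreducible_rep V" and W: "irreducible_rep W"
  shows "rep_extend W (block_idem V) = (if rep_iso V W then 1\<^sub>m (rep_dim W) else 0\<^sub>m (rep_dim W) (rep_dim W))"
proof (cases "rep_iso V W")
  case True
  then obtain P Q where d: "rep_dim V = rep_dim W" and P: "P \<in> carrier_mat (rep_dim V) (rep_dim V)"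
    and Q: "Q \<in> carrier_mat (rep_dim V) (rep_dim V)" and PQ: "P * Q = 1\<^sub>m (rep_dim V)"
    and iso: "\<And>g. P * V g = W g * P" by (rule rep_isoE) blast
  let ?n = "rep_dim V" and ?We = "rep_extend W (block_idem V)"
  have We: "?We \<in> carrier_mat ?n ?n" using rep_extend_carrier[of W "block_idem V"] d by simp
  have "P * rep_extend V (block_idem V) = ?We * P"
    using P d irreducible_repD(1)[OF V] irreducible_repD(1)[OF W] iso by (intro rep_extend_intertwine) auto
  then have "?We * P = P" using P rep_extend_block_elem[OF V] by (simp add: block_idem_def)
  then have "?We * P * Q = P * Q" by simp
  then have "?We = 1\<^sub>m ?n" using PQ We right_mult_one_mat[OF We] by (simp add: assoc_mult_mat[OF We P Q])
  then show ?thesis using True d by simp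
next
  case False
  then show ?thesis using rep_extend_block_elem_noniso[OF V W] by (simp add: block_idem_def)
qed

lemma rep_iso_irreducible_sym:
  "irreducible_rep V \<Longrightarrow> irreducible_rep W \<Longrightarrow> rep_iso V W \<longleftrightarrow> rep_iso W V"
  using rep_iso_sym irreducible_repD(1) by blast

lemma rep_iso_irreducible_trans:
  "rep_iso U V \<Longrightarrow> rep_iso V W \<Longrightarrow> irreducible_rep U \<Longrightarrow> irreducible_rep V \<Longrightarrow> irreducible_rep W \<Longrightarrow> rep_iso U W"
  using rep_iso_trans irreducible_repD(1) by blast

lemma block_idem_eq_iff:
  assumes V: "irreducible_rep V" and W: "irreducible_rep W"
  shows "block_idem V = block_idem W \<longleftrightarrow> rep_iso V W"
proof
  assume iso: "rep_iso V W"
  show "block_idem V = block_idem W"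
  proof (rule ga_eqI)
    fix U :: "'g \<Rightarrow> 'k mat" assume U: "irreducible_rep U"
    have "rep_iso V U \<longleftrightarrow> rep_iso W U"
      using rep_iso_irreducible_trans[of V W U] rep_iso_irreducible_trans[of W V U] iso V W U
        rep_iso_irreducible_sym[OF V W] by blast
    then show "rep_extend U (block_idem V) = rep_extend U (block_idem W)"
      by (simp add: rep_extend_block_idem V W U)
  qed
next
  assume eq: "block_idem V = block_idem W"
  have "rep_iso W W" using W by (intro rep_iso_refl irreducible_repD(1))
  then have "rep_extend W (block_idem V) = 1\<^sub>m (rep_dim W)"
    by (simp add: eq rep_extend_block_idem W)
  moreover have "1\<^sub>m (rep_dim W) \<noteq> (0\<^sub>m (rep_dim W) (rep_dim W) :: 'k mat)"
    using irreducible_repD(2)[OF W]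
    by (metis index_one_mat(1) index_zero_mat(1) neq0_conv zero_neq_one)
  ultimately show "rep_iso V W"
    using rep_extend_block_idem[OF V W] by (auto split: if_splits)
qed

lemma block_idem_mult:
  assumes V: "irreducible_rep V" and W: "irreducible_rep W"
  shows "block_idem V * block_idem W = (if block_idem V = block_idem W then block_idem V else 0)"
proof (rule ga_eqI)
  fix U :: "'g \<Rightarrow> 'k mat" assume U: "irreducible_rep U"
  have "rep_iso V W" if "rep_iso V U" "rep_iso W U"
    using that rep_iso_irreducible_trans[of V U W] rep_iso_irreducible_sym V W U by blast
  moreover have "rep_iso V U \<longleftrightarrow> rep_iso W U" if "rep_iso V W"
    using rep_iso_irreducible_trans[of V W U] rep_iso_irreducible_trans[of W V U] that V W U
        rep_iso_irreducible_sym[OF V W] by blast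
  ultimately show "rep_extend U (block_idem V * block_idem W) =
      rep_extend U (if block_idem V = block_idem W then block_idem V else 0)"
    by (auto simp: rep_extend_mult irreducible_repD(1)[OF U] rep_extend_block_idem V W U block_idem_eq_iff)
qed

lemma block_idem_central:
  assumes V: "irreducible_rep V"
  shows "block_idem V * a = a * block_idem V"
proof (rule ga_eqI)
  fix U :: "'g \<Rightarrow> 'k mat" assume U: "irreducible_rep U"
  show "rep_extend U (block_idem V * a) = rep_extend U (a * block_idem V)"
    using left_mult_one_mat[OF rep_extend_carrier[of U a]] right_mult_one_mat[OF rep_extend_carrier[of U a]]
      left_mult_zero_mat[OF rep_extend_carrier[of U a]] right_mult_zero_mat[OF rep_extend_carrier[of U a]]
    by (simp add: rep_extend_mult irreducible_repD(1)[OF U] rep_extend_block_idem V U)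
qed

text \<open>Two irreducible representations have equal idempotents exactly if they are isomorphic,
  so this set stands for the set of isomorphism classes, and sums over it require no choice of
  representatives.\<close>

definition block_idems :: "('g, 'k) group_algebra set" where
  "block_idems = block_idem ` {V. irreducible_rep V}"

lemma block_idem_nonzero: "irreducible_rep V \<Longrightarrow> block_idem V \<noteq> 0"
proof
  assume V: "irreducible_rep V" and 0: "block_idem V = 0"
  have "rep_iso V V" using V by (intro rep_iso_refl irreducible_repD(1))
  then have "1\<^sub>m (rep_dim V) = (0\<^sub>m (rep_dim V) (rep_dim V) :: 'k mat)"
    using rep_extend_block_idem[OF V V] by (simp add: 0)
  then show False
    using irreducible_repD(2)[OF V] by (metis index_one_mat(1) index_zero_mat(1) neq0_conv zero_neq_one)
qed

text \<open>Multiplying a relation by one of the orthogonal idempotents isolates its coefficient.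
  The aim is finiteness: a finite-dimensional group algebra has only finitely many blocks.\<close>

lemma block_idems_independent: "ga.independent block_idems"
  unfolding ga.independent_explicit_finite_subsets
proof (intro allI impI ballI)
  fix S :: "('g, 'k) group_algebra set" and u v
  assume S: "S \<subseteq> block_idems" "finite S" and 0: "(\<Sum>e\<in>S. ga_scale (u e) e) = 0" and v: "v \<in> S"
  have ev: "e * v = (if e = v then v else 0)" if e: "e \<in> S" for e
  proof -
    obtain V W where "irreducible_rep V" "irreducible_rep W" "e = block_idem V" "v = block_idem W"
      using subsetD[OF S(1) v] subsetD[OF S(1) e] unfolding block_idems_def by blast
    then show ?thesis using block_idem_mult[of V W] by simp
  qed
  have "0 = (\<Sum>e\<in>S. ga_scale (u e) e) * v" by (simp add: 0)
  also have "\<dots> = (\<Sum>e\<in>S. if e = v then ga_scale (u v) v else 0)"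
    unfolding sum_distrib_right by (intro sum.cong refl) (auto simp: ga_scale_times_left ev)
  also have "\<dots> = ga_scale (u v) v" using S(2) v by simp
  finally show "u v = 0"
    using block_idem_nonzero v S(1) by (auto simp: block_idems_def)
qed

lemma finite_block_idems: "finite block_idems"
  using ga.independent_bound_general[OF block_idems_independent] by simp

lemma sum_block_idems: "\<Sum>block_idems = 1"
proof (rule ga_eqI)
  fix U :: "'g \<Rightarrow> 'k mat" assume U: "irreducible_rep U"
  have UU: "rep_iso U U" using U by (intro rep_iso_refl irreducible_repD(1))
  have sum: "rep_extend U (\<Sum>E) $$ (i, j) = (\<Sum>e\<in>E. rep_extend U e $$ (i, j))"
    if "i < rep_dim U" "j < rep_dim U" for E i j
    using rep_extend_sum_index[OF that, of "\<lambda>_. 1" "\<lambda>e. e" E] by simp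
  have e: "rep_extend U e = (if e = block_idem U then 1\<^sub>m (rep_dim U) else 0\<^sub>m (rep_dim U) (rep_dim U))"
    if e: "e \<in> block_idems" for e
  proof -
    obtain V where V: "irreducible_rep V" "e = block_idem V"
      using e by (auto simp: block_idems_def)
    show ?thesis unfolding V(2) rep_extend_block_idem[OF V(1) U] block_idem_eq_iff[OF V(1) U] ..
  qed
  have "rep_extend U (\<Sum>block_idems) = 1\<^sub>m (rep_dim U)"
  proof (rule eq_matI)
    fix i j assume "i < dim_row (1\<^sub>m (rep_dim U) :: 'k mat)" "j < dim_col (1\<^sub>m (rep_dim U) :: 'k mat)"
    then have ij: "i < rep_dim U" "j < rep_dim U" by auto
    have "rep_extend U (\<Sum>block_idems) $$ (i, j)
      = (\<Sum>e\<in>block_idems. if e = block_idem U then 1\<^sub>m (rep_dim U) $$ (i, j) else 0)"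
      unfolding sum[OF ij] using ij by (intro sum.cong refl) (simp add: e)
    also have "\<dots> = 1\<^sub>m (rep_dim U) $$ (i, j)"
      using finite_block_idems U by (simp add: block_idems_def)
    finally show "rep_extend U (\<Sum>block_idems) $$ (i, j) = 1\<^sub>m (rep_dim U) $$ (i, j)" .
  qed auto
  then show "rep_extend U (\<Sum>block_idems) = rep_extend U 1"
    by (simp add: rep_extend_one irreducible_repD(1)[OF U])
qed

end

section \<open>The twisted inversion\<close>

lemma mat_bilinear_eq:
  fixes A B :: "'a::field mat"
  assumes A: "A \<in> carrier_mat n n" and B: "B \<in> carrier_mat n n"
    and eq: "\<And>v w. v \<in> carrier_vec n \<Longrightarrow> w \<in> carrier_vec n \<Longrightarrow> v \<bullet> (A *\<^sub>v w) = v \<bullet> (B *\<^sub>v w)"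
  shows "A = B"
proof (rule eq_matI)
  fix i j assume "i < dim_row B" "j < dim_col B"
  then have ij: "i < n" "j < n" using B by auto
  have "unit_vec n i \<bullet> (M *\<^sub>v unit_vec n j) = M $$ (i, j)" if M: "M \<in> carrier_mat n n" for M :: "'a mat"
    using M ij mult_mat_unit_vec_index[OF M ij] by (subst scalar_prod_left_unit) auto
  then show "A $$ (i, j) = B $$ (i, j)" using eq[of "unit_vec n i" "unit_vec n j"] A B by simp
qed (use A B in auto)

lemma mat_bilinear_zero:
  fixes A :: "'a::field mat"
  assumes A: "A \<in> carrier_mat n n"
    and 0: "\<And>v w. v \<in> carrier_vec n \<Longrightarrow> w \<in> carrier_vec n \<Longrightarrow> v \<bullet> (A *\<^sub>v w) = 0"
  shows "A = 0\<^sub>m n n"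
  by (rule mat_bilinear_eq[OF A]) (simp_all add: 0 zero_mult_mat_vec)

lemma scalar_prod_transpose:
  fixes A :: "'a::field mat"
  assumes "A \<in> carrier_mat n n" "v \<in> carrier_vec n" "w \<in> carrier_vec n"
  shows "(A *\<^sub>v v) \<bullet> w = v \<bullet> (transpose_mat A *\<^sub>v w)"
  using transpose_vec_mult_scalar[of "transpose_mat A" n n w v] assms by simp

lemma osp_form_iff:
  fixes B :: "'a::field mat"
  assumes B: "B \<in> carrier_mat n n"
  shows "x \<in> osp_form n B \<longleftrightarrow> x \<in> carrier_mat n n \<and> transpose_mat x * B + B * x = 0\<^sub>m n n"
proof (cases "x \<in> carrier_mat n n")
  case x: True
  have xt: "transpose_mat x \<in> carrier_mat n n" using x by simp
  let ?A = "transpose_mat x * B + B * x"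
  have A: "?A \<in> carrier_mat n n" using x B by auto
  have eq: "(x *\<^sub>v v) \<bullet> (B *\<^sub>v w) + v \<bullet> (B *\<^sub>v (x *\<^sub>v w)) = v \<bullet> (?A *\<^sub>v w)"
    if v: "v \<in> carrier_vec n" and w: "w \<in> carrier_vec n" for v w
  proof -
    have "?A *\<^sub>v w = transpose_mat x *\<^sub>v (B *\<^sub>v w) + B *\<^sub>v (x *\<^sub>v w)"
      using add_mult_distrib_mat_vec[of "transpose_mat x * B" n n "B * x" w] x xt B w
        assoc_mult_mat_vec[OF xt B w] assoc_mult_mat_vec[OF B x w] by simp
    moreover have "v \<bullet> (transpose_mat x *\<^sub>v (B *\<^sub>v w) + B *\<^sub>v (x *\<^sub>v w))
      = v \<bullet> (transpose_mat x *\<^sub>v (B *\<^sub>v w)) + v \<bullet> (B *\<^sub>v (x *\<^sub>v w))"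
      using x xt B v w by (intro scalar_prod_add_distrib[of _ n]) auto
    moreover have "(x *\<^sub>v v) \<bullet> (B *\<^sub>v w) = v \<bullet> (transpose_mat x *\<^sub>v (B *\<^sub>v w))"
      using B v w by (intro scalar_prod_transpose[OF x]) auto
    ultimately show ?thesis by simp
  qed
  have "x \<in> osp_form n B \<longleftrightarrow> (\<forall>v\<in>carrier_vec n. \<forall>w\<in>carrier_vec n. v \<bullet> (?A *\<^sub>v w) = 0)"
    using x eq by (simp add: osp_form_def)
  also have "\<dots> \<longleftrightarrow> ?A = 0\<^sub>m n n"
    using mat_bilinear_zero[OF A] by (auto simp: zero_mult_mat_vec)
  finally show ?thesis using x by simp
next
  case False
  then show ?thesis by (simp add: osp_form_def)
qed

lemma mat_add_eq_zero_iff: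
  fixes A B :: "'a::field mat"
  assumes "A \<in> carrier_mat n m" "B \<in> carrier_mat n m"
  shows "A + B = 0\<^sub>m n m \<longleftrightarrow> B = - A"
proof
  assume 0: "A + B = 0\<^sub>m n m"
  show "B = - A"
  proof (rule eq_matI)
    fix i j assume "i < dim_row (- A)" "j < dim_col (- A)"
    then show "B $$ (i, j) = (- A) $$ (i, j)"
      using arg_cong[OF 0, of "\<lambda>M. M $$ (i, j)"] assms by (auto simp: eq_neg_iff_add_eq_0 add.commute)
  qed (use assms in auto)
qed (use assms in \<open>auto intro!: eq_matI\<close>)

lemma mult_right_cancel_invertible:
  fixes A :: "'a::field mat"
  assumes A: "A \<in> carrier_mat n n" and B: "B \<in> carrier_mat n n" and inv: "invertible_mat B"
    and 0: "A * B = 0\<^sub>m n n"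
  shows "A = 0\<^sub>m n n"
proof -
  obtain Q where Q: "Q \<in> carrier_mat n n" "B * Q = 1\<^sub>m n" using inv B by (rule invertible_matE)
  have "A = A * (B * Q)" using A Q by simp
  also have "\<dots> = A * B * Q" using assoc_mult_mat[OF A B Q(1)] by simp
  finally show ?thesis using 0 Q by simp
qed

context twisted_group_algebra
begin

text \<open>The map called \<sigma> above, described by coefficients: the coefficient at
  \<open>g\<close> comes from the basis element of \<open>- g\<close>, which is sent to
  \<open>\<alpha> (- g)\<close> times that of \<open>g\<close>.\<close>

definition twisted_inv :: "('g, 'k) group_algebra \<Rightarrow> ('g, 'k) group_algebra" where
  "twisted_inv a = Abs_poly_mapping (\<lambda>g. \<alpha> (- g) * Poly_Mapping.lookup a (- g))"

lemma lookup_twisted_inv [simp]: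
  "Poly_Mapping.lookup (twisted_inv a) g = \<alpha> (- g) * Poly_Mapping.lookup a (- g)"
  by (simp add: twisted_inv_def)

lemma twisted_inv_add: "twisted_inv (a + b) = twisted_inv a + twisted_inv b"
  by (rule poly_mapping_eqI) (simp add: lookup_add distrib_left)

lemma twisted_inv_minus: "twisted_inv (a - b) = twisted_inv a - twisted_inv b"
  by (rule poly_mapping_eqI) (simp add: lookup_minus right_diff_distrib)

lemma twisted_inv_scale: "twisted_inv (ga_scale c a) = ga_scale c (twisted_inv a)"
  by (rule poly_mapping_eqI) (simp add: mult.left_commute)

lemma twisted_inv_0 [simp]: "twisted_inv 0 = 0"
  by (rule poly_mapping_eqI) simp

lemma twisted_inv_sum: "twisted_inv (sum f A) = (\<Sum>i\<in>A. twisted_inv (f i))"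
  by (induction A rule: infinite_finite_induct) (auto simp: twisted_inv_add)

lemma twisted_inv_twisted_inv [simp]: "twisted_inv (twisted_inv a) = a"
  by (rule poly_mapping_eqI) (simp add: mult.assoc[symmetric] alpha_uminus_mult)

lemma twisted_inv_basis: "twisted_inv (basis_elem g) = ga_scale (\<alpha> g) (basis_elem (- g))"
  by (rule poly_mapping_eqI) (auto simp: lookup_basis_elem)

lemma twisted_inv_1 [simp]: "twisted_inv 1 = 1"
  using twisted_inv_basis[of 0] by (simp add: basis_elem_0)

lemma twisted_inv_mult: "twisted_inv (a * b) = twisted_inv b * twisted_inv a"
proof (rule poly_mapping_eqI)
  fix h
  let ?l = Poly_Mapping.lookup
  have "?l (twisted_inv b * twisted_inv a) h
    = (\<Sum>g\<in>UNIV. \<alpha> (- g) * ?l b (- g) * (\<alpha> (- (- g + h)) * ?l a (- (- g + h))))"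
    by (simp add: lookup_times_group)
  also have "\<dots> = (\<Sum>g\<in>UNIV. \<alpha> (- (h + g)) * ?l b (- (h + g)) * (\<alpha> (- (- (h + g) + h)) * ?l a (- (- (h + g) + h))))"
    by (rule sum_reindex_add_left[symmetric])
  also have "\<dots> = (\<Sum>g\<in>UNIV. \<alpha> (- h) * (?l a g * ?l b (- g + - h)))"
  proof (rule sum.cong[OF refl])
    fix g
    have g: "- (- (h + g) + h) = g" by (simp add: minus_add add.assoc)
    have "\<alpha> (- (h + g)) * \<alpha> g = \<alpha> (- h)"
      by (simp only: minus_add alpha_add) (metis alpha_uminus_mult(2) mult.assoc mult.commute mult.right_neutral)
    then show "\<alpha> (- (h + g)) * ?l b (- (h + g)) * (\<alpha> (- (- (h + g) + h)) * ?l a (- (- (h + g) + h)))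
        = \<alpha> (- h) * (?l a g * ?l b (- g + - h))"
      unfolding g by (metis (no_types, lifting) minus_add mult.assoc mult.commute)
  qed
  also have "\<dots> = ?l (twisted_inv (a * b)) h"
    by (simp add: lookup_times_group sum_distrib_left)
  finally show "?l (twisted_inv (a * b)) h = ?l (twisted_inv b * twisted_inv a) h" ..
qed

text \<open>The spanning elements are \<open>x - twisted_inv x\<close> for basis elements
  \<open>x\<close>, and the map is an involution. Conversely, \<open>twisted_inv a = - a\<close>
  gives \<open>a + a = a - twisted_inv a\<close>, which expands in the spanning elements, and 2 is
  invertible.\<close>

lemma L_alg_iff: "a \<in> L_alg \<alpha> \<longleftrightarrow> a + twisted_inv a = 0"
proof
  assume "a \<in> L_alg \<alpha>"
  then show "a + twisted_inv a = 0"
    unfolding L_alg_def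
  proof (induction rule: ga.span_induct)
    case base
    show ?case
      unfolding ga.subspace_def
    proof (intro conjI ballI allI)
      fix x y assume "x \<in> {a. a + twisted_inv a = 0}" "y \<in> {a. a + twisted_inv a = 0}"
      then have "twisted_inv x = - x" "twisted_inv y = - y"
        by (simp_all add: eq_neg_iff_add_eq_0 add.commute)
      then show "x + y \<in> {a. a + twisted_inv a = 0}" by (simp add: twisted_inv_add)
    next
      fix c x assume "x \<in> {a. a + twisted_inv a = 0}"
      then have "ga_scale c (x + twisted_inv x) = 0" by simp
      then show "ga_scale c x \<in> {a. a + twisted_inv a = 0}"
        unfolding mem_Collect_eq twisted_inv_scale ga.scale_right_distrib .
    qed simp
  next
    case (step x)
    then obtain g where x: "x = basis_elem g - ga_scale (\<alpha> g) (basis_elem (- g))" by blast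
    then have "x = basis_elem g - twisted_inv (basis_elem g)" by (simp add: twisted_inv_basis)
    then show ?case by (simp add: twisted_inv_minus)
  qed
next
  assume a: "a + twisted_inv a = 0"
  have "twisted_inv a = - a" using a by (simp add: eq_neg_iff_add_eq_0 add.commute)
  then have "a + a = a - twisted_inv a" by simp
  also have "\<dots> = (\<Sum>g\<in>UNIV. ga_scale (Poly_Mapping.lookup a g) (basis_elem g))
      - twisted_inv (\<Sum>g\<in>UNIV. ga_scale (Poly_Mapping.lookup a g) (basis_elem g))"
    by (simp only: ga_expansion[of a, symmetric])
  also have "\<dots> = (\<Sum>g\<in>UNIV. ga_scale (Poly_Mapping.lookup a g) (basis_elem g - ga_scale (\<alpha> g) (basis_elem (- g))))"
    by (simp only: twisted_inv_sum twisted_inv_scale twisted_inv_basis sum_subtractf[symmetric] ga.scale_right_diff_distrib)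
  also have "\<dots> \<in> L_alg \<alpha>"
    unfolding L_alg_def by (intro ga.span_sum ga.span_scale ga.span_base) blast
  finally have "a + a \<in> L_alg \<alpha>" .
  then have "ga_scale (1 / 2) (a + a) \<in> L_alg \<alpha>"
    unfolding L_alg_def by (rule ga.span_scale)
  moreover have "ga_scale (1 / 2) (a + a) = a"
    by (rule poly_mapping_eqI) (simp add: lookup_add)
  ultimately show "a \<in> L_alg \<alpha>" by simp
qed

lemma L_alg_iff': "a \<in> L_alg \<alpha> \<longleftrightarrow> twisted_inv a = - a"
  by (simp add: L_alg_iff eq_neg_iff_add_eq_0 add.commute)

lemma subspace_L_alg: "ga.subspace (L_alg \<alpha>)"
  unfolding L_alg_def by (rule ga.subspace_span)

text \<open>Antisymmetrization under \<sigma>. Applied to elements with a prescribed action on one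
  block, it provides the test elements against which central elements are commuted.\<close>

lemma L_alg_commutator: "a - twisted_inv a \<in> L_alg \<alpha>"
  by (simp add: L_alg_iff twisted_inv_minus)

text \<open>For \<open>a\<close> and \<open>b\<close> in the eigenspace, the anti-automorphism sends
  \<open>a * b - b * a\<close> to \<open>b * a - a * b\<close>, the two signs cancelling in each
  product.\<close>

lemma lie_subalgebra_L_alg: "lie_subalgebra (L_alg \<alpha>)"
  unfolding lie_subalgebra_def
proof (intro conjI ballI)
  fix a b assume "a \<in> L_alg \<alpha>" "b \<in> L_alg \<alpha>"
  then show "lie_bracket a b \<in> L_alg \<alpha>"
    by (simp add: L_alg_iff' lie_bracket_def twisted_inv_minus twisted_inv_mult)
qed (rule subspace_L_alg)

section \<open>The twisted dual and its blocks\<close>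

lemma rep_dim_twisted_dual [simp]:
  assumes "representation V"
  shows "rep_dim (twisted_dual \<alpha> V) = rep_dim V"
proof -
  have "rep_dim (twisted_dual \<alpha> V) = dim_row (twisted_dual \<alpha> V 0)" by (rule rep_dim_def)
  also have "\<dots> = dim_col (V (- 0))" by (simp add: twisted_dual_def)
  finally show ?thesis using assms by (simp only: representation_dims)
qed

lemma twisted_dual_index:
  "representation V \<Longrightarrow> i < rep_dim V \<Longrightarrow> j < rep_dim V \<Longrightarrow>
    twisted_dual \<alpha> V g $$ (i, j) = \<alpha> g * V (- g) $$ (j, i)"
  by (simp add: twisted_dual_def)

lemma twisted_dual_carrier: "representation V \<Longrightarrow> twisted_dual \<alpha> V g \<in> carrier_mat (rep_dim V) (rep_dim V)"
  unfolding twisted_dual_def using representation_carrier[of V "- g"] by simp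

lemma representation_twisted_dual:
  assumes V: "representation V"
  shows "representation (twisted_dual \<alpha> V)"
  unfolding representation_def rep_dim_twisted_dual[OF V]
proof (intro conjI allI)
  let ?n = "rep_dim V"
  show "twisted_dual \<alpha> V g \<in> carrier_mat ?n ?n" for g by (rule twisted_dual_carrier[OF V])
  show "twisted_dual \<alpha> V 0 = 1\<^sub>m ?n"
    using V by (auto simp: twisted_dual_def representation_0 intro!: eq_matI)
  fix g h
  show "twisted_dual \<alpha> V (g + h) = twisted_dual \<alpha> V g * twisted_dual \<alpha> V h"
  proof (rule eq_matI)
    fix i j assume "i < dim_row (twisted_dual \<alpha> V g * twisted_dual \<alpha> V h)"
      "j < dim_col (twisted_dual \<alpha> V g * twisted_dual \<alpha> V h)"
    then have ij: "i < ?n" "j < ?n" using V by (auto simp: twisted_dual_def)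
    show "twisted_dual \<alpha> V (g + h) $$ (i, j) = (twisted_dual \<alpha> V g * twisted_dual \<alpha> V h) $$ (i, j)"
      unfolding mult_mat_index[OF twisted_dual_carrier[OF V] twisted_dual_carrier[OF V] ij]
      using ij V by (simp add: twisted_dual_index minus_add representation_add_index alpha_add sum_distrib_left mult_ac
          del: add_uminus_conv_diff)
  qed (use V in \<open>auto simp: twisted_dual_def\<close>)
qed

lemma twisted_dual_twisted_dual: 
  assumes V: "representation V"
  shows "twisted_dual \<alpha> (twisted_dual \<alpha> V) = V"
proof
  fix g
  show "twisted_dual \<alpha> (twisted_dual \<alpha> V) g = V g"
    using V by (intro eq_matI)
      (auto simp: twisted_dual_def mult.assoc[symmetric] alpha_uminus_mult)
qed

text \<open>Substituting \<open>- g\<close> for \<open>g\<close> in the sum over the group turns the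
  coefficient \<open>\<alpha> (- g)\<close> into the character twist of the dual. The action of
  \<sigma> on blocks is computed through this formula.\<close>

lemma rep_extend_twisted_inv:
  assumes V: "representation V"
  shows "rep_extend V (twisted_inv a) = transpose_mat (rep_extend (twisted_dual \<alpha> V) a)"
proof (rule eq_matI)
  fix i j assume "i < dim_row (transpose_mat (rep_extend (twisted_dual \<alpha> V) a))"
    "j < dim_col (transpose_mat (rep_extend (twisted_dual \<alpha> V) a))"
  then have ij: "i < rep_dim V" "j < rep_dim V" using V by auto
  have "rep_extend V (twisted_inv a) $$ (i, j)
    = (\<Sum>g\<in>UNIV. \<alpha> (- g) * Poly_Mapping.lookup a (- g) * V (- (- g)) $$ (i, j))"
    using ij by (simp add: rep_extend_index)
  also have "\<dots> = (\<Sum>g\<in>UNIV. \<alpha> g * Poly_Mapping.lookup a g * V (- g) $$ (i, j))"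
    by (rule sum_reindex_uminus)
  also have "\<dots> = transpose_mat (rep_extend (twisted_dual \<alpha> V) a) $$ (i, j)"
    using ij V by (simp add: rep_extend_index twisted_dual_index mult_ac)
  finally show "rep_extend V (twisted_inv a) $$ (i, j) = transpose_mat (rep_extend (twisted_dual \<alpha> V) a) $$ (i, j)" .
qed (use V in auto)

lemma irreducible_of_full:
  fixes V :: "'g \<Rightarrow> 'k mat"
  assumes V: "representation V" "rep_dim V \<noteq> 0"
    and full: "\<And>y. y \<in> carrier_mat (rep_dim V) (rep_dim V) \<Longrightarrow> \<exists>a. rep_extend V a = y"
  shows "irreducible_rep V"
proof -
  let ?n = "rep_dim V"
  have "U = {0\<^sub>v ?n} \<or> U = carrier_vec ?n"
    if U: "vec_subspace ?n U" and inv: "\<And>g w. w \<in> U \<Longrightarrow> V g *\<^sub>v w \<in> U" for U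
  proof (cases "U \<subseteq> {0\<^sub>v ?n}")
    case True
    then show ?thesis using U by (auto simp: vec_subspace_def)
  next
    case False
    then obtain w where w: "w \<in> U" "w \<noteq> 0\<^sub>v ?n" by blast
    have Uc: "U \<subseteq> carrier_vec ?n" using U by (auto simp: vec_subspace_def)
    then have wc: "w \<in> carrier_vec ?n" using w by auto
    obtain j where j: "j < ?n" "w $ j \<noteq> 0"
      using w wc by (metis carrier_vecD eq_vecI index_zero_vec(1,2))
    have "v \<in> U" if v: "v \<in> carrier_vec ?n" for v
    proof -
      \<comment> \<open>The matrix is supported in the column \<open>j\<close> where
        \<open>w\<close> has a nonzero entry, and it carries \<open>w\<close> to \<open>v\<close>;
        an invariant subspace containing \<open>w\<close> therefore contains every
        \<open>v\<close>.\<close>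
      define y where "y = mat ?n ?n (\<lambda>(i, k). if k = j then v $ i / w $ j else 0)"
      have y: "y \<in> carrier_mat ?n ?n" by (simp add: y_def)
      then obtain a where a: "rep_extend V a = y" using full by blast
      have "y *\<^sub>v w = v"
      proof (rule eq_vecI)
        fix i assume "i < dim_vec v"
        then have i: "i < ?n" using v by simp
        have "(y *\<^sub>v w) $ i = (\<Sum>k<?n. if k = j then v $ i else 0)"
          unfolding mult_mat_vec_index[OF y wc i] using i j by (intro sum.cong refl) (auto simp: y_def)
        then show "(y *\<^sub>v w) $ i = v $ i" using j by simp
      qed (use v y in auto)
      then show ?thesis using rep_extend_invariant[OF V(1) U inv w(1), of a] a by simp
    qed
    then show ?thesis using Uc by auto
  qed
  then show ?thesis using V by (auto simp: irreducible_rep_def)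
qed

text \<open>Fullness of the image of the group algebra passes to a transposed representation at
  once, whereas invariant subspaces would have to be replaced by their annihilators.\<close>

lemma irreducible_twisted_dual:
  fixes V :: "'g \<Rightarrow> 'k mat"
  assumes V: "irreducible_rep V"
  shows "irreducible_rep (twisted_dual \<alpha> V)"
proof (rule irreducible_of_full)
  note rV = irreducible_repD(1)[OF V]
  show "representation (twisted_dual \<alpha> V)" by (rule representation_twisted_dual[OF rV])
  show "rep_dim (twisted_dual \<alpha> V) \<noteq> 0" using irreducible_repD(2)[OF V] rV by simp
  fix y :: "'k mat" assume "y \<in> carrier_mat (rep_dim (twisted_dual \<alpha> V)) (rep_dim (twisted_dual \<alpha> V))"
  then have y: "transpose_mat y \<in> carrier_mat (rep_dim V) (rep_dim V)" using rV by simp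
  have "rep_extend (twisted_dual \<alpha> V) (twisted_inv (block_elem V (transpose_mat y))) = y"
    unfolding rep_extend_twisted_inv[OF representation_twisted_dual[OF rV]] twisted_dual_twisted_dual[OF rV]
      rep_extend_block_elem[OF V y] by simp
  then show "\<exists>a. rep_extend (twisted_dual \<alpha> V) a = y" ..
qed

lemma rep_iso_twisted_dual:
  assumes iso: "rep_iso V W" and V: "representation V" and W: "representation W"
  shows "rep_iso (twisted_dual \<alpha> V) (twisted_dual \<alpha> W)"
proof -
  let ?n = "rep_dim V"
  from rep_iso_sym[OF iso V W]
  obtain P Q where d: "rep_dim W = ?n" and P: "P \<in> carrier_mat ?n ?n" and Q: "Q \<in> carrier_mat ?n ?n"
    and PQ: "P * Q = 1\<^sub>m ?n" "Q * P = 1\<^sub>m ?n" and c: "\<And>g. P * W g = V g * P"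
    by (rule rep_isoE) (use iso in \<open>auto simp: rep_iso_def\<close>)
  have Wg: "W g \<in> carrier_mat ?n ?n" for g using representation_carrier[OF W, of g] d by simp
  show ?thesis
  proof (rule rep_isoI[of _ _ "transpose_mat P" "transpose_mat Q"])
    show "transpose_mat P * transpose_mat Q = 1\<^sub>m (rep_dim (twisted_dual \<alpha> V))"
      "transpose_mat Q * transpose_mat P = 1\<^sub>m (rep_dim (twisted_dual \<alpha> V))"
      using V by (simp_all only: transpose_mult[OF P Q, symmetric] transpose_mult[OF Q P, symmetric] PQ
          transpose_one rep_dim_twisted_dual)
    fix g
    have "transpose_mat P * transpose_mat (V (- g)) = transpose_mat (W (- g)) * transpose_mat P"
      using transpose_mult[OF P Wg, of "- g"] transpose_mult[OF representation_carrier[OF V] P, of "- g"] c[of "- g"] by simp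
    then show "transpose_mat P * twisted_dual \<alpha> V g = twisted_dual \<alpha> W g * transpose_mat P"
      using mult_smult_distrib[of "transpose_mat P" ?n ?n "transpose_mat (V (- g))" ?n "\<alpha> g"]
        mult_smult_assoc_mat[of "transpose_mat (W (- g))" ?n ?n "transpose_mat P" ?n "\<alpha> g"] P V Wg
      by (simp add: twisted_dual_def)
  qed (use P Q d V W in auto)
qed

lemma rep_iso_twisted_dual_iff:
  assumes V: "irreducible_rep V" and W: "irreducible_rep W"
  shows "rep_iso (twisted_dual \<alpha> V) W \<longleftrightarrow> rep_iso V (twisted_dual \<alpha> W)"
  using rep_iso_twisted_dual[of "twisted_dual \<alpha> V" W] rep_iso_twisted_dual[of V "twisted_dual \<alpha> W"]
    twisted_dual_twisted_dual irreducible_twisted_dual irreducible_repD(1) V W by metis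

lemma twisted_inv_block_idem:
  assumes V: "irreducible_rep V"
  shows "twisted_inv (block_idem V) = block_idem (twisted_dual \<alpha> V)"
proof (rule ga_eqI)
  fix U :: "'g \<Rightarrow> 'k mat" assume U: "irreducible_rep U"
  note rU = irreducible_repD(1)[OF U]
  show "rep_extend U (twisted_inv (block_idem V)) = rep_extend U (block_idem (twisted_dual \<alpha> V))"
    unfolding rep_extend_twisted_inv[OF rU] rep_extend_block_idem[OF V irreducible_twisted_dual[OF U]]
      rep_extend_block_idem[OF irreducible_twisted_dual[OF V] U] rep_iso_twisted_dual_iff[OF V U]
    using rU by simp
qed

text \<open>The element \<open>a + twisted_inv a\<close> is fixed by \<sigma>, so its action on the
  twisted dual is the transpose of its action on \<open>V\<close>. Vanishing on \<open>V\<close>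
  thus gives vanishing on both blocks, and outside them \<open>a\<close> and
  \<open>twisted_inv a\<close> act by 0. Membership in \<open>L_alg \<alpha>\<close> is thereby
  tested on one block.\<close>

lemma L_alg_of_blocks:
  assumes V: "irreducible_rep V" and a: "a \<in> blocks {V, twisted_dual \<alpha> V}"
    and 0: "rep_extend V (a + twisted_inv a) = 0\<^sub>m (rep_dim V) (rep_dim V)"
  shows "a \<in> L_alg \<alpha>"
  unfolding L_alg_iff
proof (rule rep_extend_faithful)
  note rV = irreducible_repD(1)[OF V] and rV' = representation_twisted_dual[OF irreducible_repD(1)[OF V]]
  let ?b = "a + twisted_inv a"
  fix W :: "'g \<Rightarrow> 'k mat" assume W: "irreducible_rep W"
  note rW = irreducible_repD(1)[OF W]
  have b: "twisted_inv ?b = ?b" by (simp add: twisted_inv_add add.commute)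
  consider "rep_iso W V" | "rep_iso W (twisted_dual \<alpha> V)"
    | "\<not> rep_iso W V" "\<not> rep_iso W (twisted_dual \<alpha> V)" by blast
  then show "rep_extend W ?b = 0\<^sub>m (rep_dim W) (rep_dim W)"
  proof cases
    case 1
    then show ?thesis using 0 by (rule rep_extend_iso_zero[OF _ rW rV])
  next
    case 2
    have "rep_extend (twisted_dual \<alpha> V) ?b = transpose_mat (rep_extend V ?b)"
      using rep_extend_twisted_inv[OF rV', of ?b] by (simp add: b twisted_dual_twisted_dual[OF rV])
    then have "rep_extend (twisted_dual \<alpha> V) ?b = 0\<^sub>m (rep_dim (twisted_dual \<alpha> V)) (rep_dim (twisted_dual \<alpha> V))"
      using 0 rV by simp
    with 2 show ?thesis by (rule rep_extend_iso_zero[OF _ rW rV'])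
  next
    case 3
    have W': "irreducible_rep (twisted_dual \<alpha> W)" by (rule irreducible_twisted_dual[OF W])
    have "\<not> rep_iso (twisted_dual \<alpha> W) V" "\<not> rep_iso (twisted_dual \<alpha> W) (twisted_dual \<alpha> V)"
      using 3 rep_iso_twisted_dual_iff[OF W V] rep_iso_twisted_dual_iff[OF W irreducible_twisted_dual[OF V]]
        twisted_dual_twisted_dual[OF rV] by auto
    then have "rep_extend W a = 0\<^sub>m (rep_dim W) (rep_dim W)"
      "rep_extend (twisted_dual \<alpha> W) a = 0\<^sub>m (rep_dim W) (rep_dim W)"
      using a 3 W W' rW by (auto simp: blocks_def)
    then show ?thesis by (simp add: rep_extend_add rep_extend_twisted_inv[OF rW])
  qed
qed

end

section \<open>Skew-adjoint elements and the equality with the direct sum\<close>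

text \<open>For skew-adjoint \<open>x\<close> the matrix \<open>B * x\<close> is skew-symmetric of
  size 2, hence a multiple of \<open>J\<close>. So every skew-adjoint matrix is a multiple of the
  one matrix \<open>K = Q * J\<close>: the Lie algebra \<open>so(2)\<close> is a line.\<close>

lemma skew_adjoint_2x2_commute:
  fixes x y B :: "'a::field_char_0 mat"
  assumes B: "B \<in> carrier_mat 2 2" "invertible_mat B" "transpose_mat B = B"
    and x: "x \<in> osp_form 2 B" and y: "y \<in> osp_form 2 B"
  shows "x * y = y * x"
proof -
  define J :: "'a mat" where "J = mat 2 2 (\<lambda>(i, j). if i = 0 \<and> j = 1 then 1 else if i = 1 \<and> j = 0 then -1 else 0)"
  have J: "J \<in> carrier_mat 2 2" by (simp add: J_def)
  obtain Q where Q: "Q \<in> carrier_mat 2 2" "Q * B = 1\<^sub>m 2" using B(2,1) by (rule invertible_matE)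
  define K where "K = Q * J"
  have K: "K \<in> carrier_mat 2 2" using Q J by (simp add: K_def)
  have "\<exists>m. x = m \<cdot>\<^sub>m K" if "x \<in> osp_form 2 B" for x
  proof -
    have xc: "x \<in> carrier_mat 2 2" and 0: "transpose_mat x * B + B * x = 0\<^sub>m 2 2"
      using that osp_form_iff[OF B(1)] by auto
    define M where "M = B * x"
    have M: "M \<in> carrier_mat 2 2" using B xc by (simp add: M_def)
    have "transpose_mat M = transpose_mat x * B"
      unfolding M_def using transpose_mult[OF B(1) xc] B(3) by simp
    then have "transpose_mat M + M = 0\<^sub>m 2 2" using 0 by (simp add: M_def)
    then have e: "(transpose_mat M + M) $$ (i, j) = 0" if "i < 2" "j < 2" for i j using that by simp
    have e': "M $$ (j, i) + M $$ (i, j) = 0" if "i < 2" "j < 2" for i j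
      using e[OF that] that M by simp
    have "M = M $$ (0, 1) \<cdot>\<^sub>m J"
    proof (rule eq_matI)
      fix i j assume "i < dim_row (M $$ (0, 1) \<cdot>\<^sub>m J)" "j < dim_col (M $$ (0, 1) \<cdot>\<^sub>m J)"
      then have ij: "i < 2" "j < 2" using J by auto
      then have "i = 0 \<or> i = 1" "j = 0 \<or> j = 1" by auto
      then show "M $$ (i, j) = (M $$ (0, 1) \<cdot>\<^sub>m J) $$ (i, j)"
        using e'[of 0 0] e'[of 1 1] e'[of 0 1] by (auto simp: J_def add_eq_0_iff)
    qed (use M J in auto)
    then have "Q * M = M $$ (0, 1) \<cdot>\<^sub>m K"
      unfolding K_def using mult_smult_distrib[OF Q(1) J] by metis
    moreover have "Q * M = x"
      unfolding M_def using assoc_mult_mat[OF Q(1) B(1) xc] Q(2) xc by simp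
    ultimately show ?thesis by auto
  qed
  then obtain m m' where xy: "x = m \<cdot>\<^sub>m K" "y = m' \<cdot>\<^sub>m K" using x y by meson
  show ?thesis
    unfolding xy using K
    by (simp add: mult_smult_distrib[of _ 2 2] mult_smult_assoc_mat[of _ 2 2])
      (auto intro!: eq_matI simp: mult.left_commute)
qed

text \<open>The hypothesis is the \<open>(i, j)\<close> entry of \<open>x D + D x\<^sup>T = 0\<close>, where \<open>D = E\<^sub>p\<^sub>q - \<epsilon> E\<^sub>q\<^sub>p\<close>.\<close>

lemma centralizer_entries_zero:
  fixes x :: "nat \<Rightarrow> nat \<Rightarrow> 'a::field_char_0"
  assumes eq: "\<And>i j p q. i < n \<Longrightarrow> j < n \<Longrightarrow> p < n \<Longrightarrow> q < n \<Longrightarrow>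
      (if j = q then x i p else 0) - \<epsilon> * (if j = p then x i q else 0)
        + (if i = p then x j q else 0) - \<epsilon> * (if i = q then x j p else 0) = 0"
    and eps: "\<epsilon> = -1 \<or> \<epsilon> = 1 \<and> n \<ge> 3"
    and ip: "i < n" "p < n"
  shows "x i p = 0"
  using eps
proof
  assume e: "\<epsilon> = -1"
  \<comment> \<open>In the symplectic case \<open>q = p\<close> is allowed, since \<open>D\<close>
    is then twice a diagonal matrix unit.\<close>
  have "x i p + x i p = 0" if "i \<noteq> p" using eq[of i p p p] ip that by (simp add: e)
  moreover have "x p p + x p p + (x p p + x p p) = 0" using eq[of p p p p] ip by (simp add: e)
  ultimately show ?thesis by (cases "i = p") (auto simp: mult_2[symmetric])
next
  assume e: "\<epsilon> = 1 \<and> n \<ge> 3"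
  \<comment> \<open>In the orthogonal case \<open>D\<close> vanishes for \<open>p = q\<close>, and
    spare indices are needed: one outside \<open>i\<close> and \<open>p\<close> for an off-diagonal
    entry, and two besides \<open>p\<close> for a diagonal entry, where the pairwise sums of three
    diagonal entries vanish. With only two indices there is no such choice, in accordance with
    \<open>so(2)\<close> being abelian.\<close>
  have third: "\<exists>q<n. q \<noteq> a \<and> q \<noteq> b" for a b
  proof -
    have "0 \<noteq> a \<and> 0 \<noteq> b \<or> 1 \<noteq> a \<and> 1 \<noteq> b \<or> 2 \<noteq> a \<and> 2 \<noteq> b" by arith
    then show ?thesis using e by (metis (no_types) One_nat_def Suc_le_eq le_trans less_le_trans numeral_2_eq_2 numeral_3_eq_3 zero_less_Suc lessI Suc_less_eq)
  qed
  show ?thesis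
  proof (cases "i = p")
    case False
    obtain q where "q < n" "q \<noteq> i" "q \<noteq> p" using third by blast
    then show ?thesis using eq[of i q p q] False ip by simp
  next
    case True
    obtain q where q: "q < n" "q \<noteq> p" using third by blast
    obtain r where r: "r < n" "r \<noteq> p" "r \<noteq> q" using third by blast
    have s: "x a a + x b b = 0" if "a < n" "b < n" "a \<noteq> b" for a b
      using eq[of a b a b] that e by simp
    have "x p p + x q q = 0" "x p p + x r r = 0" "x q q + x r r = 0"
      using s q r ip by auto
    then have "x p p + x p p = 0" by (metis add.commute add_eq_0_iff neg_equal_iff_equal add.inverse_inverse)
    then show ?thesis using True by (simp add: mult_2[symmetric])
  qed
qed

context twisted_group_algebra
begin

text \<open>Invariance means that the transpose of \<open>V g\<close> times \<open>B * V g\<close>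
  is \<open>\<alpha> g\<close> times \<open>B\<close>. Cancelling with \<open>V (- g)\<close> turns
  this into an intertwining relation; together with the converse below, invariant forms are the
  isomorphisms onto the twisted dual.\<close>

lemma invariant_form_intertwines:
  assumes V: "representation V" and B: "invariant_form \<alpha> V B"
  shows "B * V g = twisted_dual \<alpha> V g * B"
proof -
  let ?n = "rep_dim V"
  have Bc: "B \<in> carrier_mat ?n ?n" using B by (simp add: invariant_form_def)
  have Vc: "V g \<in> carrier_mat ?n ?n" "transpose_mat (V g) \<in> carrier_mat ?n ?n" for g using V by auto
  have inv: "transpose_mat (V g) * (B * V g) = \<alpha> g \<cdot>\<^sub>m B" for g
  proof (rule mat_bilinear_eq)
    fix v w :: "'k vec" assume v: "v \<in> carrier_vec ?n" and w: "w \<in> carrier_vec ?n"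
    have BVw: "B *\<^sub>v (V g *\<^sub>v w) = (B * V g) *\<^sub>v w"
      using assoc_mult_mat_vec[OF Bc Vc(1) w] by simp
    have BVwc: "(B * V g) *\<^sub>v w \<in> carrier_vec ?n"
      by (rule mult_mat_vec_carrier[OF mult_carrier_mat[OF Bc Vc(1)] w])
    have "v \<bullet> (transpose_mat (V g) * (B * V g) *\<^sub>v w) = v \<bullet> (transpose_mat (V g) *\<^sub>v ((B * V g) *\<^sub>v w))"
      using assoc_mult_mat_vec[OF Vc(2) mult_carrier_mat[OF Bc Vc(1)] w] by simp
    also have "\<dots> = (V g *\<^sub>v v) \<bullet> ((B * V g) *\<^sub>v w)"
      by (rule scalar_prod_transpose[OF Vc(1) v BVwc, symmetric])
    also have "\<dots> = \<alpha> g * (v \<bullet> (B *\<^sub>v w))"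
      using B v w by (simp add: invariant_form_def BVw[symmetric])
    also have "\<dots> = v \<bullet> (\<alpha> g \<cdot>\<^sub>m B *\<^sub>v w)"
    proof -
      have "\<alpha> g \<cdot>\<^sub>m B *\<^sub>v w = \<alpha> g \<cdot>\<^sub>v (B *\<^sub>v w)"
        by (rule smult_mult_mat_vec[OF Bc w])
      moreover have "v \<bullet> (\<alpha> g \<cdot>\<^sub>v (B *\<^sub>v w)) = \<alpha> g * (v \<bullet> (B *\<^sub>v w))"
        using v mult_mat_vec_carrier[OF Bc w] by (rule scalar_prod_smult_distrib)
      ultimately show ?thesis by simp
    qed
    finally show "v \<bullet> (transpose_mat (V g) * (B * V g) *\<^sub>v w) = v \<bullet> (\<alpha> g \<cdot>\<^sub>m B *\<^sub>v w)" .
  qed (use Bc mult_carrier_mat[OF Vc(2) mult_carrier_mat[OF Bc Vc(1)]] in auto)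
  have VV: "V (- g) * V g = 1\<^sub>m ?n" using V representation_add[OF V, of "- g" g] representation_0[OF V] by simp
  have "transpose_mat (V (- g)) * B = transpose_mat (V (- g)) * (B * (V (- g) * V g))"
    using Bc by (simp add: VV)
  also have "\<dots> = transpose_mat (V (- g)) * (B * V (- g)) * V g"
    using assoc_mult_mat[OF Bc Vc(1) Vc(1), of "- g" g]
      assoc_mult_mat[OF Vc(2) mult_carrier_mat[OF Bc Vc(1)] Vc(1), of "- g" "- g" g] by simp
  also have "\<dots> = \<alpha> (- g) \<cdot>\<^sub>m (B * V g)"
    unfolding inv by (rule mult_smult_assoc_mat[OF Bc Vc(1)])
  finally have *: "transpose_mat (V (- g)) * B = \<alpha> (- g) \<cdot>\<^sub>m (B * V g)" .
  have "twisted_dual \<alpha> V g * B = \<alpha> g \<cdot>\<^sub>m (transpose_mat (V (- g)) * B)"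
    unfolding twisted_dual_def by (rule mult_smult_assoc_mat[OF Vc(2) Bc])
  also have "\<dots> = B * V g"
    unfolding * by (auto simp: mult.assoc[symmetric] alpha_uminus_mult intro!: eq_matI)
  finally show ?thesis ..
qed

lemma invariant_formI:
  assumes V: "representation V" and B: "B \<in> carrier_mat (rep_dim V) (rep_dim V)" "invertible_mat B"
    and c: "\<And>g. B * V g = twisted_dual \<alpha> V g * B"
  shows "invariant_form \<alpha> V B"
  unfolding invariant_form_def
proof (intro conjI allI ballI B)
  let ?n = "rep_dim V"
  fix g and v w :: "'k vec" assume v: "v \<in> carrier_vec ?n" and w: "w \<in> carrier_vec ?n"
  have Vc: "V g \<in> carrier_mat ?n ?n" "transpose_mat (V g) \<in> carrier_mat ?n ?n" for g using V by auto
  have Bw: "B *\<^sub>v w \<in> carrier_vec ?n" using B(1) w by simp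
  have VtBw: "transpose_mat (V (- g)) *\<^sub>v (B *\<^sub>v w) \<in> carrier_vec ?n"
    by (rule mult_mat_vec_carrier[OF Vc(2) Bw])
  have "B *\<^sub>v (V g *\<^sub>v w) = twisted_dual \<alpha> V g *\<^sub>v (B *\<^sub>v w)"
    using assoc_mult_mat_vec[OF B(1) Vc(1)[of g] w] assoc_mult_mat_vec[OF twisted_dual_carrier[OF V, of g] B(1) w] c[of g] by simp
  also have "\<dots> = \<alpha> g \<cdot>\<^sub>v (transpose_mat (V (- g)) *\<^sub>v (B *\<^sub>v w))"
    unfolding twisted_dual_def by (rule smult_mult_mat_vec[OF Vc(2) Bw])
  finally have "(V g *\<^sub>v v) \<bullet> (B *\<^sub>v (V g *\<^sub>v w))
    = (V g *\<^sub>v v) \<bullet> (\<alpha> g \<cdot>\<^sub>v (transpose_mat (V (- g)) *\<^sub>v (B *\<^sub>v w)))" by simp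
  also have "\<dots> = \<alpha> g * ((V g *\<^sub>v v) \<bullet> (transpose_mat (V (- g)) *\<^sub>v (B *\<^sub>v w)))"
    by (rule scalar_prod_smult_distrib[OF mult_mat_vec_carrier[OF Vc(1) v] VtBw])
  also have "(V g *\<^sub>v v) \<bullet> (transpose_mat (V (- g)) *\<^sub>v (B *\<^sub>v w)) = (V (- g) *\<^sub>v (V g *\<^sub>v v)) \<bullet> (B *\<^sub>v w)"
    by (rule scalar_prod_transpose[OF Vc(1) mult_mat_vec_carrier[OF Vc(1) v] Bw, symmetric])
  also have "V (- g) *\<^sub>v (V g *\<^sub>v v) = v"
    unfolding assoc_mult_mat_vec[OF Vc(1) Vc(1) v, symmetric] representation_add[OF V, symmetric]
    using v by (simp add: representation_0[OF V])
  finally show "(V g *\<^sub>v v) \<bullet> (B *\<^sub>v (V g *\<^sub>v w)) = \<alpha> g * (v \<bullet> (B *\<^sub>v w))" .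
qed

lemma invariant_form_exists_iff:
  assumes V: "representation V"
  shows "(\<exists>B. invariant_form \<alpha> V B) \<longleftrightarrow> rep_iso V (twisted_dual \<alpha> V)"
  using invariant_form_intertwines[OF V] invariant_formI[OF V] V
  unfolding rep_iso_def by (metis invariant_form_def rep_dim_twisted_dual)

text \<open>\<open>B\<close> carries the action \<open>x\<close> of \<open>a\<close> on
  \<open>V\<close> to its action \<open>y\<close> on the twisted dual, so
  \<open>x\<^sup>T * B + B * x\<close> equals \<open>(x\<^sup>T + y) * B\<close>, and
  \<open>B\<close> can be cancelled. The resulting condition no longer mentions
  \<open>B\<close>.\<close>

lemma osp_form_rep_extend_iff:
  assumes V: "representation V" and B: "invariant_form \<alpha> V B"
  shows "rep_extend V a \<in> osp_form (rep_dim V) B \<longleftrightarrow>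
    rep_extend V (a + twisted_inv a) = 0\<^sub>m (rep_dim V) (rep_dim V)"
proof -
  let ?n = "rep_dim V" and ?x = "rep_extend V a" and ?y = "rep_extend (twisted_dual \<alpha> V) a"
  have Bc: "B \<in> carrier_mat ?n ?n" "invertible_mat B" using B by (auto simp: invariant_form_def)
  have y: "?y \<in> carrier_mat ?n ?n" using rep_extend_carrier[of "twisted_dual \<alpha> V" a] V by simp
  have xt: "transpose_mat ?x \<in> carrier_mat ?n ?n" by simp
  have "B * ?x = ?y * B"
    by (rule rep_extend_intertwine)
      (use Bc V representation_twisted_dual[OF V] invariant_form_intertwines[OF V B] in auto)
  then have "transpose_mat ?x * B + B * ?x = (transpose_mat ?x + ?y) * B"
    using add_mult_distrib_mat[OF xt y Bc(1)] by simp
  moreover have "transpose_mat (rep_extend V (a + twisted_inv a)) = transpose_mat ?x + ?y"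
    unfolding rep_extend_add rep_extend_twisted_inv[OF V]
    using transpose_add[of ?x ?n ?n "transpose_mat ?y"] y by simp
  moreover have "(transpose_mat ?x + ?y) * B = 0\<^sub>m ?n ?n \<longleftrightarrow> transpose_mat ?x + ?y = 0\<^sub>m ?n ?n"
    using mult_right_cancel_invertible[of "transpose_mat ?x + ?y" ?n B] xt y Bc by auto
  ultimately have "transpose_mat ?x * B + B * ?x = 0\<^sub>m ?n ?n \<longleftrightarrow>
      transpose_mat (rep_extend V (a + twisted_inv a)) = 0\<^sub>m ?n ?n" by simp
  also have "\<dots> \<longleftrightarrow> rep_extend V (a + twisted_inv a) = 0\<^sub>m ?n ?n"
    by (metis transpose_transpose zero_transpose_mat)
  finally show ?thesis using osp_form_iff[OF Bc(1)] by simp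
qed

lemma blocks_twisted_dual_iso:
  assumes V: "irreducible_rep V" and iso: "rep_iso V (twisted_dual \<alpha> V)"
  shows "blocks {V, twisted_dual \<alpha> V} = (blocks {V} :: ('g, 'k) group_algebra set)"
proof -
  have "rep_iso W (twisted_dual \<alpha> V) \<longleftrightarrow> rep_iso W V" if "irreducible_rep W" for W
    using rep_iso_irreducible_trans[of W V "twisted_dual \<alpha> V"] rep_iso_irreducible_trans[of W "twisted_dual \<alpha> V" V]
      rep_iso_irreducible_sym[OF V irreducible_twisted_dual[OF V]] irreducible_twisted_dual[OF V] that iso V by blast
  then show ?thesis by (auto simp: blocks_def)
qed

text \<open>Together with the description of \<open>gl_alg\<close> below, both kinds of summand take
  the same form, the part of \<open>L_alg \<alpha>\<close> supported on the blocks of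
  \<open>V\<close> and its twisted dual. The comparison with \<open>M_alg \<alpha>\<close> then runs
  uniformly.\<close>

lemma osp_alg_eq:
  assumes V: "irreducible_rep V" and iso: "rep_iso V (twisted_dual \<alpha> V)"
  shows "osp_alg \<alpha> V = L_alg \<alpha> \<inter> blocks {V, twisted_dual \<alpha> V}"
proof -
  note rV = irreducible_repD(1)[OF V]
  obtain B where B: "invariant_form \<alpha> V B" using iso invariant_form_exists_iff[OF rV] by blast
  have "a \<in> osp_alg \<alpha> V \<longleftrightarrow> a \<in> L_alg \<alpha> \<inter> blocks {V, twisted_dual \<alpha> V}" for a
  proof
    assume "a \<in> osp_alg \<alpha> V"
    then show "a \<in> L_alg \<alpha> \<inter> blocks {V, twisted_dual \<alpha> V}"
      using L_alg_of_blocks[OF V] osp_form_rep_extend_iff[OF rV]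
      by (auto simp: osp_alg_def blocks_twisted_dual_iso[OF V iso])
  next
    assume "a \<in> L_alg \<alpha> \<inter> blocks {V, twisted_dual \<alpha> V}"
    then show "a \<in> osp_alg \<alpha> V"
      using B osp_form_rep_extend_iff[OF rV B, of a]
      by (auto simp: osp_alg_def blocks_twisted_dual_iso[OF V iso] L_alg_iff)
  qed
  then show ?thesis by blast
qed

lemma gl_alg_eq:
  assumes V: "irreducible_rep V"
  shows "gl_alg \<alpha> V = L_alg \<alpha> \<inter> blocks {V, twisted_dual \<alpha> V}"
proof -
  note rV = irreducible_repD(1)[OF V]
  let ?n = "rep_dim V"
  have "rep_extend (twisted_dual \<alpha> V) a = - transpose_mat (rep_extend V a)
    \<longleftrightarrow> rep_extend V (a + twisted_inv a) = 0\<^sub>m ?n ?n" for a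
  proof -
    have y: "rep_extend (twisted_dual \<alpha> V) a \<in> carrier_mat ?n ?n"
      using rep_extend_carrier[of "twisted_dual \<alpha> V" a] rV by simp
    have "rep_extend (twisted_dual \<alpha> V) a = - transpose_mat (rep_extend V a)
      \<longleftrightarrow> transpose_mat (rep_extend (twisted_dual \<alpha> V) a) = - rep_extend V a"
      by (metis transpose_transpose transpose_uminus)
    also have "\<dots> \<longleftrightarrow> rep_extend V (a + twisted_inv a) = 0\<^sub>m ?n ?n"
      unfolding rep_extend_add rep_extend_twisted_inv[OF rV]
      using mat_add_eq_zero_iff[of "rep_extend V a" ?n ?n "transpose_mat (rep_extend (twisted_dual \<alpha> V) a)"] y by simp
    finally show ?thesis .
  qed
  then show ?thesis
    using L_alg_of_blocks[OF V] by (auto simp: gl_alg_def L_alg_iff)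
qed

text \<open>The component of \<open>a\<close> in the blocks of \<open>V\<close> and \<open>V\<^sup>* \<otimes> \<alpha>\<close>, where \<open>e\<close> is the central
  idempotent of \<open>V\<close>; it is halved if these are distinct and counted once for each.\<close>

definition block_component :: "('g, 'k) group_algebra \<Rightarrow> ('g, 'k) group_algebra \<Rightarrow> ('g, 'k) group_algebra" where
  "block_component e a = ga_scale (1 / 2) ((e + twisted_inv e) * a)"

lemma sum_block_component: "(\<Sum>e\<in>block_idems. block_component e a) = a"
proof -
  have "(\<Sum>e\<in>block_idems. block_component e a)
    = ga_scale (1 / 2) ((\<Sum>block_idems + twisted_inv (\<Sum>block_idems)) * a)"
    by (simp add: block_component_def ga.scale_sum_right sum_distrib_right twisted_inv_sum sum.distrib[symmetric])
  also have "\<dots> = ga_scale (1 / 2) (a + a)"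
    by (simp only: sum_block_idems twisted_inv_1 distrib_right mult_1_left)
  also have "\<dots> = a"
    by (rule poly_mapping_eqI) (simp add: lookup_add)
  finally show ?thesis .
qed

lemma twisted_inv_block_idem_central:
  assumes "irreducible_rep V"
  shows "(block_idem V + twisted_inv (block_idem V)) * a = a * (block_idem V + twisted_inv (block_idem V))"
  using block_idem_central[OF assms] block_idem_central[OF irreducible_twisted_dual[OF assms]]
  by (simp add: twisted_inv_block_idem[OF assms] distrib_left distrib_right)

text \<open>The factor \<open>e + twisted_inv e\<close>, with \<open>e\<close> the idempotent of
  \<open>V\<close>, is central and fixed by \<sigma>, so multiplication by it commutes with
  \<sigma>; and it acts by 0 outside the two blocks.\<close>

lemma block_component_L_alg:
  assumes V: "irreducible_rep V" and a: "a \<in> L_alg \<alpha>"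
  shows "block_component (block_idem V) a \<in> L_alg \<alpha> \<inter> blocks {V, twisted_dual \<alpha> V}"
proof
  let ?f = "block_idem V + twisted_inv (block_idem V)"
  have "twisted_inv ?f = ?f" by (simp add: twisted_inv_add add.commute)
  then show "block_component (block_idem V) a \<in> L_alg \<alpha>"
    using a twisted_inv_block_idem_central[OF V, of a]
    by (simp add: L_alg_iff' block_component_def twisted_inv_scale twisted_inv_mult)
  show "block_component (block_idem V) a \<in> blocks {V, twisted_dual \<alpha> V}"
    unfolding blocks_def
  proof (intro CollectI allI impI)
    fix W :: "'g \<Rightarrow> 'k mat" assume W: "irreducible_rep W \<and> (\<forall>U\<in>{V, twisted_dual \<alpha> V}. \<not> rep_iso W U)"
    then have "rep_extend W ?f = 0\<^sub>m (rep_dim W) (rep_dim W)"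
      using rep_extend_block_idem[OF V, of W] rep_extend_block_idem[OF irreducible_twisted_dual[OF V], of W]
        rep_iso_irreducible_sym[OF V, of W] rep_iso_irreducible_sym[OF irreducible_twisted_dual[OF V], of W]
      by (simp add: twisted_inv_block_idem[OF V] rep_extend_add)
    then show "rep_extend W (block_component (block_idem V) a) = 0\<^sub>m (rep_dim W) (rep_dim W)"
      using W left_mult_zero_mat[OF rep_extend_carrier[of W a]]
      by (simp add: block_component_def rep_extend_scale rep_extend_mult irreducible_repD(1))
  qed
qed

lemma L_alg_eq_M_alg: "L_alg \<alpha> = M_alg \<alpha>"
proof
  show "L_alg \<alpha> \<subseteq> M_alg \<alpha>"
  proof
    fix a assume a: "a \<in> L_alg \<alpha>"
    have "block_component e a \<in> M_alg \<alpha>" if e: "e \<in> block_idems" for e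
    proof -
      obtain V where V: "irreducible_rep V" "e = block_idem V" using e by (auto simp: block_idems_def)
      have c: "block_component e a \<in> L_alg \<alpha> \<inter> blocks {V, twisted_dual \<alpha> V}"
        unfolding V(2) by (rule block_component_L_alg[OF V(1) a])
      show ?thesis
      proof (cases "rep_iso V (twisted_dual \<alpha> V)")
        case True
        then show ?thesis
          using c V(1) unfolding M_alg_def osp_alg_eq[OF V(1) True, symmetric]
          by (intro ga.span_base UnI1) blast
      next
        case False
        then show ?thesis
          using c V(1) unfolding M_alg_def gl_alg_eq[OF V(1), symmetric]
          by (intro ga.span_base UnI2) blast
      qed
    qed
    then have "(\<Sum>e\<in>block_idems. block_component e a) \<in> M_alg \<alpha>"
      unfolding M_alg_def by (intro ga.span_sum)
    then show "a \<in> M_alg \<alpha>" by (simp add: sum_block_component)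
  qed
  show "M_alg \<alpha> \<subseteq> L_alg \<alpha>"
    unfolding M_alg_def using osp_alg_eq gl_alg_eq
    by (intro ga.span_minimal subspace_L_alg) auto
qed

end

section \<open>The center\<close>

context twisted_group_algebra
begin

lemma lie_center_L_algD:
  assumes "z \<in> lie_center (L_alg \<alpha>)"
  shows "z \<in> L_alg \<alpha>" "b \<in> L_alg \<alpha> \<Longrightarrow> z * b = b * z"
  using assms by (auto simp: lie_center_def lie_bracket_def)

text \<open>When \<open>V\<close> is not isomorphic to its twisted dual,
  \<open>L_alg \<alpha>\<close> acts on \<open>V\<close> by all matrices: an element
  \<open>c\<close> supported on the block of \<open>V\<close> has \<open>twisted_inv c\<close>
  supported on the other block, so \<open>c - twisted_inv c\<close> acts on \<open>V\<close> as
  \<open>c\<close> does.\<close>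

lemma rep_extend_center_commute:
  assumes z: "z \<in> lie_center (L_alg \<alpha>)" and V: "irreducible_rep V"
    and "\<not> rep_iso V (twisted_dual \<alpha> V)"
  shows "rep_extend V (z * a - a * z) = 0\<^sub>m (rep_dim V) (rep_dim V)"
proof -
  note rV = irreducible_repD(1)[OF V]
  let ?n = "rep_dim V"
  define c where "c = block_elem V (rep_extend V a)"
  have "rep_extend (twisted_dual \<alpha> V) c = 0\<^sub>m ?n ?n"
    unfolding c_def using rep_extend_block_elem_noniso[OF V irreducible_twisted_dual[OF V] assms(3)] rV by simp
  moreover have "rep_extend V c = rep_extend V a"
    unfolding c_def by (rule rep_extend_block_elem[OF V rep_extend_carrier])
  ultimately have "rep_extend V (c - twisted_inv c) = rep_extend V a"
    by (auto simp: rep_extend_minus rep_extend_twisted_inv[OF rV] intro!: eq_matI)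
  moreover have "z * (c - twisted_inv c) = (c - twisted_inv c) * z"
    by (rule lie_center_L_algD(2)[OF z L_alg_commutator])
  ultimately have "rep_extend V z * rep_extend V a = rep_extend V a * rep_extend V z"
    by (metis rep_extend_mult[OF rV])
  then show ?thesis
    by (auto simp: rep_extend_minus rep_extend_mult[OF rV] intro!: eq_matI)
qed

text \<open>The transpose of \<open>B\<close> is again an intertwiner from \<open>V\<close> to the
  twisted dual, so by Schur's lemma it is a multiple of \<open>B\<close>; transposing twice shows
  that the square of the factor is 1.\<close>

lemma invariant_form_symmetric_or_skew:
  assumes V: "irreducible_rep V" and B: "invariant_form \<alpha> V B"
  obtains \<epsilon> where "\<epsilon> = 1 \<or> \<epsilon> = -1" "transpose_mat B = \<epsilon> \<cdot>\<^sub>m B"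
proof -
  let ?n = "rep_dim V"
  note rV = irreducible_repD(1)[OF V] and n0 = irreducible_repD(2)[OF V]
  have Bc: "B \<in> carrier_mat ?n ?n" "invertible_mat B" using B by (auto simp: invariant_form_def)
  then obtain Q where Q: "Q \<in> carrier_mat ?n ?n" "B * Q = 1\<^sub>m ?n" "Q * B = 1\<^sub>m ?n" by (metis invertible_matE)
  have Bt: "transpose_mat B \<in> carrier_mat ?n ?n" using Bc by simp
  have Vc: "V g \<in> carrier_mat ?n ?n" "twisted_dual \<alpha> V g \<in> carrier_mat ?n ?n" for g
    using rV twisted_dual_carrier by auto
  have c: "B * V g = twisted_dual \<alpha> V g * B" for g by (rule invariant_form_intertwines[OF rV B])
  have ct: "transpose_mat B * V g = twisted_dual \<alpha> V g * transpose_mat B" for g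
  proof -
    have tt: "transpose_mat (twisted_dual \<alpha> V (- g)) = \<alpha> (- g) \<cdot>\<^sub>m V g"
      by (auto simp: twisted_dual_def intro!: eq_matI)
    have "transpose_mat (V (- g)) * transpose_mat B = transpose_mat (B * V (- g))"
      by (rule transpose_mult[OF Bc(1) Vc(1), symmetric])
    also have "\<dots> = transpose_mat B * transpose_mat (twisted_dual \<alpha> V (- g))"
      unfolding c by (rule transpose_mult[OF Vc(2) Bc(1)])
    also have "\<dots> = \<alpha> (- g) \<cdot>\<^sub>m (transpose_mat B * V g)"
      unfolding tt by (rule mult_smult_distrib[OF Bt Vc(1)])
    finally have *: "transpose_mat (V (- g)) * transpose_mat B = \<alpha> (- g) \<cdot>\<^sub>m (transpose_mat B * V g)" .
    have "twisted_dual \<alpha> V g * transpose_mat B = \<alpha> g \<cdot>\<^sub>m (transpose_mat (V (- g)) * transpose_mat B)"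
      unfolding twisted_dual_def using Vc(1) by (intro mult_smult_assoc_mat[OF _ Bt]) simp
    also have "\<dots> = transpose_mat B * V g"
      unfolding * by (auto simp: mult.assoc[symmetric] alpha_uminus_mult intro!: eq_matI)
    finally show ?thesis ..
  qed
  have Qt: "Q * twisted_dual \<alpha> V g = V g * Q" for g
  proof -
    have "Q * twisted_dual \<alpha> V g = Q * twisted_dual \<alpha> V g * (B * Q)" using Q Vc(2)[of g] by simp
    also have "\<dots> = Q * (twisted_dual \<alpha> V g * B) * Q"
      using assoc_mult_mat[OF mult_carrier_mat[OF Q(1) Vc(2)] Bc(1) Q(1), of g]
        assoc_mult_mat[OF Q(1) Vc(2) Bc(1), of g] by simp
    also have "\<dots> = V g * Q"
      unfolding c[symmetric] assoc_mult_mat[OF Q(1) Bc(1) Vc(1), symmetric] Q(3) using Vc(1)[of g] by simp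
    finally show ?thesis .
  qed
  define S where "S = Q * transpose_mat B"
  have S: "S \<in> carrier_mat ?n ?n" using Q Bt by (simp add: S_def)
  have SV: "S * V g = V g * S" for g
  proof -
    have "S * V g = Q * (twisted_dual \<alpha> V g * transpose_mat B)"
      unfolding S_def ct[symmetric] by (rule assoc_mult_mat[OF Q(1) Bt Vc(1)])
    also have "\<dots> = Q * twisted_dual \<alpha> V g * transpose_mat B" by (rule assoc_mult_mat[OF Q(1) Vc(2) Bt, symmetric])
    also have "\<dots> = V g * S" unfolding Qt S_def by (rule assoc_mult_mat[OF Vc(1) Q(1) Bt])
    finally show ?thesis .
  qed
  have "S = S $$ (0, 0) \<cdot>\<^sub>m 1\<^sub>m ?n" by (rule schur_scalar[OF defined_over V S SV])
  then obtain e where e: "S = e \<cdot>\<^sub>m 1\<^sub>m ?n" by blast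
  have "transpose_mat B = B * Q * transpose_mat B" using Q Bt by simp
  also have "\<dots> = B * S" unfolding S_def by (rule assoc_mult_mat[OF Bc(1) Q(1) Bt])
  also have "\<dots> = e \<cdot>\<^sub>m B" unfolding e using mult_smult_distrib[OF Bc(1), of "1\<^sub>m ?n" ?n e] Bc by simp
  finally have Be: "transpose_mat B = e \<cdot>\<^sub>m B" .
  have "B \<noteq> 0\<^sub>m ?n ?n"
  proof
    assume "B = 0\<^sub>m ?n ?n"
    then have "1\<^sub>m ?n = (0\<^sub>m ?n ?n :: 'k mat)" using Q by simp
    then show False using n0 by (metis index_one_mat(1) index_zero_mat(1) neq0_conv zero_neq_one)
  qed
  then obtain i j where ij: "i < ?n" "j < ?n" "B $$ (i, j) \<noteq> 0"
    using Bc(1) by (metis carrier_matD eq_matI index_zero_mat)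
  have sw: "B $$ (l, k) = e * B $$ (k, l)" if "k < ?n" "l < ?n" for k l
    using arg_cong[OF Be, of "\<lambda>M. M $$ (k, l)"] that Bc(1) by simp
  have "B $$ (i, j) = e * (e * B $$ (i, j))" using sw[of i j] sw[of j i] ij by simp
  then have "(e - 1) * (e + 1) = 0" using ij(3) by (simp add: algebra_simps)
  then have "e = 1 \<or> e = -1" by (auto simp: add_eq_0_iff2)
  then show ?thesis using Be by (rule that)
qed

text \<open>For a matrix unit \<open>F\<close> and \<open>D = F - \<epsilon> F\<^sup>T\<close>, the
  product \<open>D * B\<close> is skew-adjoint and is the action of an element of
  \<open>L_alg \<alpha>\<close>. Commuting the action \<open>x\<close> of \<open>z\<close> with
  \<open>D * B\<close>, replacing \<open>B * x\<close> by \<open>- x\<^sup>T * B\<close> and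
  cancelling \<open>B\<close> leaves the relation between \<open>x\<close> and \<open>D\<close> that
  \<open>centralizer_entries_zero\<close> evaluates entry by entry.\<close>

lemma rep_extend_center_zero:
  assumes z: "z \<in> lie_center (L_alg \<alpha>)" and V: "irreducible_rep V" and B: "invariant_form \<alpha> V B"
    and plane: "\<not> (rep_dim V = 2 \<and> transpose_mat B = B)"
  shows "rep_extend V z = 0\<^sub>m (rep_dim V) (rep_dim V)"
proof -
  let ?n = "rep_dim V"
  note rV = irreducible_repD(1)[OF V] and n0 = irreducible_repD(2)[OF V]
  have Bc: "B \<in> carrier_mat ?n ?n" "invertible_mat B" using B by (auto simp: invariant_form_def)
  then obtain Q where Q: "Q \<in> carrier_mat ?n ?n" "B * Q = 1\<^sub>m ?n" "Q * B = 1\<^sub>m ?n" by (metis invertible_matE)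
  obtain \<epsilon> where eps: "\<epsilon> = 1 \<or> \<epsilon> = -1" "transpose_mat B = \<epsilon> \<cdot>\<^sub>m B"
    using invariant_form_symmetric_or_skew[OF V B] .
  define x where "x = rep_extend V z"
  have x: "x \<in> carrier_mat ?n ?n" "transpose_mat x \<in> carrier_mat ?n ?n" by (simp_all add: x_def)
  have "x \<in> osp_form ?n B"
    unfolding x_def osp_form_rep_extend_iff[OF rV B]
    using lie_center_L_algD(1)[OF z] by (simp add: L_alg_iff)
  then have osp: "transpose_mat x * B + B * x = 0\<^sub>m ?n ?n"
    using osp_form_iff[OF Bc(1)] by simp
  have eq: "(if j = q then x $$ (i, p) else 0) - \<epsilon> * (if j = p then x $$ (i, q) else 0)
        + (if i = p then x $$ (j, q) else 0) - \<epsilon> * (if i = q then x $$ (j, p) else 0) = 0"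
    if i: "i < ?n" and j: "j < ?n" and p: "p < ?n" and q: "q < ?n" for i j p q
  proof -
    define F :: "'k mat" where "F = mat ?n ?n (\<lambda>(i, j). if i = p \<and> j = q then 1 else 0)"
    define D where "D = F - \<epsilon> \<cdot>\<^sub>m transpose_mat F"
    have F: "F \<in> carrier_mat ?n ?n" "transpose_mat F \<in> carrier_mat ?n ?n" by (simp_all add: F_def)
    have D: "D \<in> carrier_mat ?n ?n" using F by (simp add: D_def minus_carrier_mat)
    have Bt: "transpose_mat B \<in> carrier_mat ?n ?n" "transpose_mat Q \<in> carrier_mat ?n ?n" using Bc Q by auto
    \<comment> \<open>On \<open>V\<close>, the element \<open>twisted_inv a\<close> acts by
      \<open>\<epsilon> F\<^sup>T * B\<close>, as the form carries \<open>F * B\<close> to the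
      twisted dual; antisymmetrizing \<open>a\<close> therefore yields \<open>D * B\<close>.\<close>
    define a where "a = block_elem V (F * B)"
    have Va: "rep_extend V a = F * B"
      unfolding a_def using F Bc by (intro rep_extend_block_elem[OF V]) auto
    define y where "y = rep_extend (twisted_dual \<alpha> V) a"
    have y: "y \<in> carrier_mat ?n ?n" "transpose_mat y \<in> carrier_mat ?n ?n"
      using rep_extend_carrier[of "twisted_dual \<alpha> V" a] rV by (simp_all add: y_def)
    have "B * (F * B) = y * B"
      unfolding y_def Va[symmetric]
      by (rule rep_extend_intertwine)
        (use Bc rV representation_twisted_dual[OF rV] invariant_form_intertwines[OF rV B] in auto)
    then have "transpose_mat (B * (F * B)) = transpose_mat (y * B)" by simp
    then have tt: "transpose_mat B * transpose_mat F * transpose_mat B = transpose_mat B * transpose_mat y"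
      using transpose_mult[OF Bc(1) mult_carrier_mat[OF F(1) Bc(1)]] transpose_mult[OF F(1) Bc(1)] transpose_mult[OF y(1) Bc(1)]
      by simp
    have QB: "transpose_mat Q * transpose_mat B = 1\<^sub>m ?n"
      using transpose_mult[OF Bc(1) Q(1)] Q(2) by simp
    have "transpose_mat y = transpose_mat Q * (transpose_mat B * transpose_mat y)"
      using assoc_mult_mat[OF Bt(2) Bt(1) y(2)] QB y by simp
    also have "\<dots> = transpose_mat Q * (transpose_mat B * (transpose_mat F * transpose_mat B))"
      unfolding tt[symmetric] assoc_mult_mat[OF Bt(1) F(2) Bt(1)] ..
    also have "\<dots> = transpose_mat F * transpose_mat B"
      unfolding assoc_mult_mat[OF Bt(2) Bt(1) mult_carrier_mat[OF F(2) Bt(1)], symmetric] QB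
      by (rule left_mult_one_mat[OF mult_carrier_mat[OF F(2) Bt(1)]])
    also have "\<dots> = \<epsilon> \<cdot>\<^sub>m transpose_mat F * B"
      unfolding eps(2) mult_smult_distrib[OF F(2) Bc(1)] mult_smult_assoc_mat[OF F(2) Bc(1)] ..
    finally have "rep_extend V (a - twisted_inv a) = F * B - \<epsilon> \<cdot>\<^sub>m transpose_mat F * B"
      by (simp add: rep_extend_minus rep_extend_twisted_inv[OF rV] Va y_def)
    also have "\<dots> = D * B"
      unfolding D_def by (rule minus_mult_distrib_mat[OF F(1) _ Bc(1), symmetric]) (use F in simp)
    finally have Vb: "rep_extend V (a - twisted_inv a) = D * B" .
    have "z * (a - twisted_inv a) = (a - twisted_inv a) * z"
      by (rule lie_center_L_algD(2)[OF z L_alg_commutator])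
    then have "x * (D * B) = D * B * x"
      unfolding x_def Vb[symmetric] by (metis rep_extend_mult[OF rV])
    also have "\<dots> = D * (B * x)" by (rule assoc_mult_mat[OF D Bc(1) x(1)])
    also have "B * x = - (transpose_mat x * B)"
      using osp mat_add_eq_zero_iff[of "transpose_mat x * B" ?n ?n "B * x"] x Bc by simp
    finally have "x * D * B = - (D * transpose_mat x * B)"
      using assoc_mult_mat[OF x(1) D Bc(1)] assoc_mult_mat[OF D x(2) Bc(1)] D x Bc by simp
    then have "D * transpose_mat x * B + x * D * B = 0\<^sub>m ?n ?n"
      using D x Bc by (intro iffD2[OF mat_add_eq_zero_iff]) auto
    then have "(D * transpose_mat x + x * D) * B = 0\<^sub>m ?n ?n"
      using add_mult_distrib_mat[OF mult_carrier_mat[OF D x(2)] mult_carrier_mat[OF x(1) D] Bc(1)] by simp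
    then have 0: "D * transpose_mat x + x * D = 0\<^sub>m ?n ?n"
      by (rule mult_right_cancel_invertible[rotated 3, OF _ _ Bc]) (use D x in simp)
    have Dij: "D $$ (k, l) = (if k = p \<and> l = q then 1 else 0) - \<epsilon> * (if l = p \<and> k = q then 1 else 0)"
      if "k < ?n" "l < ?n" for k l
      using that by (simp add: D_def F_def)
    have "(x * D) $$ (i, j) = (\<Sum>k<?n. x $$ (i, k) * D $$ (k, j))"
      by (rule mult_mat_index[OF x(1) D i j])
    also have "\<dots> = (\<Sum>k<?n. if k = p then (if j = q then x $$ (i, k) else 0) else 0)
        - \<epsilon> * (\<Sum>k<?n. if k = q then (if j = p then x $$ (i, k) else 0) else 0)"
      unfolding sum_distrib_left sum_subtractf[symmetric]
      by (rule sum.cong[OF refl]) (auto simp: Dij j algebra_simps)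
    also have "\<dots> = (if j = q then x $$ (i, p) else 0) - \<epsilon> * (if j = p then x $$ (i, q) else 0)"
      using p q by simp
    finally have 1: "(x * D) $$ (i, j) = (if j = q then x $$ (i, p) else 0) - \<epsilon> * (if j = p then x $$ (i, q) else 0)" .
    have "(D * transpose_mat x) $$ (i, j) = (\<Sum>k<?n. D $$ (i, k) * transpose_mat x $$ (k, j))"
      by (rule mult_mat_index[OF D x(2) i j])
    also have "\<dots> = (\<Sum>k<?n. if k = q then (if i = p then x $$ (j, k) else 0) else 0)
        - \<epsilon> * (\<Sum>k<?n. if k = p then (if i = q then x $$ (j, k) else 0) else 0)"
      unfolding sum_distrib_left sum_subtractf[symmetric]
      using x(1) by (intro sum.cong[OF refl]) (auto simp: Dij i j algebra_simps)
    also have "\<dots> = (if i = p then x $$ (j, q) else 0) - \<epsilon> * (if i = q then x $$ (j, p) else 0)"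
      using p q by simp
    finally have 2: "(D * transpose_mat x) $$ (i, j) = (if i = p then x $$ (j, q) else 0) - \<epsilon> * (if i = q then x $$ (j, p) else 0)" .
    have "(D * transpose_mat x) $$ (i, j) + (x * D) $$ (i, j) = 0"
      using arg_cong[OF 0, of "\<lambda>M. M $$ (i, j)"] i j D x by (simp del: index_mult_mat(1))
    then show ?thesis unfolding 1 2 by (simp add: algebra_simps)
  qed
  show ?thesis
  proof (cases "\<epsilon> = 1 \<and> ?n = 1")
    case True
    \<comment> \<open>An orthogonal line: \<open>so(1)\<close> is zero, and \<open>x\<close>
      vanishes already by its own skew-adjointness. This dimension lies outside the symmetric case
      of \<open>centralizer_entries_zero\<close>.\<close>
    have "B $$ (0, 0) * Q $$ (0, 0) = 1"
      using arg_cong[OF Q(2), of "\<lambda>M. M $$ (0, 0)"] mult_mat_index[OF Bc(1) Q(1), of 0 0] True by simp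
    then have b0: "B $$ (0, 0) \<noteq> 0" by auto
    have "(transpose_mat x * B) $$ (0, 0) = x $$ (0, 0) * B $$ (0, 0)"
      "(B * x) $$ (0, 0) = B $$ (0, 0) * x $$ (0, 0)"
      using mult_mat_index[OF x(2) Bc(1), of 0 0] mult_mat_index[OF Bc(1) x(1), of 0 0] True x(1) by simp_all
    moreover have "(transpose_mat x * B) $$ (0, 0) + (B * x) $$ (0, 0) = 0"
      using arg_cong[OF osp, of "\<lambda>M. M $$ (0, 0)"] True x Bc by (simp del: index_mult_mat(1))
    ultimately have "2 * (x $$ (0, 0) * B $$ (0, 0)) = 0" by (simp only: mult_2 mult.commute)
    then have "x $$ (0, 0) = 0" using b0 by simp
    then show ?thesis using True x(1) unfolding x_def[symmetric] by (intro eq_matI) auto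
  next
    case False
    then have "\<epsilon> = -1 \<or> \<epsilon> = 1 \<and> ?n \<ge> 3"
      using eps plane n0 by (cases "\<epsilon> = 1") (auto simp: eps(2))
    then have "x $$ (i, p) = 0" if "i < ?n" "p < ?n" for i p
      using centralizer_entries_zero[where n = ?n and x = "\<lambda>i p. x $$ (i, p)" and \<epsilon> = \<epsilon>, OF eq] that by blast
    then show ?thesis using x(1) unfolding x_def[symmetric] by (intro eq_matI) auto
  qed
qed

end

section \<open>Conjugacy classes and the center of the group algebra\<close>

lemma conj_class_iff:
  fixes c :: "'g::group_add set"
  assumes c: "c \<in> conj_classes"
  shows "h + k + - h \<in> c \<longleftrightarrow> k \<in> c"
proof -
  obtain g where g: "c = {h + g + (- h) | h. True}" using c by (auto simp: conj_classes_def)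
  have closed: "h + k + - h \<in> c" if kc: "k \<in> c" for h k
  proof -
    obtain m where "k = m + g + - m" using kc g by blast
    then have "h + k + - h = (h + m) + g + - (h + m)" by (simp add: minus_add add.assoc del: add_uminus_conv_diff)
    then show ?thesis unfolding g by blast
  qed
  show ?thesis
  proof
    assume "h + k + - h \<in> c"
    from closed[OF this, of "- h"] show "k \<in> c" by (simp add: add.assoc del: add_uminus_conv_diff)
  qed (rule closed)
qed

lemma conj_class_uminus:
  fixes c :: "'g::group_add set"
  assumes "c \<in> conj_classes"
  shows "uminus ` c \<in> conj_classes"
proof -
  obtain g where g: "c = {h + g + (- h) | h. True}" using assms by (auto simp: conj_classes_def)
  have "uminus ` c = {h + - g + (- h) | h. True}"
    unfolding g by (auto simp: image_iff minus_add add.assoc simp del: add_uminus_conv_diff)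
      (metis add.assoc minus_add minus_minus)
  then show ?thesis unfolding conj_classes_def by blast
qed

lemma conj_class_of: "\<exists>!c. c \<in> conj_classes \<and> (g :: 'g::group_add) \<in> c"
proof (rule ex1I)
  have "g = 0 + g + - 0" by simp
  then show "{h + g + (- h) | h. True} \<in> conj_classes \<and> g \<in> {h + g + (- h) | h. True}"
    unfolding conj_classes_def by blast
  fix c assume c: "c \<in> conj_classes \<and> g \<in> c"
  then obtain k where k: "c = {h + k + (- h) | h. True}" unfolding conj_classes_def by blast
  show "c = {h + g + (- h) | h. True}"
  proof
    show "{h + g + (- h) | h. True} \<subseteq> c" using c conj_class_iff[of c _ g] by blast
    obtain m where m: "g = m + k + - m" using c k by blast
    have k': "k = - m + g + m" by (simp add: m add.assoc del: add_uminus_conv_diff)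
    have "h + k + - h = (h + - m) + g + - (h + - m)" for h
      by (simp add: k' minus_add add.assoc del: add_uminus_conv_diff)
    then show "c \<subseteq> {h + g + (- h) | h. True}" unfolding k by blast
  qed
qed

lemma lookup_class_sum:
  fixes c :: "'g::{finite, group_add} set"
  shows "Poly_Mapping.lookup (class_sum c :: ('g, 'k::field) group_algebra) g = (if g \<in> c then 1 else 0)"
  by (simp add: class_sum_def lookup_sum lookup_basis_elem)

lemma class_sum_central:
  fixes c :: "'g::{finite, group_add} set" and a :: "('g, 'k::field) group_algebra"
  assumes c: "c \<in> conj_classes"
  shows "class_sum c * a = a * class_sum c"
proof (induction a rule: ga_induct)
  case (basis x g)
  have "class_sum c * basis_elem g = (basis_elem g * class_sum c :: ('g, 'k) group_algebra)"
  proof (rule poly_mapping_eqI)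
    fix h
    have "h - g = g + (- g + h) + - g" by (simp add: add.assoc[symmetric])
    then have "h - g \<in> c \<longleftrightarrow> - g + h \<in> c" using conj_class_iff[OF c, of g "- g + h"] by simp
    then show "Poly_Mapping.lookup (class_sum c * basis_elem g :: ('g, 'k) group_algebra) h
      = Poly_Mapping.lookup (basis_elem g * class_sum c) h"
      by (simp add: lookup_basis_times lookup_times_basis lookup_class_sum)
  qed
  then show ?case by (simp add: ga_scale_times_left ga_scale_times_right)
qed (simp add: distrib_left distrib_right)

lemma central_class_expansion:
  fixes z :: "('g::{finite, group_add}, 'k::field) group_algebra"
  assumes central: "\<And>a. z * a = a * z"
  obtains f where "z = (\<Sum>c\<in>conj_classes. ga_scale (f c) (class_sum c))"
proof -
  have inv: "Poly_Mapping.lookup z (h + g + - h) = Poly_Mapping.lookup z g" for g h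
  proof -
    have "Poly_Mapping.lookup (z * basis_elem h) (h + g) = Poly_Mapping.lookup (basis_elem h * z) (h + g)"
      by (simp only: central)
    then show ?thesis
      by (simp add: lookup_basis_times lookup_times_basis add.assoc[symmetric])
  qed
  define f where "f c = Poly_Mapping.lookup z (SOME g. g \<in> c)" for c
  have f: "f c = Poly_Mapping.lookup z g" if c: "c \<in> conj_classes" "g \<in> c" for c g
  proof -
    obtain k where k: "c = {h + k + (- h) | h. True}" using c unfolding conj_classes_def by blast
    have lookup_k: "Poly_Mapping.lookup z x = Poly_Mapping.lookup z k" if "x \<in> c" for x
      using that inv by (auto simp only: k mem_Collect_eq)
    have "(SOME g. g \<in> c) \<in> c" using c(2) by (rule someI)
    then show ?thesis unfolding f_def using lookup_k c(2) by metis
  qed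
  have "z = (\<Sum>c\<in>conj_classes. ga_scale (f c) (class_sum c))"
  proof (rule poly_mapping_eqI)
    fix g :: 'g
    obtain c0 where c0: "c0 \<in> conj_classes" "g \<in> c0" and uniq: "\<And>c. c \<in> conj_classes \<Longrightarrow> g \<in> c \<Longrightarrow> c = c0"
      using conj_class_of[of g] by blast
    have "Poly_Mapping.lookup (\<Sum>c\<in>conj_classes. ga_scale (f c) (class_sum c)) g
      = (\<Sum>c\<in>conj_classes. if c = c0 then f c0 else 0)"
      unfolding lookup_sum lookup_ga_scale lookup_class_sum
    proof (rule sum.cong[OF refl])
      fix c :: "'g set" assume c: "c \<in> conj_classes"
      show "f c * (if g \<in> c then 1 else 0) = (if c = c0 then f c0 else 0)"
      proof (cases "c = c0")
        case True
        with c0(2) show ?thesis by simp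
      next
        case False
        with uniq[OF c] have "g \<notin> c" by blast
        with False show ?thesis by simp
      qed
    qed
    also have "\<dots> = Poly_Mapping.lookup z g" using c0 f by simp
    finally show "Poly_Mapping.lookup z g = Poly_Mapping.lookup (\<Sum>c\<in>conj_classes. ga_scale (f c) (class_sum c)) g" ..
  qed
  then show ?thesis by (rule that)
qed

context twisted_group_algebra
begin

lemma alpha_conj: "\<alpha> (h + g + - h) = \<alpha> g"
  by (simp only: alpha_add) (metis alpha_uminus_mult(2) mult.commute mult.left_commute mult.right_neutral)

lemma class_value_eq: "c \<in> conj_classes \<Longrightarrow> g \<in> c \<Longrightarrow> class_value \<alpha> c = \<alpha> g"
proof -
  assume c: "c \<in> conj_classes" and g: "g \<in> c"
  then obtain k where k: "c = {h + k + (- h) | h. True}" unfolding conj_classes_def by blast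
  then have "\<alpha> x = \<alpha> k" if "x \<in> c" for x using that by (auto simp only: mem_Collect_eq alpha_conj)
  then have "\<alpha> ` c = {\<alpha> g}" using g by auto
  then show ?thesis by (simp add: class_value_def)
qed

lemma twisted_inv_class_sum:
  assumes c: "c \<in> conj_classes"
  shows "twisted_inv (class_sum c) = ga_scale (class_value \<alpha> c) (class_sum (uminus ` c))"
proof (rule poly_mapping_eqI)
  fix g
  have "- g \<in> c \<longleftrightarrow> g \<in> uminus ` c" by (metis image_iff minus_minus)
  then show "Poly_Mapping.lookup (twisted_inv (class_sum c)) g
    = Poly_Mapping.lookup (ga_scale (class_value \<alpha> c) (class_sum (uminus ` c))) g"
    using class_value_eq[OF c, of "- g"] by (auto simp: lookup_class_sum)
qed

lemma subspace_lie_center: "ga.subspace (lie_center (L_alg \<alpha>))"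
  using subspace_L_alg
  by (auto simp: ga.subspace_def lie_center_def lie_bracket_def distrib_left distrib_right
      ga_scale_times_left ga_scale_times_right)

lemma class_elements_subset_center: "class_elements \<alpha> \<subseteq> lie_center (L_alg \<alpha>)"
proof
  fix x assume "x \<in> class_elements \<alpha>"
  then obtain c where c: "c \<in> conj_classes"
    and x: "x = class_sum c - ga_scale (class_value \<alpha> c) (class_sum (uminus ` c))"
    by (auto simp: class_elements_def)
  have "x \<in> L_alg \<alpha>"
    unfolding x twisted_inv_class_sum[OF c, symmetric] by (rule L_alg_commutator)
  moreover have "x * a = a * x" for a
    unfolding x using class_sum_central[OF c, of a] class_sum_central[OF conj_class_uminus[OF c], of a]
    by (simp add: left_diff_distrib right_diff_distrib ga_scale_times_left ga_scale_times_right)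
  ultimately show "x \<in> lie_center (L_alg \<alpha>)" by (simp add: lie_center_def lie_bracket_def)
qed

text \<open>By \<open>z + z = z - twisted_inv z\<close>, each class sum in the expansion of
  \<open>z\<close> gets antisymmetrized. The classes left out of
  \<open>class_elements \<alpha>\<close> are those equal to their inverse with character value 1,
  whose antisymmetrization is zero.\<close>

lemma central_L_alg_in_span:
  assumes central: "\<And>a. z * a = a * z" and z: "z \<in> L_alg \<alpha>"
  shows "z \<in> ga.span (class_elements \<alpha>)"
proof -
  obtain f where f: "z = (\<Sum>c\<in>conj_classes. ga_scale (f c) (class_sum c))"
    using central_class_expansion[OF central] by blast
  have "z + z = z - twisted_inv z" using z by (simp add: L_alg_iff')
  also have "\<dots> = (\<Sum>c\<in>conj_classes. ga_scale (f c) (class_sum c))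
      - twisted_inv (\<Sum>c\<in>conj_classes. ga_scale (f c) (class_sum c))"
    by (simp only: f[symmetric])
  also have "\<dots> = (\<Sum>c\<in>conj_classes. ga_scale (f c) (class_sum c - twisted_inv (class_sum c)))"
    by (simp only: twisted_inv_sum twisted_inv_scale sum_subtractf[symmetric] ga.scale_right_diff_distrib)
  also have "\<dots> \<in> ga.span (class_elements \<alpha>)"
  proof (intro ga.span_sum ga.span_scale)
    fix c :: "'g set" assume c: "c \<in> conj_classes"
    show "class_sum c - twisted_inv (class_sum c) \<in> ga.span (class_elements \<alpha>)"
    proof (cases "class_value \<alpha> c \<noteq> 1 \<or> class_value \<alpha> c = 1 \<and> c \<noteq> uminus ` c")
      case True
      then show ?thesis
        unfolding twisted_inv_class_sum[OF c] class_elements_def using c by (intro ga.span_base) blast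
    next
      case False
      then have "class_sum c - twisted_inv (class_sum c) = (0 :: ('g, 'k) group_algebra)"
        unfolding twisted_inv_class_sum[OF c] by (metis ga.scale_one diff_self)
      then show ?thesis by (simp only: ga.span_zero)
    qed
  qed
  finally have "ga_scale (1 / 2) (z + z) \<in> ga.span (class_elements \<alpha>)"
    by (rule ga.span_scale)
  moreover have "ga_scale (1 / 2) (z + z) = z"
    by (rule poly_mapping_eqI) (simp add: lookup_add)
  ultimately show ?thesis by simp
qed

text \<open>On the block of \<open>V\<close> all of \<open>L_alg \<alpha>\<close> acts by
  skew-adjoint matrices, which commute in the plane; on the other blocks an element of
  \<open>osp_alg \<alpha> V\<close> acts by 0.\<close>

lemma orthogonal_plane_in_center:
  assumes V: "V \<in> orthogonal_planes \<alpha>"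
  shows "osp_alg \<alpha> V \<subseteq> lie_center (L_alg \<alpha>)"
proof
  from V obtain B where irr: "irreducible_rep V" and n: "rep_dim V = 2" and B: "invariant_form \<alpha> V B"
    and sym: "transpose_mat B = B" by (auto simp: orthogonal_planes_def)
  note rV = irreducible_repD(1)[OF irr]
  have Bc: "B \<in> carrier_mat 2 2" "invertible_mat B" using B n by (auto simp: invariant_form_def)
  have iso: "rep_iso V (twisted_dual \<alpha> V)" using B invariant_form_exists_iff[OF rV] by blast
  fix a assume "a \<in> osp_alg \<alpha> V"
  then have a: "a \<in> L_alg \<alpha>" "a \<in> blocks {V}"
    unfolding osp_alg_eq[OF irr iso] blocks_twisted_dual_iso[OF irr iso] by auto
  have osp: "rep_extend V x \<in> osp_form 2 B" if "x \<in> L_alg \<alpha>" for x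
    using osp_form_rep_extend_iff[OF rV B, of x] that by (simp add: L_alg_iff n)
  have "a * b - b * a = 0" if b: "b \<in> L_alg \<alpha>" for b
  proof (rule rep_extend_faithful)
    fix W :: "'g \<Rightarrow> 'k mat" assume W: "irreducible_rep W"
    note rW = irreducible_repD(1)[OF W]
    show "rep_extend W (a * b - b * a) = 0\<^sub>m (rep_dim W) (rep_dim W)"
    proof (cases "rep_iso W V")
      case True
      have "rep_extend V (a * b - b * a) = 0\<^sub>m (rep_dim V) (rep_dim V)"
        using skew_adjoint_2x2_commute[OF Bc sym osp[OF a(1)] osp[OF b]]
        by (auto simp: rep_extend_minus rep_extend_mult[OF rV] intro!: eq_matI)
      with True show ?thesis by (rule rep_extend_iso_zero[OF _ rW rV])
    next
      case False
      then have "rep_extend W a = 0\<^sub>m (rep_dim W) (rep_dim W)" using a(2) W by (simp add: blocks_def)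
      then show ?thesis by (rule rep_extend_commutator_zero[OF rW])
    qed
  qed
  then show "a \<in> lie_center (L_alg \<alpha>)"
    using a(1) by (simp add: lie_center_def lie_bracket_def)
qed

text \<open>Unless \<open>V\<close> is an orthogonal plane, the bracket of \<open>z\<close> with
  every element of the group algebra, and not only of \<open>L_alg \<alpha>\<close>, acts by 0 on
  \<open>V\<close> and its twisted dual. The component is therefore central in the group algebra,
  and \<open>central_L_alg_in_span\<close> applies.\<close>

lemma block_component_center:
  assumes z: "z \<in> lie_center (L_alg \<alpha>)" and V: "irreducible_rep V"
  shows "block_component (block_idem V) z
    \<in> ga.span (class_elements \<alpha> \<union> (\<Union>V \<in> orthogonal_planes \<alpha>. osp_alg \<alpha> V))"
proof -
  note rV = irreducible_repD(1)[OF V] and V' = irreducible_twisted_dual[OF V]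
  note rV' = irreducible_repD(1)[OF V']
  let ?z = "block_component (block_idem V) z"
  have L: "?z \<in> L_alg \<alpha> \<inter> blocks {V, twisted_dual \<alpha> V}"
    by (rule block_component_L_alg[OF V lie_center_L_algD(1)[OF z]])
  show ?thesis
  proof (cases "V \<in> orthogonal_planes \<alpha>")
    case True
    then have "rep_iso V (twisted_dual \<alpha> V)"
      using invariant_form_exists_iff[OF rV] by (auto simp: orthogonal_planes_def)
    then have "?z \<in> osp_alg \<alpha> V" using L osp_alg_eq[OF V] by blast
    then show ?thesis using True by (intro ga.span_base) blast
  next
    case False
    have comm: "rep_extend V (z * a - a * z) = 0\<^sub>m (rep_dim V) (rep_dim V)
      \<and> rep_extend (twisted_dual \<alpha> V) (z * a - a * z) = 0\<^sub>m (rep_dim V) (rep_dim V)" for a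
    proof (cases "rep_iso V (twisted_dual \<alpha> V)")
      case True
      then obtain B where B: "invariant_form \<alpha> V B" using invariant_form_exists_iff[OF rV] by blast
      then have "\<not> (rep_dim V = 2 \<and> transpose_mat B = B)" using False V by (auto simp: orthogonal_planes_def)
      then have 0: "rep_extend V z = 0\<^sub>m (rep_dim V) (rep_dim V)" by (rule rep_extend_center_zero[OF z V B])
      have *: "rep_extend V (z * a - a * z) = 0\<^sub>m (rep_dim V) (rep_dim V)"
        by (rule rep_extend_commutator_zero[OF rV 0])
      have "rep_iso (twisted_dual \<alpha> V) V" using True rep_iso_irreducible_sym[OF V V'] by simp
      from rep_extend_iso_zero[OF this rV' rV *] * show ?thesis using rV by simp
    next
      case False
      then have "\<not> rep_iso (twisted_dual \<alpha> V) (twisted_dual \<alpha> (twisted_dual \<alpha> V))"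
        using rep_iso_irreducible_sym[OF V V'] twisted_dual_twisted_dual[OF rV] by simp
      then show ?thesis
        using rep_extend_center_commute[OF z V False] rep_extend_center_commute[OF z V'] rV by simp
    qed
    have "?z * a - a * ?z = 0" for a
    proof (rule rep_extend_faithful)
      fix W :: "'g \<Rightarrow> 'k mat" assume W: "irreducible_rep W"
      note rW = irreducible_repD(1)[OF W]
      let ?f = "block_idem V + twisted_inv (block_idem V)"
      have eq: "?z * a - a * ?z = ga_scale (1 / 2) (?f * (z * a - a * z))"
      proof -
        have "a * (?f * z) = ?f * (a * z)"
          using twisted_inv_block_idem_central[OF V, of a] by (simp only: mult.assoc[symmetric])
        then show ?thesis
          by (simp add: block_component_def ga_scale_times_left ga_scale_times_right mult.assoc
              ga.scale_right_diff_distrib right_diff_distrib)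
      qed
      show "rep_extend W (?z * a - a * ?z) = 0\<^sub>m (rep_dim W) (rep_dim W)"
      proof (cases "rep_iso W V \<or> rep_iso W (twisted_dual \<alpha> V)")
        case True
        then have "rep_extend W (z * a - a * z) = 0\<^sub>m (rep_dim W) (rep_dim W)"
          using rep_extend_iso_zero[OF _ rW rV, of "z * a - a * z"]
            rep_extend_iso_zero[OF _ rW rV', of "z * a - a * z"] comm[of a] rV by auto
        then show ?thesis
          unfolding eq rep_extend_scale rep_extend_mult[OF rW]
          using right_mult_zero_mat[OF rep_extend_carrier[of W ?f]] by simp
      next
        case False
        then have 0: "rep_extend W ?z = 0\<^sub>m (rep_dim W) (rep_dim W)"
          using L W by (auto simp: blocks_def)
        show ?thesis by (rule rep_extend_commutator_zero[OF rW 0])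
      qed
    qed
    then have "?z \<in> ga.span (class_elements \<alpha>)"
      using L by (intro central_L_alg_in_span) auto
    then show ?thesis using ga.span_mono[of "class_elements \<alpha>"] by blast
  qed
qed

lemma lie_center_L_alg:
  "lie_center (L_alg \<alpha>) = ga.span (class_elements \<alpha> \<union> (\<Union>V \<in> orthogonal_planes \<alpha>. osp_alg \<alpha> V))"
proof
  show "ga.span (class_elements \<alpha> \<union> (\<Union>V \<in> orthogonal_planes \<alpha>. osp_alg \<alpha> V)) \<subseteq> lie_center (L_alg \<alpha>)"
    using class_elements_subset_center orthogonal_plane_in_center
    by (intro ga.span_minimal subspace_lie_center) blast
  show "lie_center (L_alg \<alpha>) \<subseteq> ga.span (class_elements \<alpha> \<union> (\<Union>V \<in> orthogonal_planes \<alpha>. osp_alg \<alpha> V))"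
  proof
    fix z assume z: "z \<in> lie_center (L_alg \<alpha>)"
    have "(\<Sum>e\<in>block_idems. block_component e z)
      \<in> ga.span (class_elements \<alpha> \<union> (\<Union>V \<in> orthogonal_planes \<alpha>. osp_alg \<alpha> V))"
      using block_component_center[OF z] by (intro ga.span_sum) (auto simp: block_idems_def)
    then show "z \<in> ga.span (class_elements \<alpha> \<union> (\<Union>V \<in> orthogonal_planes \<alpha>. osp_alg \<alpha> V))"
      by (simp add: sum_block_component)
  qed
qed

end

section \<open>Reductivity\<close>

type_synonym 'n rat_matrix = "('n \<times> 'n) \<Rightarrow>\<^sub>0 rat"

text \<open>Used for vectors and for matrices alike; on matrices, indexed by pairs, it is the trace
  form \<open>tr (x y\<^sup>T)\<close>.\<close>

definition rm_inner :: "('m::finite \<Rightarrow>\<^sub>0 rat) \<Rightarrow> ('m \<Rightarrow>\<^sub>0 rat) \<Rightarrow> rat" where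
  "rm_inner x y = (\<Sum>p\<in>UNIV. Poly_Mapping.lookup x p * Poly_Mapping.lookup y p)"

lemma rm_inner_diff: "rm_inner (x - y) z = rm_inner x z - rm_inner y z"
  by (simp add: rm_inner_def lookup_minus left_diff_distrib sum_subtractf)

lemma rm_inner_scale: "rm_inner (ga_scale c x) y = c * rm_inner x y"
  by (simp add: rm_inner_def sum_distrib_left mult.assoc)

lemma rm_inner_sum: "rm_inner (sum f A) y = (\<Sum>i\<in>A. rm_inner (f i) y)"
  by (simp add: rm_inner_def lookup_sum sum_distrib_right) (rule sum.swap)

lemma rm_inner_commute: "rm_inner x y = rm_inner y x"
  by (simp add: rm_inner_def mult.commute)

lemma rm_inner_nonneg: "rm_inner x x \<ge> 0"
  by (auto simp: rm_inner_def intro!: sum_nonneg)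

lemma rm_inner_eq_0_iff: "rm_inner x x = 0 \<longleftrightarrow> x = 0"
proof
  assume "rm_inner x x = 0"
  then have "\<forall>p\<in>UNIV. Poly_Mapping.lookup x p * Poly_Mapping.lookup x p = 0"
    unfolding rm_inner_def by (subst (asm) sum_nonneg_eq_0_iff) auto
  then show "x = 0" by (intro poly_mapping_eqI) simp
qed (simp add: rm_inner_def)

text \<open>A maximal orthogonal set of nonzero vectors in \<open>E\<close> works: what remains of
  \<open>x\<close> after projection is orthogonal to the set and, if nonzero, would enlarge it.
  Normalizing would require square roots of rationals, hence the quotients by
  \<open>rm_inner b b\<close> here and in the averages.\<close>

lemma orthogonal_basis_exists:
  fixes E :: "('m::finite \<Rightarrow>\<^sub>0 rat) set"
  assumes E: "ga.subspace E"
  obtains B where "finite B" "B \<subseteq> E" "\<And>b. b \<in> B \<Longrightarrow> rm_inner b b > 0"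
    "\<And>x. x \<in> E \<Longrightarrow> x = (\<Sum>b\<in>B. ga_scale (rm_inner x b / rm_inner b b) b)"
proof -
  define P where "P B \<longleftrightarrow> finite B \<and> B \<subseteq> E \<and> 0 \<notin> B \<and>
    (\<forall>b\<in>B. \<forall>b'\<in>B. b \<noteq> b' \<longrightarrow> rm_inner b b' = 0)" for B
  have indep: "ga.independent B" if B: "P B" for B
  proof (rule ga.independent_if_scalars_zero)
    show "finite B" using B by (simp add: P_def)
    fix u v assume 0: "(\<Sum>b\<in>B. ga_scale (u b) b) = 0" and v: "v \<in> B"
    have "0 = rm_inner (\<Sum>b\<in>B. ga_scale (u b) b) v" by (simp add: 0 rm_inner_def)
    also have "\<dots> = (\<Sum>b\<in>B. if b = v then u v * rm_inner v v else 0)"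
      unfolding rm_inner_sum rm_inner_scale using B v by (intro sum.cong refl) (auto simp: P_def)
    also have "\<dots> = u v * rm_inner v v" using B v by (simp add: P_def)
    finally show "u v = 0" using B v rm_inner_eq_0_iff[of v] by (auto simp: P_def)
  qed
  define N where "N = card (range basis_elem :: ('m \<Rightarrow>\<^sub>0 rat) set)"
  have bound: "card B \<le> N" if "P B" for B
    using ga.independent_span_bound[OF _ indep[OF that], of "range basis_elem"]
    by (simp add: ga_span_basis N_def)
  have "P {}" by (simp add: P_def)
  moreover have "\<forall>B. P B \<longrightarrow> card B < Suc N" using bound by (simp add: less_Suc_eq_le)
  ultimately have "\<exists>B. P B \<and> (\<forall>B'. P B' \<longrightarrow> card B' \<le> card B)"
    by (rule ex_has_greatest_nat)
  then obtain B where B: "P B" and max: "\<And>B'. P B' \<Longrightarrow> card B' \<le> card B" by blast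
  have pos: "rm_inner b b > 0" if "b \<in> B" for b
    using that B rm_inner_nonneg[of b] rm_inner_eq_0_iff[of b] by (auto simp: P_def less_le)
  show ?thesis
  proof
    show "finite B" "B \<subseteq> E" using B by (auto simp: P_def)
    show "rm_inner b b > 0" if "b \<in> B" for b using that by (rule pos)
    fix x assume x: "x \<in> E"
    define y where "y = x - (\<Sum>b\<in>B. ga_scale (rm_inner x b / rm_inner b b) b)"
    have yE: "y \<in> E"
      unfolding y_def using B x E
      by (intro ga.subspace_diff ga.subspace_sum ga.subspace_scale) (auto simp: P_def)
    have orth: "rm_inner y b = 0" if b: "b \<in> B" for b
    proof -
      have "rm_inner y b = rm_inner x b - (\<Sum>b'\<in>B. if b' = b then rm_inner x b else 0)"
        unfolding y_def rm_inner_diff rm_inner_sum rm_inner_scale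
        using B b pos[OF b] by (intro arg_cong2[of _ _ _ _ "(-)"] sum.cong refl) (auto simp: P_def)
      then show ?thesis using B b by (simp add: P_def)
    qed
    have "y = 0"
    proof (rule ccontr)
      assume y: "y \<noteq> 0"
      have orth': "rm_inner b y = 0" if "b \<in> B" for b
        using orth[OF that] by (simp only: rm_inner_commute[of b])
      from y have "y \<notin> B" using orth rm_inner_eq_0_iff by blast
      moreover have "P (insert y B)"
        using B y yE orth orth' unfolding P_def by auto
      ultimately show False using max[of "insert y B"] B by (simp add: P_def)
    qed
    then show "x = (\<Sum>b\<in>B. ga_scale (rm_inner x b / rm_inner b b) b)" by (simp add: y_def)
  qed
qed

text \<open>The matrix is rational while the vector lies over an arbitrary field of characteristic
  0, so that orthogonality can be used for matrices that act over the algebraic closure.\<close>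

definition rm_act :: "'n::finite rat_matrix \<Rightarrow> ('n, 'f::field_char_0) group_algebra \<Rightarrow> ('n, 'f) group_algebra" where
  "rm_act A v = Abs_poly_mapping (\<lambda>i. \<Sum>j\<in>UNIV. of_rat (Poly_Mapping.lookup A (i, j)) * Poly_Mapping.lookup v j)"

definition rm_mult :: "'n::finite rat_matrix \<Rightarrow> 'n rat_matrix \<Rightarrow> 'n rat_matrix" where
  "rm_mult A B = Abs_poly_mapping (\<lambda>(i, j). \<Sum>k\<in>UNIV. Poly_Mapping.lookup A (i, k) * Poly_Mapping.lookup B (k, j))"

definition rm_transpose :: "'n::finite rat_matrix \<Rightarrow> 'n rat_matrix" where
  "rm_transpose A = Abs_poly_mapping (\<lambda>(i, j). Poly_Mapping.lookup A (j, i))"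

definition rm_one :: "'n::finite rat_matrix" where
  "rm_one = Abs_poly_mapping (\<lambda>(i, j). if i = j then 1 else 0)"

definition rm_skew :: "'n::finite rat_matrix \<Rightarrow> bool" where
  "rm_skew A \<longleftrightarrow> (\<forall>i j. Poly_Mapping.lookup A (i, j) = - Poly_Mapping.lookup A (j, i))"

lemma lookup_rm_act [simp]: "Poly_Mapping.lookup (rm_act A v) i
    = (\<Sum>j\<in>UNIV. of_rat (Poly_Mapping.lookup A (i, j)) * Poly_Mapping.lookup v j)"
  by (simp add: rm_act_def)

lemma lookup_rm_mult [simp]: "Poly_Mapping.lookup (rm_mult A B) (i, j)
    = (\<Sum>k\<in>UNIV. Poly_Mapping.lookup A (i, k) * Poly_Mapping.lookup B (k, j))"
  by (simp add: rm_mult_def)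

lemma lookup_rm_transpose [simp]: "Poly_Mapping.lookup (rm_transpose A) (i, j) = Poly_Mapping.lookup A (j, i)"
  by (simp add: rm_transpose_def)

lemma lookup_rm_one [simp]: "Poly_Mapping.lookup rm_one (i, j) = (if i = j then 1 else 0)"
  by (simp add: rm_one_def)

lemma rat_matrix_eqI:
  "(\<And>i j. Poly_Mapping.lookup A (i, j) = Poly_Mapping.lookup B (i, j)) \<Longrightarrow> A = (B :: 'n rat_matrix)"
  by (rule poly_mapping_eqI) (auto split: prod.splits)

lemma rm_act_add_right: "rm_act A (v + w) = rm_act A v + rm_act A w"
  by (rule poly_mapping_eqI) (simp add: lookup_add distrib_left sum.distrib)

lemma rm_act_scale_right: "rm_act A (ga_scale c v) = ga_scale c (rm_act A v)"
  by (rule poly_mapping_eqI) (simp add: sum_distrib_left mult_ac)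

lemma rm_act_zero_right [simp]: "rm_act A 0 = 0"
  by (rule poly_mapping_eqI) simp

lemma rm_act_sum_right: "rm_act A (sum f S) = (\<Sum>i\<in>S. rm_act A (f i))"
  by (induction S rule: infinite_finite_induct) (auto simp: rm_act_add_right)

lemma rm_act_add_left: "rm_act (A + B) v = rm_act A v + rm_act B v"
  by (rule poly_mapping_eqI) (simp add: lookup_add of_rat_add distrib_right sum.distrib)

lemma rm_act_scale_left: "rm_act (ga_scale c A) v = ga_scale (of_rat c) (rm_act A v)"
  by (rule poly_mapping_eqI) (simp add: of_rat_mult sum_distrib_left mult.assoc)

lemma rm_act_zero_left [simp]: "rm_act 0 v = 0"
  by (rule poly_mapping_eqI) simp

lemma rm_act_sum_left: "rm_act (sum f S) v = (\<Sum>i\<in>S. rm_act (f i) v)"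
  by (induction S rule: infinite_finite_induct) (auto simp: rm_act_add_left)

lemma rm_act_mult: "rm_act (rm_mult A B) v = rm_act A (rm_act B v)"
proof (rule poly_mapping_eqI)
  fix i
  let ?l = Poly_Mapping.lookup
  have "?l (rm_act (rm_mult A B) v) i
    = (\<Sum>j\<in>UNIV. \<Sum>k\<in>UNIV. of_rat (?l A (i, k)) * (of_rat (?l B (k, j)) * ?l v j))"
    by (simp add: of_rat_sum of_rat_mult sum_distrib_right mult.assoc)
  also have "\<dots> = (\<Sum>k\<in>UNIV. \<Sum>j\<in>UNIV. of_rat (?l A (i, k)) * (of_rat (?l B (k, j)) * ?l v j))"
    by (rule sum.swap)
  finally show "?l (rm_act (rm_mult A B) v) i = ?l (rm_act A (rm_act B v)) i"
    by (simp add: sum_distrib_left)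
qed

lemma rm_act_one [simp]: "rm_act rm_one v = v"
proof (rule poly_mapping_eqI)
  fix i
  have "(\<Sum>j\<in>UNIV. of_rat (Poly_Mapping.lookup rm_one (i, j)) * Poly_Mapping.lookup v j)
    = (\<Sum>j\<in>UNIV. if j = i then Poly_Mapping.lookup v j else 0)"
    by (intro sum.cong refl) auto
  then show "Poly_Mapping.lookup (rm_act rm_one v) i = Poly_Mapping.lookup v i" by simp
qed

lemma rm_transpose_add: "rm_transpose (A + B) = rm_transpose A + rm_transpose B"
  by (rule rat_matrix_eqI) (simp add: lookup_add)

lemma rm_transpose_scale: "rm_transpose (ga_scale c A) = ga_scale c (rm_transpose A)"
  by (rule rat_matrix_eqI) simp

lemma rm_transpose_zero [simp]: "rm_transpose 0 = 0"
  by (rule rat_matrix_eqI) simp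

lemma rm_transpose_sum: "rm_transpose (sum f S) = (\<Sum>i\<in>S. rm_transpose (f i))"
  by (induction S rule: infinite_finite_induct) (auto simp: rm_transpose_add)

lemma rm_transpose_one [simp]: "rm_transpose rm_one = rm_one"
  by (rule rat_matrix_eqI) auto

lemma rm_transpose_mult_skew:
  assumes "rm_skew A"
  shows "rm_transpose (rm_mult A B) = ga_scale (-1) (rm_mult (rm_transpose B) A)"
proof (rule rat_matrix_eqI)
  fix i j
  have "Poly_Mapping.lookup A (j, k) = - Poly_Mapping.lookup A (k, j)" for k
    using assms unfolding rm_skew_def by blast
  then show "Poly_Mapping.lookup (rm_transpose (rm_mult A B)) (i, j)
    = Poly_Mapping.lookup (ga_scale (-1) (rm_mult (rm_transpose B) A)) (i, j)"
    by (simp add: sum_negf[symmetric] mult.commute)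
qed

text \<open>For the trace form, left multiplication by \<open>A\<close> has left multiplication by
  the transpose as its adjoint. This skewness is what lets \<open>A\<close> cross the averaged
  projection.\<close>

lemma rm_inner_mult_skew:
  fixes A B C :: "'n::finite rat_matrix"
  assumes "rm_skew A"
  shows "rm_inner (rm_mult A B) C = - rm_inner (rm_mult A C) B"
proof -
  let ?l = Poly_Mapping.lookup
  have exp: "rm_inner (rm_mult A B) C = (\<Sum>i\<in>UNIV. \<Sum>j\<in>UNIV. \<Sum>k\<in>UNIV. ?l A (i, k) * ?l B (k, j) * ?l C (i, j))"
    for B C :: "'n rat_matrix"
  proof -
    have "rm_inner M C = (\<Sum>i\<in>UNIV. \<Sum>j\<in>UNIV. ?l M (i, j) * ?l C (i, j))" for M
      unfolding rm_inner_def sum.cartesian_product by (simp add: case_prod_unfold)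
    then show ?thesis by (simp add: sum_distrib_right)
  qed
  have "rm_inner (rm_mult A C) B = (\<Sum>i\<in>UNIV. \<Sum>k\<in>UNIV. \<Sum>j\<in>UNIV. ?l A (i, k) * ?l C (k, j) * ?l B (i, j))"
    unfolding exp by (rule sum.cong[OF refl], rule sum.swap)
  also have "\<dots> = (\<Sum>k\<in>UNIV. \<Sum>i\<in>UNIV. \<Sum>j\<in>UNIV. ?l A (i, k) * ?l C (k, j) * ?l B (i, j))"
    by (rule sum.swap)
  also have "\<dots> = (\<Sum>i\<in>UNIV. \<Sum>k\<in>UNIV. \<Sum>j\<in>UNIV. - (?l A (i, k) * ?l B (k, j) * ?l C (i, j)))"
  proof (intro sum.cong refl)
    fix i k j
    have "?l A (k, i) = - ?l A (i, k)" using assms unfolding rm_skew_def by blast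
    then show "?l A (k, i) * ?l C (i, j) * ?l B (k, j) = - (?l A (i, k) * ?l B (k, j) * ?l C (i, j))"
      by simp
  qed
  also have "\<dots> = - (\<Sum>i\<in>UNIV. \<Sum>k\<in>UNIV. \<Sum>j\<in>UNIV. ?l A (i, k) * ?l B (k, j) * ?l C (i, j))"
    by (simp add: sum_negf)
  also have "(\<Sum>i\<in>UNIV. \<Sum>k\<in>UNIV. \<Sum>j\<in>UNIV. ?l A (i, k) * ?l B (k, j) * ?l C (i, j)) = rm_inner (rm_mult A B) C"
    unfolding exp by (rule sum.cong[OF refl], rule sum.swap)
  finally show ?thesis by simp
qed

text \<open>The words span the associative algebra generated by \<open>S\<close>. They grow only on
  the left: the averaging uses stability under left multiplication by \<open>S\<close>, and the
  injectivity of the Casimir operator uses the presence of the identity.\<close>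

inductive_set rm_words :: "'n::finite rat_matrix set \<Rightarrow> 'n rat_matrix set" for S where
  one: "rm_one \<in> rm_words S"
| mult: "A \<in> S \<Longrightarrow> w \<in> rm_words S \<Longrightarrow> rm_mult A w \<in> rm_words S"

lemma rm_mult_span_words:
  assumes A: "A \<in> S" and x: "x \<in> ga.span (rm_words S)"
  shows "rm_mult A x \<in> ga.span (rm_words S)"
  using x
proof (induction rule: ga.span_induct_alt)
  case base
  have "rm_mult A 0 = 0" by (rule rat_matrix_eqI) simp
  then show ?case by (simp add: ga.span_zero)
next
  case (step c w y)
  have "rm_mult A (ga_scale c w + y) = ga_scale c (rm_mult A w) + rm_mult A y"
    by (rule rat_matrix_eqI) (simp add: lookup_add distrib_left sum.distrib sum_distrib_left mult_ac)
  then show ?case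
    using ga.span_add[OF ga.span_scale[OF ga.span_base[OF rm_words.mult[OF A step(1)]]] step(2)] by simp
qed

text \<open>The transpose of a word is, up to sign, the reversed word, again a product of matrices
  of \<open>S\<close>. Preservation of \<open>I\<close> by transposes is the form in which closure
  under transposition is used.\<close>

lemma rm_act_span_words:
  fixes I :: "('n::finite, 'f::field_char_0) group_algebra set"
  assumes I: "ga.subspace I" and inv: "\<And>A v. A \<in> S \<Longrightarrow> v \<in> I \<Longrightarrow> rm_act A v \<in> I"
    and skew: "\<And>A. A \<in> S \<Longrightarrow> rm_skew A"
    and x: "x \<in> ga.span (rm_words S)" and v: "v \<in> I"
  shows "rm_act x v \<in> I" "rm_act (rm_transpose x) v \<in> I"
proof -
  have word: "rm_act w v \<in> I \<and> rm_act (rm_transpose w) v \<in> I" if "w \<in> rm_words S" "v \<in> I" for w v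
    using that
  proof (induction arbitrary: v rule: rm_words.induct)
    case (mult A w)
    then show ?case
      using I inv[OF mult.hyps(1)]
      by (auto simp: rm_act_mult rm_transpose_mult_skew[OF skew] rm_act_scale_left simp del: ga.scale_minus_left
          intro!: ga.subspace_scale)
  qed simp
  show "rm_act x v \<in> I"
    using x by (induction rule: ga.span_induct_alt)
      (use I v word in \<open>auto simp: rm_act_add_left rm_act_scale_left intro!: ga.subspace_add ga.subspace_scale ga.subspace_0\<close>)
  show "rm_act (rm_transpose x) v \<in> I"
    using x by (induction rule: ga.span_induct_alt)
      (use I v word in \<open>auto simp: rm_transpose_add rm_transpose_scale rm_act_add_left rm_act_scale_left
        intro!: ga.subspace_add ga.subspace_scale ga.subspace_0\<close>)
qed

text \<open>The Casimir operator is positive definite over the rationals; applying rational-linear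
  functionals entrywise transfers its injectivity to every field of characteristic \<open>0\<close>.\<close>

lemma casimir_injective:
  fixes v :: "('n::finite, 'f::field_char_0) group_algebra"
  assumes fin: "finite B" and pos: "\<And>b. b \<in> B \<Longrightarrow> rm_inner b b > 0"
    and one: "rm_one = (\<Sum>b\<in>B. ga_scale (c b) b)"
    and 0: "(\<Sum>b\<in>B. ga_scale (inverse (of_rat (rm_inner b b))) (rm_act b (rm_act (rm_transpose b) v))) = 0"
  shows "v = 0"
proof (rule poly_mapping_eqI, rule ccontr)
  let ?l = Poly_Mapping.lookup
  fix i0 assume "?l v i0 \<noteq> ?l 0 i0"
  then have "?l v i0 \<noteq> 0" by simp
  then obtain f :: "'f \<Rightarrow> rat" where add: "\<And>x y. f (x + y) = f x + f y"
    and sc: "\<And>c x. f (of_rat c * x) = c * f x" and f1: "f (?l v i0) = 1"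
    by (rule field_hom_linear_functional[of of_rat, rotated 3]) (auto simp: of_rat_add of_rat_mult intro: that)
  have f0: "f 0 = 0" using add[of 0 0] by simp
  define F where "F w = Abs_poly_mapping (\<lambda>i. f (?l w i))" for w :: "('n, 'f) group_algebra"
  have lF [simp]: "?l (F w) i = f (?l w i)" for w i by (simp add: F_def)
  have F_act: "F (rm_act A w) = rm_act A (F w)" for A w
    by (rule poly_mapping_eqI) (simp add: linear_functional_sum[OF add] sc)
  have F_scale: "F (ga_scale (of_rat c) w) = ga_scale c (F w)" for c w
    by (rule poly_mapping_eqI) (simp add: sc)
  have F_sum: "F (sum g S) = (\<Sum>i\<in>S. F (g i))" for g and S :: "'n rat_matrix set"
    by (rule poly_mapping_eqI) (simp add: lookup_sum linear_functional_sum[OF add])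
  define u where "u = F v"
  \<comment> \<open>The Casimir operator has rational coefficients and so commutes with the
    entrywise functional; \<open>u\<close> satisfies the same equation over the rationals.\<close>
  have "0 = F 0" by (rule poly_mapping_eqI) (simp add: f0)
  also have "\<dots> = (\<Sum>b\<in>B. ga_scale (inverse (rm_inner b b)) (rm_act b (rm_act (rm_transpose b) u)))"
    unfolding 0[symmetric] F_sum of_rat_inverse[symmetric] F_scale F_act u_def ..
  finally have cu: "(\<Sum>b\<in>B. ga_scale (inverse (rm_inner b b)) (rm_act b (rm_act (rm_transpose b) u))) = 0" ..
  have adj: "rm_inner (rm_act b w) u = rm_inner w (rm_act (rm_transpose b) u)" for b w
  proof -
    have "rm_inner (rm_act b w) u = (\<Sum>i\<in>UNIV. \<Sum>j\<in>UNIV. ?l b (i, j) * ?l w j * ?l u i)"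
      by (simp add: rm_inner_def sum_distrib_right)
    also have "\<dots> = (\<Sum>j\<in>UNIV. \<Sum>i\<in>UNIV. ?l b (i, j) * ?l w j * ?l u i)" by (rule sum.swap)
    finally show ?thesis by (simp add: rm_inner_def sum_distrib_left mult_ac)
  qed
  \<comment> \<open>Pairing the Casimir operator applied to \<open>u\<close> with \<open>u\<close>
    gives a combination, with positive coefficients, of the squared norms of all
    \<open>b\<^sup>T u\<close>.\<close>
  have "0 = rm_inner (\<Sum>b\<in>B. ga_scale (inverse (rm_inner b b)) (rm_act b (rm_act (rm_transpose b) u))) u"
    unfolding cu by (simp add: rm_inner_def)
  also have "\<dots> = (\<Sum>b\<in>B. inverse (rm_inner b b) * rm_inner (rm_act (rm_transpose b) u) (rm_act (rm_transpose b) u))"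
    by (simp only: rm_inner_sum rm_inner_scale adj)
  finally have sum0: "(\<Sum>b\<in>B. inverse (rm_inner b b) * rm_inner (rm_act (rm_transpose b) u) (rm_act (rm_transpose b) u)) = 0" ..
  have nn: "inverse (rm_inner b b) * rm_inner (rm_act (rm_transpose b) u) (rm_act (rm_transpose b) u) \<ge> 0"
    if "b \<in> B" for b
    using pos[OF that] rm_inner_nonneg by (intro mult_nonneg_nonneg) auto
  have "\<forall>b\<in>B. inverse (rm_inner b b) * rm_inner (rm_act (rm_transpose b) u) (rm_act (rm_transpose b) u) = 0"
    using sum0 sum_nonneg_eq_0_iff[OF fin nn] by simp
  then have tb: "rm_act (rm_transpose b) u = 0" if "b \<in> B" for b
    using that pos[OF that] rm_inner_eq_0_iff by (metis inverse_zero_imp_zero less_numeral_extra(3) mult_eq_0_iff)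
  \<comment> \<open>The identity matrix is a combination of \<open>B\<close>, so \<open>u\<close> is
    a combination of the vectors just shown to vanish.\<close>
  have "u = rm_act (rm_transpose (\<Sum>b\<in>B. ga_scale (c b) b)) u"
    unfolding one[symmetric] by simp
  also have "\<dots> = (\<Sum>b\<in>B. ga_scale (c b) (rm_act (rm_transpose b) u))"
    by (simp add: rm_transpose_sum rm_transpose_scale rm_act_sum_left rm_act_scale_left)
  also have "\<dots> = 0" using tb by simp
  finally have "?l u i0 = 0" by simp
  with f1 show False by (simp add: u_def)
qed

text \<open>Averaging a projection with dual bases of the algebra generated by \<open>S\<close> makes it equivariant.\<close>

lemma rm_casimir_average_commute:
  fixes p :: "('n::finite, 'f::field_char_0) group_algebra \<Rightarrow> ('n, 'f) group_algebra"
  assumes p: "\<And>x y. p (x + y) = p x + p y" "\<And>c x. p (ga_scale c x) = ga_scale c (p x)"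
    and pos: "\<And>b. b \<in> B \<Longrightarrow> rm_inner b b > 0"
    and skew: "rm_skew A"
    and exp: "\<And>b. b \<in> B \<Longrightarrow> rm_mult A b = (\<Sum>b'\<in>B. ga_scale (rm_inner (rm_mult A b) b' / rm_inner b' b') b')"
  defines "T \<equiv> (\<lambda>v. \<Sum>b\<in>B. ga_scale (inverse (of_rat (rm_inner b b))) (rm_act b (p (rm_act (rm_transpose b) v))))"
  shows "T (rm_act A v) = rm_act A (T v)"
proof -
  let ?m = "\<lambda>b b'. of_rat (rm_inner (rm_mult A b) b') :: 'f"
  let ?n = "\<lambda>b. of_rat (rm_inner b b) :: 'f"
  let ?t = "\<lambda>b b'. rm_act b' (p (rm_act (rm_transpose b) v))"
  have p0: "p 0 = 0" using p(2)[of 0 0] by simp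
  have p_sum: "p (sum f S) = (\<Sum>i\<in>S. p (f i))" for f and S :: "'n rat_matrix set"
    by (induction S rule: infinite_finite_induct) (auto simp: p p0)
  have "rm_act A (T v) = (\<Sum>b\<in>B. ga_scale (inverse (?n b)) (rm_act (rm_mult A b) (p (rm_act (rm_transpose b) v))))"
    by (simp add: T_def rm_act_sum_right rm_act_scale_right rm_act_mult)
  also have "\<dots> = (\<Sum>b\<in>B. \<Sum>b'\<in>B. ga_scale (inverse (?n b) * (?m b b' / ?n b')) (?t b b'))"
  proof (rule sum.cong[OF refl])
    fix b assume b: "b \<in> B"
    have "rm_act (rm_mult A b) w = (\<Sum>b'\<in>B. ga_scale (?m b b' / ?n b') (rm_act b' w))" for w
      using arg_cong[OF exp[OF b], of "\<lambda>M. rm_act M w"]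
      by (simp add: rm_act_sum_left rm_act_scale_left of_rat_divide)
    then show "ga_scale (inverse (?n b)) (rm_act (rm_mult A b) (p (rm_act (rm_transpose b) v)))
      = (\<Sum>b'\<in>B. ga_scale (inverse (?n b) * (?m b b' / ?n b')) (?t b b'))"
      by (simp add: ga.scale_sum_right)
  qed
  also have "\<dots> = (\<Sum>b'\<in>B. \<Sum>b\<in>B. ga_scale (inverse (?n b) * (?m b b' / ?n b')) (?t b b'))"
    by (rule sum.swap)
  \<comment> \<open>Skewness of left multiplication by \<open>A\<close> exchanges the roles of
    \<open>b\<close> and \<open>b'\<close> at the cost of a sign, which moves \<open>A\<close> from
    the outer side of \<open>p\<close> to the inner one.\<close>
  also have "\<dots> = (\<Sum>b'\<in>B. \<Sum>b\<in>B. ga_scale (inverse (?n b') * (- (?m b' b / ?n b))) (?t b b'))"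
  proof (intro sum.cong refl arg_cong2[of _ _ _ _ ga_scale])
    fix b' b
    have "?m b b' = - ?m b' b" by (simp only: rm_inner_mult_skew[OF skew, of b b'] of_rat_minus)
    then show "inverse (?n b) * (?m b b' / ?n b') = inverse (?n b') * (- (?m b' b / ?n b))"
      by (simp add: divide_inverse mult_ac)
  qed
  also have "\<dots> = T (rm_act A v)"
    unfolding T_def
  proof (rule sum.cong[OF refl])
    fix b' assume b': "b' \<in> B"
    \<comment> \<open>Since \<open>A\<close> is skew, \<open>b'\<^sup>T\<close> times
      \<open>A\<close> is minus the transpose of \<open>rm_mult A b'\<close>, which is expanded
      again in the orthogonal basis; this accounts for the sign.\<close>
    have "rm_act (rm_transpose b') (rm_act A v) = rm_act (ga_scale (-1) (rm_transpose (rm_mult A b'))) v"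
      unfolding rm_transpose_mult_skew[OF skew] rm_act_mult[symmetric] by simp
    also have "rm_transpose (rm_mult A b') = (\<Sum>b\<in>B. ga_scale (rm_inner (rm_mult A b') b / rm_inner b b) (rm_transpose b))"
      by (subst exp[OF b']) (simp add: rm_transpose_sum rm_transpose_scale)
    also have "rm_act (ga_scale (-1) \<dots>) v = (\<Sum>b\<in>B. ga_scale (- (?m b' b / ?n b)) (rm_act (rm_transpose b) v))"
      unfolding ga.scale_sum_right ga.scale_scale rm_act_sum_left rm_act_scale_left
      by (simp add: of_rat_minus of_rat_divide)
    finally show "(\<Sum>b\<in>B. ga_scale (inverse (?n b') * (- (?m b' b / ?n b))) (?t b b'))
      = ga_scale (inverse (?n b')) (rm_act b' (p (rm_act (rm_transpose b') (rm_act A v))))"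
      by (simp only: p_sum p rm_act_sum_right rm_act_scale_right ga.scale_sum_right ga.scale_scale)
  qed
  finally show ?thesis ..
qed

text \<open>On \<open>I\<close> the average \<open>T\<close> is the Casimir operator, injective and
  hence bijective. The projection is \<open>T\<close> followed by the inverse of this restriction:
  \<open>R x\<close> is the unique element of \<open>I\<close> with \<open>T (R x) = T x\<close>,
  and uniqueness yields linearity and equivariance.\<close>

lemma rational_skew_invariant_projection:
  fixes I :: "('n::finite, 'f::field_char_0) group_algebra set"
  assumes I: "ga.subspace I" and inv: "\<And>A v. A \<in> S \<Longrightarrow> v \<in> I \<Longrightarrow> rm_act A v \<in> I"
    and skew: "\<And>A. A \<in> S \<Longrightarrow> rm_skew A"
  obtains R where "\<And>x y. R (x + y) = R x + R y" "\<And>c x. R (ga_scale c x) = ga_scale c (R x)"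
    "\<And>x. R x \<in> I" "\<And>x. x \<in> I \<Longrightarrow> R x = x" "\<And>A x. A \<in> S \<Longrightarrow> R (rm_act A x) = rm_act A (R x)"
proof -
  define E where "E = ga.span (rm_words S)"
  have subE: "ga.subspace E" unfolding E_def by (rule ga.subspace_span)
  obtain B where B: "finite B" "B \<subseteq> E" and pos: "\<And>b. b \<in> B \<Longrightarrow> rm_inner b b > 0"
    and exp: "\<And>x. x \<in> E \<Longrightarrow> x = (\<Sum>b\<in>B. ga_scale (rm_inner x b / rm_inner b b) b)"
    by (rule orthogonal_basis_exists[OF subE]) (rule that)
  have one: "rm_one \<in> E" unfolding E_def by (intro ga.span_base rm_words.one)
  have I_act: "rm_act b v \<in> I" "rm_act (rm_transpose b) v \<in> I" if "b \<in> B" "v \<in> I" for b v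
    using rm_act_span_words[OF I inv skew _ that(2)] that(1) B(2) unfolding E_def by blast+
  obtain p where p: "\<And>x y. p (x + y) = p x + p y" "\<And>c x. p (ga_scale c x) = ga_scale c (p x)"
    and pI: "\<And>x. p x \<in> I" and pid: "\<And>x. x \<in> I \<Longrightarrow> p x = x"
    using ga_subspace_projection[OF I] by blast
  define T where "T v = (\<Sum>b\<in>B. ga_scale (inverse (of_rat (rm_inner b b))) (rm_act b (p (rm_act (rm_transpose b) v))))" for v
  have T_add: "T (x + y) = T x + T y" for x y
    by (simp add: T_def rm_act_add_right p ga.scale_right_distrib sum.distrib)
  have T_scale: "T (ga_scale c x) = ga_scale c (T x)" for c x
    by (simp add: T_def rm_act_scale_right p ga.scale_sum_right mult.commute)
  have T_I: "T x \<in> I" for x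
    unfolding T_def using I I_act pI by (intro ga.subspace_sum ga.subspace_scale) auto
  have T_comm: "T (rm_act A x) = rm_act A (T x)" if A: "A \<in> S" for A x
    unfolding T_def
  proof (rule rm_casimir_average_commute[OF p pos skew[OF A]])
    fix b assume "b \<in> B"
    then have "rm_mult A b \<in> E" using B(2) rm_mult_span_words[OF A] unfolding E_def by blast
    then show "rm_mult A b = (\<Sum>b'\<in>B. ga_scale (rm_inner (rm_mult A b) b' / rm_inner b' b') b')" by (rule exp)
  qed
  have T_inj: "x = 0" if x: "x \<in> I" "T x = 0" for x
  proof (rule casimir_injective[OF B(1) pos exp[OF one]])
    show "(\<Sum>b\<in>B. ga_scale (inverse (of_rat (rm_inner b b))) (rm_act b (rm_act (rm_transpose b) x))) = 0"
      using x(2) I_act(2)[OF _ x(1)] by (simp add: T_def pid)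
  qed
  have T_inj2: "x = y" if "x \<in> I" "y \<in> I" "T x = T y" for x y
  proof -
    have "T (x + ga_scale (-1) y) = T x + ga_scale (-1) (T y)" by (simp only: T_add T_scale)
    then have "T (x - y) = 0" using that(3) by simp
    moreover have "x - y \<in> I" using I that(1,2) by (rule ga.subspace_diff)
    ultimately have "x - y = 0" by (rule T_inj[rotated])
    then show ?thesis by simp
  qed
  have "T ` I = I"
    by (rule ga_injective_imp_surjective_on[OF I T_add T_scale]) (use T_I T_inj in auto)
  then have "\<exists>a. a \<in> I \<and> T a = T x" for x using T_I[of x] by (metis imageE)
  then obtain R where P: "\<And>x. R x \<in> I" "\<And>x. T (R x) = T x" by metis
  show ?thesis
  proof
    show "R (x + y) = R x + R y" for x y
      by (rule T_inj2[OF P(1) ga.subspace_add[OF I P(1) P(1)]]) (simp only: T_add P(2))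
    show "R (ga_scale c x) = ga_scale c (R x)" for c x
      by (rule T_inj2[OF P(1) ga.subspace_scale[OF I P(1)]]) (simp only: T_scale P(2))
    show "R x \<in> I" for x by (rule P(1))
    show "R x = x" if "x \<in> I" for x by (rule T_inj2[OF P(1) that P(2)])
    show "R (rm_act A x) = rm_act A (R x)" if "A \<in> S" for A x
      by (rule T_inj2[OF P(1) inv[OF that P(1)]]) (simp only: T_comm[OF that] P(2))
  qed
qed

context twisted_group_algebra
begin

section \<open>The adjoint representation in a rescaled basis\<close>

definition sqrt_alpha_inv :: "'g \<Rightarrow> 'k alg_closure" where
  "sqrt_alpha_inv g = (SOME x. x ^ 2 = inverse (to_ac (\<alpha> g)))"

lemma sqrt_alpha_inv_square: "sqrt_alpha_inv g ^ 2 = inverse (to_ac (\<alpha> g))"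
proof -
  have "\<exists>x :: 'k alg_closure. x ^ 2 = inverse (to_ac (\<alpha> g))"
    by (rule nth_root_exists) simp
  then show ?thesis unfolding sqrt_alpha_inv_def by (rule someI_ex)
qed

lemma sqrt_alpha_inv_nonzero [simp]: "sqrt_alpha_inv g \<noteq> 0"
  using sqrt_alpha_inv_square[of g] by auto

text \<open>The cocycle of the basis \<open>s g * g\<close> of the group algebra over the algebraic closure,
  where \<open>s = sqrt_alpha_inv\<close>; it takes values in \<open>{1, -1}\<close>.\<close>

definition cocycle :: "'g \<Rightarrow> 'g \<Rightarrow> 'k alg_closure" where
  "cocycle g h = sqrt_alpha_inv (g + h) / (sqrt_alpha_inv g * sqrt_alpha_inv h)"

definition cocycle_sign :: "'g \<Rightarrow> 'g \<Rightarrow> rat" where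
  "cocycle_sign g h = (if cocycle g h = 1 then 1 else -1)"

lemma cocycle_square: "cocycle g h * cocycle g h = 1"
proof -
  have "cocycle g h ^ 2 = 1"
    unfolding cocycle_def power_divide power_mult_distrib sqrt_alpha_inv_square by (simp add: alpha_add)
  then show ?thesis by (simp add: power2_eq_square)
qed

lemma of_rat_cocycle_sign: "of_rat (cocycle_sign g h) = cocycle g h"
proof -
  have "(cocycle g h - 1) * (cocycle g h + 1) = 0"
    using cocycle_square[of g h] by (simp add: algebra_simps)
  then show ?thesis by (auto simp: cocycle_sign_def add_eq_0_iff2)
qed

text \<open>In the rescaled basis, this is the matrix of the bracket with
  \<open>sqrt_alpha_inv h\<close> times \<open>h - \<alpha> h \<cdot> h\<^sup>-\<^sup>1\<close>. The
  four terms come from left multiplication by \<open>h\<close> and by its inverse, and from right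
  multiplication by \<open>h\<close> and by its inverse, the factor \<open>\<alpha> h\<close> being
  absorbed by the rescaling. The members of each pair are negative transposes of each other.\<close>

definition ad_matrix :: "'g \<Rightarrow> 'g rat_matrix" where
  "ad_matrix h = Abs_poly_mapping (\<lambda>(g, j). (if g = h + j then cocycle_sign h j else 0)
    - (if j = h + g then cocycle_sign h g else 0) - (if g = j + h then cocycle_sign j h else 0)
    + (if j = g + h then cocycle_sign g h else 0))"

lemma rm_skew_ad_matrix: "rm_skew (ad_matrix h)"
  by (simp add: rm_skew_def ad_matrix_def)

text \<open>The prefactor converts rescaled coordinates into coefficients in the group basis, where
  the four terms become those of the bracket with
  \<open>h - \<alpha> h \<cdot> h\<^sup>-\<^sup>1\<close>. The relation
  \<open>\<alpha> h * (s h * s h) = 1\<close> restores the factor \<open>\<alpha> h\<close> in the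
  two terms of the inverse.\<close>

lemma ad_matrix_action:
  fixes w :: "('g, 'k alg_closure) group_algebra" and h :: 'g
  defines "s \<equiv> sqrt_alpha_inv" and "l \<equiv> Poly_Mapping.lookup w"
  shows "s g / s h * Poly_Mapping.lookup (rm_act (ad_matrix h) w) g
    = s (- h + g) * l (- h + g) - to_ac (\<alpha> h) * (s (h + g) * l (h + g))
      - s (g - h) * l (g - h) + to_ac (\<alpha> h) * (s (g + h) * l (g + h))"
proof -
  have s0: "s x \<noteq> 0" for x by (simp add: s_def)
  have e1: "g = h + j \<longleftrightarrow> j = - h + g" and e2: "g = j + h \<longleftrightarrow> j = g - h" for j
    by (metis add.assoc add_0 left_minus right_minus) (metis add_diff_cancel diff_add_cancel)
  have "Poly_Mapping.lookup (rm_act (ad_matrix h) w) g = (\<Sum>j\<in>UNIV.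
      (if j = - h + g then cocycle h j * l j else 0) - (if j = h + g then cocycle h g * l j else 0)
      - (if j = g - h then cocycle j h * l j else 0) + (if j = g + h then cocycle g h * l j else 0))"
    unfolding lookup_rm_act l_def
    by (intro sum.cong refl)
      (simp add: ad_matrix_def e1 e2 of_rat_add of_rat_diff of_rat_cocycle_sign algebra_simps)
  also have "\<dots> = cocycle h (- h + g) * l (- h + g) - cocycle h g * l (h + g)
      - cocycle (g - h) h * l (g - h) + cocycle g h * l (g + h)"
    by (simp add: sum.distrib sum_subtractf)
  finally have act: "Poly_Mapping.lookup (rm_act (ad_matrix h) w) g
    = cocycle h (- h + g) * l (- h + g) - cocycle h g * l (h + g)
      - cocycle (g - h) h * l (g - h) + cocycle g h * l (g + h)" .
  have hg: "h + (- h + g) = g" by (simp add: add.assoc[symmetric])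
  have ca: "to_ac (\<alpha> h) * (s h * s h) = 1"
    using sqrt_alpha_inv_square[of h] by (simp add: s_def power2_eq_square)
  have c1: "s g / s h * cocycle h (- h + g) = s (- h + g)"
  proof -
    have "cocycle h (- h + g) * (s h * s (- h + g)) = s g"
      by (simp add: cocycle_def s_def hg)
    then have "s g * cocycle h (- h + g) = cocycle h (- h + g) * cocycle h (- h + g) * (s h * s (- h + g))"
      by (simp add: mult_ac)
    then show ?thesis using s0[of h] by (simp add: cocycle_square field_simps)
  qed
  have c3: "s g / s h * cocycle (g - h) h = s (g - h)"
  proof -
    have "cocycle (g - h) h * (s (g - h) * s h) = s g"
      by (simp add: cocycle_def s_def)
    then have "s g * cocycle (g - h) h = cocycle (g - h) h * cocycle (g - h) h * (s (g - h) * s h)"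
      by (simp add: mult_ac)
    then show ?thesis using s0[of h] by (simp add: cocycle_square field_simps)
  qed
  have c2: "s g / s h * cocycle h g = to_ac (\<alpha> h) * s (h + g)"
  proof -
    have "s g / s h * cocycle h g = (to_ac (\<alpha> h) * (s h * s h)) * (s g / s h * cocycle h g)" by (simp add: ca)
    also have "\<dots> = to_ac (\<alpha> h) * s (h + g)" using s0 by (simp add: cocycle_def s_def)
    finally show ?thesis .
  qed
  have c4: "s g / s h * cocycle g h = to_ac (\<alpha> h) * s (g + h)"
  proof -
    have "s g / s h * cocycle g h = (to_ac (\<alpha> h) * (s h * s h)) * (s g / s h * cocycle g h)" by (simp add: ca)
    also have "\<dots> = to_ac (\<alpha> h) * s (g + h)" using s0 by (simp add: cocycle_def s_def)
    finally show ?thesis .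
  qed
  show ?thesis
    unfolding act right_diff_distrib distrib_left mult.assoc[symmetric] c1 c2 c3 c4 ..
qed

definition L_generator :: "'g \<Rightarrow> ('g, 'k) group_algebra" where
  "L_generator h = basis_elem h - ga_scale (\<alpha> h) (basis_elem (- h))"

lemma lookup_ad_L_generator:
  "Poly_Mapping.lookup (lie_bracket (L_generator h) a) g
    = Poly_Mapping.lookup a (- h + g) - \<alpha> h * Poly_Mapping.lookup a (h + g)
      - Poly_Mapping.lookup a (g - h) + \<alpha> h * Poly_Mapping.lookup a (g + h)"
  by (simp add: lie_bracket_def L_generator_def left_diff_distrib right_diff_distrib lookup_minus
      ga_scale_times_left ga_scale_times_right lookup_basis_times lookup_times_basis)

text \<open>Coordinates over the closure with respect to the multiples of \<open>g\<close> by
  \<open>sqrt_alpha_inv g\<close>, whence the division.\<close>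

definition to_coords :: "('g, 'k) group_algebra \<Rightarrow> ('g, 'k alg_closure) group_algebra" where
  "to_coords a = Abs_poly_mapping (\<lambda>g. to_ac (Poly_Mapping.lookup a g) / sqrt_alpha_inv g)"

lemma lookup_to_coords [simp]:
  "Poly_Mapping.lookup (to_coords a) g = to_ac (Poly_Mapping.lookup a g) / sqrt_alpha_inv g"
  by (simp add: to_coords_def)

lemma to_coords_add: "to_coords (a + b) = to_coords a + to_coords b"
  by (rule poly_mapping_eqI) (simp add: lookup_add add_divide_distrib)

lemma to_coords_scale: "to_coords (ga_scale c a) = ga_scale (to_ac c) (to_coords a)"
  by (rule poly_mapping_eqI) simp

lemma to_coords_ad:
  "rm_act (ad_matrix h) (to_coords a) = ga_scale (sqrt_alpha_inv h) (to_coords (lie_bracket (L_generator h) a))"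
proof (rule poly_mapping_eqI)
  fix g
  have "sqrt_alpha_inv g / sqrt_alpha_inv h * Poly_Mapping.lookup (rm_act (ad_matrix h) (to_coords a)) g
    = to_ac (Poly_Mapping.lookup (lie_bracket (L_generator h) a) g)"
    unfolding ad_matrix_action lookup_ad_L_generator by simp
  then show "Poly_Mapping.lookup (rm_act (ad_matrix h) (to_coords a)) g
    = Poly_Mapping.lookup (ga_scale (sqrt_alpha_inv h) (to_coords (lie_bracket (L_generator h) a))) g"
    by (simp only: lookup_ga_scale lookup_to_coords flip: \<open>_ = to_ac _\<close>) (simp del: lookup_rm_act)
qed

text \<open>The invariant projection exists over the algebraic closure in the coordinates above; a linear
  functional brings it back to the base field.\<close>

lemma ideal_projection:
  assumes I: "lie_ideal (L_alg \<alpha>) I"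
  obtains R where "\<And>x y. R (x + y) = R x + R y" "\<And>c x. R (ga_scale c x) = ga_scale c (R x)"
    "\<And>x. R x \<in> I" "\<And>x. x \<in> I \<Longrightarrow> R x = x"
    "\<And>a x. a \<in> L_alg \<alpha> \<Longrightarrow> R (lie_bracket a x) = lie_bracket a (R x)"
proof -
  have Isub: "ga.subspace I" and Iinv: "\<And>a b. a \<in> L_alg \<alpha> \<Longrightarrow> b \<in> I \<Longrightarrow> lie_bracket a b \<in> I"
    using I by (auto simp: lie_ideal_def)
  have gen: "L_generator h \<in> L_alg \<alpha>" for h
    unfolding L_alg_def L_generator_def by (rule ga.span_base) blast
  \<comment> \<open>The extension of scalars of the ideal to the closure, in rescaled
    coordinates.\<close>
  define IK where "IK = ga.span (to_coords ` I)"
  have IKsub: "ga.subspace IK" unfolding IK_def by (rule ga.subspace_span)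
  have act: "rm_act A v \<in> IK" if A: "A \<in> range ad_matrix" and v: "v \<in> IK" for A v
    using v unfolding IK_def
  proof (induction rule: ga.span_induct_alt)
    case base
    then show ?case by (simp add: ga.span_zero)
  next
    case (step c x y)
    obtain h a where h: "A = ad_matrix h" "x = to_coords a" "a \<in> I" using A step(1) by blast
    have "rm_act A x \<in> ga.span (to_coords ` I)"
      unfolding h(1,2) to_coords_ad using Iinv[OF gen h(3)] by (intro ga.span_scale ga.span_base imageI)
    then show ?case
      using step(2) by (simp only: rm_act_add_right rm_act_scale_right ga.span_add ga.span_scale)
  qed
  obtain P where P_add: "\<And>x y. P (x + y) = P x + P y" and P_scale: "\<And>c x. P (ga_scale c x) = ga_scale c (P x)"
    and P_IK: "\<And>x. P x \<in> IK" and P_id: "\<And>x. x \<in> IK \<Longrightarrow> P x = x"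
    and P_act: "\<And>A x. A \<in> range ad_matrix \<Longrightarrow> P (rm_act A x) = rm_act A (P x)"
    by (rule rational_skew_invariant_projection[OF IKsub act]) (auto simp: rm_skew_ad_matrix intro: that)
  obtain f :: "'k alg_closure \<Rightarrow> 'k" where f_add: "\<And>x y. f (x + y) = f x + f y"
    and f_scale: "\<And>c x. f (to_ac c * x) = c * f x" and f1: "f 1 = 1"
    by (rule field_hom_linear_functional[of to_ac "1 :: 'k alg_closure"]) (auto intro: that)
  have f_to_ac: "f (to_ac c) = c" for c using f_scale[of c 1] f1 by simp
  have f0: "f 0 = 0" using f_to_ac[of 0] by simp
  have f_diff: "f (x - y) = f x - f y" for x y using f_add[of "x - y" y] by simp
  \<comment> \<open>Undoes the rescaling and applies \<open>f\<close> to each coefficient; as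
    \<open>f 1 = 1\<close>, this is a base-linear left inverse of \<open>to_coords\<close>.\<close>
  define descend where "descend w = Abs_poly_mapping (\<lambda>g. f (sqrt_alpha_inv g * Poly_Mapping.lookup w g))" for w
  have lookup_descend [simp]: "Poly_Mapping.lookup (descend w) g = f (sqrt_alpha_inv g * Poly_Mapping.lookup w g)" for w g
    by (simp add: descend_def)
  have descend_add: "descend (x + y) = descend x + descend y" for x y
    by (rule poly_mapping_eqI) (simp add: lookup_add distrib_left f_add)
  have descend_scale: "descend (ga_scale (to_ac c) x) = ga_scale c (descend x)" for c x
    by (rule poly_mapping_eqI) (simp add: mult.left_commute[of _ "to_ac c"] f_scale)
  have descend_coords: "descend (ga_scale c (to_coords a)) = ga_scale (f c) a" for c a
  proof (rule poly_mapping_eqI)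
    fix g
    have eq: "sqrt_alpha_inv g * Poly_Mapping.lookup (ga_scale c (to_coords a)) g = to_ac (Poly_Mapping.lookup a g) * c"
      by simp
    show "Poly_Mapping.lookup (descend (ga_scale c (to_coords a))) g = Poly_Mapping.lookup (ga_scale (f c) a) g"
      unfolding lookup_descend eq f_scale by simp
  qed
  have descend_coords1: "descend (to_coords a) = a" for a using descend_coords[of 1 a] f1 by simp
  have descend_I: "descend v \<in> I" if "v \<in> IK" for v
    using that unfolding IK_def
  proof (induction rule: ga.span_induct_alt)
    case base
    have "descend 0 = 0" by (rule poly_mapping_eqI) (simp add: f0)
    then show ?case using Isub by (simp add: ga.subspace_0)
  next
    case (step c x y)
    then show ?case using Isub by (auto simp: descend_add descend_coords intro!: ga.subspace_add ga.subspace_scale)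
  qed
  \<comment> \<open>The bracket with \<open>L_generator h\<close> has coefficients in the base
    field, so the base-linear functional \<open>f\<close> passes through it.\<close>
  have descend_ad: "descend (ga_scale (inverse (sqrt_alpha_inv h)) (rm_act (ad_matrix h) w))
    = lie_bracket (L_generator h) (descend w)" for h w
  proof (rule poly_mapping_eqI)
    fix g
    have "sqrt_alpha_inv g * Poly_Mapping.lookup (ga_scale (inverse (sqrt_alpha_inv h)) (rm_act (ad_matrix h) w)) g
      = sqrt_alpha_inv g / sqrt_alpha_inv h * Poly_Mapping.lookup (rm_act (ad_matrix h) w) g"
      by (simp add: divide_inverse mult.assoc del: lookup_rm_act)
    then show "Poly_Mapping.lookup (descend (ga_scale (inverse (sqrt_alpha_inv h)) (rm_act (ad_matrix h) w))) g
      = Poly_Mapping.lookup (lie_bracket (L_generator h) (descend w)) g"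
      unfolding lookup_descend lookup_ad_L_generator by (simp only: ad_matrix_action f_add f_diff f_scale)
  qed
  define R where "R a = descend (P (to_coords a))" for a
  have R_add: "R (x + y) = R x + R y" for x y by (simp add: R_def to_coords_add P_add descend_add)
  have R_scale: "R (ga_scale c x) = ga_scale c (R x)" for c x
    by (simp add: R_def to_coords_scale P_scale descend_scale)
  have R_gen: "R (lie_bracket (L_generator h) x) = lie_bracket (L_generator h) (R x)" for h x
  proof -
    have "to_coords (lie_bracket (L_generator h) x)
      = ga_scale (inverse (sqrt_alpha_inv h)) (rm_act (ad_matrix h) (to_coords x))"
      by (simp add: to_coords_ad)
    then show ?thesis by (simp add: R_def P_scale P_act descend_ad)
  qed
  have R_L: "R (lie_bracket a x) = lie_bracket a (R x)" if "a \<in> L_alg \<alpha>" for a x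
    using that unfolding L_alg_def
  proof (induction rule: ga.span_induct_alt)
    case base
    have "R 0 = 0" using R_scale[of 0 0] by simp
    then show ?case by (simp add: lie_bracket_def)
  next
    case (step c b y)
    then obtain h where "b = L_generator h" by (auto simp: L_generator_def)
    have bracket: "lie_bracket (ga_scale c b + y) u = ga_scale c (lie_bracket b u) + lie_bracket y u" for u
      by (simp add: lie_bracket_def distrib_left distrib_right ga_scale_times_left ga_scale_times_right
          ga.scale_right_diff_distrib)
    show ?case
      unfolding bracket R_add R_scale step(2) unfolding \<open>b = L_generator h\<close> R_gen ..
  qed
  show ?thesis
  proof (rule that[of R])
    show "R x \<in> I" for x unfolding R_def by (rule descend_I[OF P_IK])
    show "R x = x" if "x \<in> I" for x
    proof -
      have "to_coords x \<in> IK" unfolding IK_def using that by (intro ga.span_base imageI)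
      then show ?thesis by (simp add: R_def P_id descend_coords1)
    qed
  qed (rule R_add R_scale R_L, assumption?)+
qed

text \<open>The complement of \<open>I\<close> is the kernel in \<open>L_alg \<alpha>\<close> of the
  equivariant projection, stable under brackets because the projection commutes with them.\<close>

lemma lie_reductive_L_alg: "lie_reductive (L_alg \<alpha>)"
  unfolding lie_reductive_def
proof (intro conjI allI impI)
  show "lie_subalgebra (L_alg \<alpha>)" by (rule lie_subalgebra_L_alg)
  fix I assume I: "lie_ideal (L_alg \<alpha>) I"
  then have IL: "I \<subseteq> L_alg \<alpha>" and Isub: "ga.subspace I" by (auto simp: lie_ideal_def)
  obtain R where R: "\<And>x y. R (x + y) = R x + R y" "\<And>c x. R (ga_scale c x) = ga_scale c (R x)"
    and RI: "\<And>x. R x \<in> I" "\<And>x. x \<in> I \<Longrightarrow> R x = x"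
    and R_L: "\<And>a x. a \<in> L_alg \<alpha> \<Longrightarrow> R (lie_bracket a x) = lie_bracket a (R x)"
    using ideal_projection[OF I] by blast
  have R0: "R 0 = 0" using R(2)[of 0 0] by simp
  define J where "J = {a \<in> L_alg \<alpha>. R a = 0}"
  have "lie_ideal (L_alg \<alpha>) J"
    unfolding lie_ideal_def
  proof (intro conjI ballI)
    show "ga.subspace J"
      using subspace_L_alg by (auto simp: ga.subspace_def J_def R R0)
    show "J \<subseteq> L_alg \<alpha>" by (auto simp: J_def)
    fix a b assume ab: "a \<in> L_alg \<alpha>" "b \<in> J"
    then have "lie_bracket a b \<in> L_alg \<alpha>"
      using lie_subalgebra_L_alg by (auto simp: lie_subalgebra_def J_def)
    then show "lie_bracket a b \<in> J"
      using ab by (simp add: J_def R_L) (simp add: lie_bracket_def)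
  qed
  moreover have "I \<inter> J = {0}"
    using RI(2) R0 Isub IL by (auto simp: J_def ga.subspace_0)
  moreover have "{a + b | a b. a \<in> I \<and> b \<in> J} = L_alg \<alpha>"
  proof
    show "{a + b | a b. a \<in> I \<and> b \<in> J} \<subseteq> L_alg \<alpha>"
      using IL subspace_L_alg by (auto simp: J_def intro: ga.subspace_add)
    show "L_alg \<alpha> \<subseteq> {a + b | a b. a \<in> I \<and> b \<in> J}"
    proof
      fix x assume x: "x \<in> L_alg \<alpha>"
      have "R (x - R x) + R (R x) = R x" using R(1)[of "x - R x" "R x"] by simp
      then have "R (x - R x) = 0" using RI by simp
      moreover have "x - R x \<in> L_alg \<alpha>" using x RI(1)[of x] IL subspace_L_alg by (auto intro: ga.subspace_diff)
      ultimately have "x - R x \<in> J" by (simp add: J_def)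
      then have "x = R x + (x - R x) \<and> R x \<in> I \<and> x - R x \<in> J" using RI(1) by simp
      then show "x \<in> {a + b | a b. a \<in> I \<and> b \<in> J}" by blast
    qed
  qed
  ultimately show "\<exists>J. lie_ideal (L_alg \<alpha>) J \<and> I \<inter> J = {0} \<and> {a + b | a b. a \<in> I \<and> b \<in> J} = L_alg \<alpha>"
    by blast
qed

end

theorem theorem1p3:
  fixes \<alpha> :: "'g::{finite, group_add} \<Rightarrow> 'k::field_char_0"
  assumes "\<forall>V :: 'g \<Rightarrow> 'k alg_closure mat. representation V \<longrightarrow> defined_over_base V"
    and "mult_character \<alpha>"
  shows "lie_subalgebra (L_alg \<alpha>) \<and> L_alg \<alpha> = M_alg \<alpha> \<and>
    lie_reductive (L_alg \<alpha>) \<and>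
    (orthogonal_planes \<alpha> = {} \<longrightarrow> lie_center (L_alg \<alpha>) = ga.span (class_elements \<alpha>)) \<and>
    lie_center (L_alg \<alpha>) =
      ga.span (class_elements \<alpha> \<union> (\<Union>V \<in> orthogonal_planes \<alpha>. osp_alg \<alpha> V))"
proof -
  interpret twisted_group_algebra \<alpha>
    using assms by unfold_locales auto
  show ?thesis
    using lie_subalgebra_L_alg L_alg_eq_M_alg lie_reductive_L_alg lie_center_L_alg by simp
qed

end
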